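(* Let $m\in\mathbb Z_{\ge0}$ and $J\subset[1,m-1]$. (a) Let $n\ge4m-1$ and suppose that $K\subset[2m+1,n-2m]$ and $n+1-K$ are weakly orthogonal (in type $A_n$). Then the assignments $\widehat T_1\mapsto T_{w_\circ^{[1,2m-1]\cup[n+2-2m,n]\cup K}}$, $\widehat T_2\mapsto T_{w_\circ^{[m+1,n-m]\cup J\cup(n+1-J)}}$ define a homomorphism $\mathrm{Br}^+(B_2)\to\mathrm{Br}^+(A_n)$. (b) Let $n\ge2m$ and $K\subset[2m+1,n]$. Then the assignments $\widehat T_1\mapsto T_{w_\circ^{[1,2m-1]\cup K}}$, $\widehat T_2\mapsto T_{w_\circ^{[m+1,n]\cup J}}$ define a homomorphism $\mathrm{Br}^+(B_2)\to\mathrm{Br}^+(B_n)$. (c) Let $n\ge2m$. Let $K\subset[2m+1,n+1]$ and, if $n-m$ is even, assume in addition that $K$ and $\tau(K)$ are weakly orthogonal (in type $D_{n+1}$), where $\tau$ is the transposition $(n,n+1)$. Then the assignments $\widehat T_1\mapsto T_{w_\circ^{[1,2m-1]\cup K}}$, $\widehat T_2\mapsto T_{w_\circ^{[m+1,n+1]\cup J}}$ define a homomorphism $\mathrm{Br}^+(B_2)\to\mathrm{Br}^+(D_{n+1})$.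
   Context: For integers $a\le b$, $[a,b]=\{a,\dots,b\}$, and $[a,b]=\emptyset$ if $a>b$; $c-K=\{c-k:k\in K\}$. For a Coxeter matrix $M=(m_{ij})_{i,j\in I}$, $\mathrm{Br}^+(M)$ is the Artin monoid with generators $T_i$, $i\in I$, and relations $T_iT_jT_i\cdots=T_jT_iT_j\cdots$ ($m_{ij}$ factors each), $i\neq j$. Coxeter matrices: $A_n$ ($n\ge1$) over $[1,n]$ with $m_{i,i+1}=3$; $B_n$ ($n\ge2$) over $[1,n]$ with $m_{i,i+1}=3$ for $i\le n-2$ and $m_{n-1,n}=4$; $D_{n+1}$ ($n\ge3$) over $[1,n+1]$ with $m_{i,i+1}=3$ for $1\le i\le n-1$ and $m_{n-1,n+1}=3$; all other off-diagonal entries equal $2$. $\mathrm{Br}^+(B_2)$ has generators $\widehat T_1,\widehat T_2$ and the relation $\widehat T_1\widehat T_2\widehat T_1\widehat T_2=\widehat T_2\widehat T_1\widehat T_2\widehat T_1$. For $w$ in the Coxeter group $W(M)$ with reduced expression $s_{i_1}\cdots s_{i_k}$, $T_w=T_{i_1}\cdots T_{i_k}$; $w_\circ^L$ is the longest element of the parabolic subgroup generated by $s_l$, $l\in L$. Subsets $J,K\subset I$ are orthogonal if $m_{jk}=2$ for all $j\in J$, $k\in K$; they are weakly orthogonal if $J\setminus K$ is orthogonal to $K$ and $K\setminus J$ is orthogonal to $J$.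
   Formalization: In (c) the extra assumption n+1 ∉ K is made when n = 2m; without it the claim is false, e.g. m = 2, n = 4, J = ∅, K = {5}, where node 5 is joined to node 3 in D_5 and the B_2 relation fails. *)

theory Defs
  imports "HOL-Algebra.Generated_Groups" "HOL-Combinatorics.Transposition"
begin

section \<open>Monoids given by generators and relations\<close>

inductive pres_cong :: "'i set \<Rightarrow> ('i list \<times> 'i list) set \<Rightarrow> 'i list \<Rightarrow> 'i list \<Rightarrow> bool"
  for I :: "'i set" and R :: "('i list \<times> 'i list) set" where
  rel: "(u, v) \<in> R \<Longrightarrow> set u \<subseteq> I \<Longrightarrow> set v \<subseteq> I \<Longrightarrow> set p \<subseteq> I \<Longrightarrow> set q \<subseteq> I
        \<Longrightarrow> pres_cong I R (p @ u @ q) (p @ v @ q)"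
| refl: "set u \<subseteq> I \<Longrightarrow> pres_cong I R u u"
| sym: "pres_cong I R u v \<Longrightarrow> pres_cong I R v u"
| trans: "pres_cong I R u v \<Longrightarrow> pres_cong I R v w \<Longrightarrow> pres_cong I R u w"

definition pres_class :: "'i set \<Rightarrow> ('i list \<times> 'i list) set \<Rightarrow> 'i list \<Rightarrow> 'i list set" where
  "pres_class I R u = {v. pres_cong I R u v}"

definition presented_monoid :: "'i set \<Rightarrow> ('i list \<times> 'i list) set \<Rightarrow> 'i list set monoid" where
  "presented_monoid I R =
     \<lparr>carrier = pres_class I R ` lists I,
      mult = (\<lambda>X Y. \<Union>u\<in>X. \<Union>v\<in>Y. pres_class I R (u @ v)),
      one = pres_class I R []\<rparr>"

section \<open>Coxeter matrices, Artin monoids and Coxeter groups\<close>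

text \<open>The entries \<open>bond M i j\<close> matter only for \<open>i\<close>, \<open>j\<close> in \<open>nodes M\<close>. The entry \<open>0\<close> encodes
  \<open>\<infinity>\<close>: the relations below are then trivial.\<close>

record 'i coxeter_matrix =
  nodes :: "'i set"
  bond :: "'i \<Rightarrow> 'i \<Rightarrow> nat"

fun alt_word :: "'i \<Rightarrow> 'i \<Rightarrow> nat \<Rightarrow> 'i list" where
  "alt_word i j 0 = []"
| "alt_word i j (Suc k) = i # alt_word j i k"

definition braid_relations :: "'i coxeter_matrix \<Rightarrow> ('i list \<times> 'i list) set" where
  "braid_relations M =
     {(alt_word i j (bond M i j), alt_word j i (bond M i j)) | i j.
        i \<in> nodes M \<and> j \<in> nodes M \<and> i \<noteq> j}"

definition artin_monoid :: "'i coxeter_matrix \<Rightarrow> 'i list set monoid" where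
  "artin_monoid M = presented_monoid (nodes M) (braid_relations M)"

definition artin_word :: "'i coxeter_matrix \<Rightarrow> 'i list \<Rightarrow> 'i list set" where
  "artin_word M u = pres_class (nodes M) (braid_relations M) u"

text \<open>The relations \<open>(s\<^sub>i s\<^sub>j)\<^bsup>m\<^esup> = 1\<close>, \<open>m = bond M i j\<close>. The diagonal ones, with
  \<open>bond M i i = 1\<close>, say \<open>s\<^sub>i s\<^sub>i = 1\<close>, so presenting the Coxeter group as a monoid or as a group
  gives the same result.\<close>

definition coxeter_relations :: "'i coxeter_matrix \<Rightarrow> ('i list \<times> 'i list) set" where
  "coxeter_relations M =
     {(concat (replicate (bond M i j) [i, j]), []) | i j. i \<in> nodes M \<and> j \<in> nodes M}"

definition coxeter_group :: "'i coxeter_matrix \<Rightarrow> 'i list set monoid" where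
  "coxeter_group M = presented_monoid (nodes M) (coxeter_relations M)"

definition coxeter_word :: "'i coxeter_matrix \<Rightarrow> 'i list \<Rightarrow> 'i list set" where
  "coxeter_word M u = pres_class (nodes M) (coxeter_relations M) u"

definition coxeter_length :: "'i coxeter_matrix \<Rightarrow> 'i list set \<Rightarrow> nat" where
  "coxeter_length M w = (LEAST k. \<exists>u \<in> lists (nodes M). coxeter_word M u = w \<and> length u = k)"

definition reduced_expression :: "'i coxeter_matrix \<Rightarrow> 'i list set \<Rightarrow> 'i list \<Rightarrow> bool" where
  "reduced_expression M w u \<longleftrightarrow>
     u \<in> lists (nodes M) \<and> coxeter_word M u = w \<and> length u = coxeter_length M w"

definition parabolic :: "'i coxeter_matrix \<Rightarrow> 'i set \<Rightarrow> 'i list set set" where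
  "parabolic M L = generate (coxeter_group M) ((\<lambda>l. coxeter_word M [l]) ` L)"

definition longest_element :: "'i coxeter_matrix \<Rightarrow> 'i set \<Rightarrow> 'i list set" where
  "longest_element M L = arg_max_on (coxeter_length M) (parabolic M L)"

text \<open>The canonical lift \<open>T\<^sub>w\<close>. By Matsumoto's theorem it does not depend on the reduced
  expression chosen.\<close>

definition artin_lift :: "'i coxeter_matrix \<Rightarrow> 'i list set \<Rightarrow> 'i list set" where
  "artin_lift M w = artin_word M (SOME u. reduced_expression M w u)"

definition orthogonal_nodes :: "'i coxeter_matrix \<Rightarrow> 'i set \<Rightarrow> 'i set \<Rightarrow> bool" where
  "orthogonal_nodes M J K \<longleftrightarrow> (\<forall>j\<in>J. \<forall>k\<in>K. bond M j k = 2)"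

definition weakly_orthogonal :: "'i coxeter_matrix \<Rightarrow> 'i set \<Rightarrow> 'i set \<Rightarrow> bool" where
  "weakly_orthogonal M J K \<longleftrightarrow> orthogonal_nodes M (J - K) K \<and> orthogonal_nodes M (K - J) J"

section \<open>The classical types\<close>

text \<open>The indices of the types are the ranks, so the type written \<open>D\<^bsub>n+1\<^esub>\<close> is \<open>type_D (n + 1)\<close>.
  They make sense for \<open>type_A r\<close> with \<open>r \<ge> 1\<close>, \<open>type_B r\<close> with \<open>r \<ge> 2\<close> and \<open>type_D r\<close> with
  \<open>r \<ge> 4\<close>.\<close>

definition type_A :: "int \<Rightarrow> int coxeter_matrix" where
  "type_A r = \<lparr>nodes = {1..r},
     bond = (\<lambda>i j. if i = j then 1 else if \<bar>i - j\<bar> = 1 then 3 else 2)\<rparr>"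

definition type_B :: "int \<Rightarrow> int coxeter_matrix" where
  "type_B r = \<lparr>nodes = {1..r},
     bond = (\<lambda>i j. if i = j then 1
                   else if {i, j} = {r - 1, r} then 4
                   else if \<bar>i - j\<bar> = 1 then 3 else 2)\<rparr>"

definition type_D :: "int \<Rightarrow> int coxeter_matrix" where
  "type_D r = \<lparr>nodes = {1..r},
     bond = (\<lambda>i j. if i = j then 1
                   else if {i, j} = {r - 2, r} then 3
                   else if \<bar>i - j\<bar> = 1 \<and> max i j \<le> r - 1 then 3 else 2)\<rparr>"

section \<open>Homomorphisms from the Artin monoid of type B2\<close>

text \<open>The assignments of \<open>x1\<close> and \<open>x2\<close> to the two generators define a homomorphism of monoids;
  \<open>hom\<close> does not include preservation of the unit.\<close>

definition defines_B2_hom :: "('a, 'b) monoid_scheme \<Rightarrow> 'a \<Rightarrow> 'a \<Rightarrow> bool" where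
  "defines_B2_hom H x1 x2 \<longleftrightarrow>
     (\<exists>\<phi> \<in> hom (artin_monoid (type_B 2)) H.
        \<phi> \<one>\<^bsub>artin_monoid (type_B 2)\<^esub> = \<one>\<^bsub>H\<^esub> \<and>
        \<phi> (artin_word (type_B 2) [1]) = x1 \<and> \<phi> (artin_word (type_B 2) [2]) = x2)"

text \<open>A pitfall in type \<open>D\<^bsub>n+1\<^esub>\<close>: the nodes \<open>n - 1\<close> and \<open>n + 1\<close> are joined, so if \<open>n = 2m\<close> then
  a set \<open>K \<subseteq> {2m+1..n+1}\<close> containing \<open>n + 1\<close> is not orthogonal to \<open>{1..2m-1}\<close>. In all other cases,
  and in types \<open>A\<close> and \<open>B\<close>, the corresponding sets are orthogonal. The relation fails for instance
  for \<open>m = 2\<close>, \<open>n = 4\<close>, \<open>K = {5}\<close>, so the theorem excludes \<open>n + 1 \<in> K\<close> if \<open>n = 2m\<close>.\<close>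

end

theory Submission
  imports Defs
begin

text \<open>By Matsumoto's theorem the two images are the words \<open>D \<kappa>\<close> and \<open>Y \<iota>\<close>, where \<open>D\<close> is the half twist of
  the chain \<open>[1, 2m - 1]\<close> (doubled in type \<open>A\<close>), \<open>Y\<close> is the longest word of the end of the diagram from
  \<open>m + 1\<close> on (in type \<open>A\<close>, of \<open>[m + 1, n - m]\<close>), and \<open>\<kappa>\<close>, \<open>\<iota>\<close> are longest words for \<open>K\<close> and for \<open>J\<close>
  (together with its reflection in type \<open>A\<close>).
  Since \<open>D\<close> moves \<open>\<iota>\<close> into the part on which \<open>Y\<close> acts by a diagram automorphism, and \<open>\<kappa>\<close> commutes
  with its image under that automorphism, it suffices to show \<open>D Y D Y = Y D Y D\<close>.

  In type \<open>B\<close>, \<open>Y\<close> is the product of the commuting Jucys-Murphy elements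
  \<open>y\<^sub>i = T\<^sub>i \<cdots> T\<^sub>n \<cdots> T\<^sub>i\<close>, \<open>i > m\<close>, and the recursion \<open>y\<^sub>i = T\<^sub>i y\<^bsub>i+1\<^esub> T\<^sub>i\<close> gives
  \<open>D y\<^bsub>m+1\<^esub> \<cdots> y\<^bsub>2m\<^esub> D = y\<^sub>1 \<cdots> y\<^sub>m \<Delta>\<^sub>1\<^sup>2 \<Delta>\<^sub>2\<^sup>2\<close> with \<open>\<Delta>\<^sub>1\<close>, \<open>\<Delta>\<^sub>2\<close> the half twists of
  \<open>[1, m - 1]\<close> and \<open>[m + 1, 2m - 1]\<close>. Every factor on the right commutes with \<open>Y\<close>.
  Types \<open>A\<close> and \<open>D\<close> fold onto type \<open>B\<close>, and the same computation applies.\<close>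

section \<open>Presented monoids\<close>

text \<open>The canonical lift picks its reduced expression by choice, so it can be identified only
  after Matsumoto's theorem, and that theorem needs the exact order of each product of two
  generators. Both these orders and the reducedness of the explicit words are read off from
  permutations of signed integers, with a height that every generator changes by at most one. The
  main identity must be reached without inverses. Words therefore become operators, and
  \<open>y i\<close> enters through \<open>y i = T i y (i + 1) T i\<close> instead of a conjugation.
  The squared half twists in \<open>D Y D\<close> are a remainder: when the last \<open>m\<close>
  operators on \<open>[1, 2m]\<close> are moved to its start, the crossings between the two blocks
  are absorbed by this recursion, while those inside a block survive and occur twice. In type A the
  half twist of a symmetric interval is a product of nested reflections, which play the role of the
  \<open>y i\<close>. In type D the last generator of the chain is the product of the two tail
  generators, and each \<open>y i\<close> with \<open>i < n\<close> exchanges these two; hence the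
  parity of \<open>n - m\<close> decides whether \<open>K\<close> has to be compared with its
  image.\<close>

lemma pres_cong_sets: "pres_cong I R u v \<Longrightarrow> set u \<subseteq> I \<and> set v \<subseteq> I"
  by (induction rule: pres_cong.induct) auto

lemma pres_cong_context:
  assumes "pres_cong I R u v" "set p \<subseteq> I" "set q \<subseteq> I"
  shows "pres_cong I R (p @ u @ q) (p @ v @ q)"
  using assms
proof (induction rule: pres_cong.induct)
  case (rel u v p' q')
  have "pres_cong I R ((p @ p') @ u @ (q' @ q)) ((p @ p') @ v @ (q' @ q))"
    by (rule pres_cong.rel) (use rel in auto)
  then show ?case by simp
next
  case (refl u)
  then show ?case by (intro pres_cong.refl) auto
next
  case (sym u v)
  then show ?case by (blast intro: pres_cong.sym)
next
  case (trans u v w)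
  then show ?case by (blast intro: pres_cong.trans)
qed

lemma pres_cong_append:
  assumes "pres_cong I R u u'" "pres_cong I R v v'"
  shows "pres_cong I R (u @ v) (u' @ v')"
proof -
  note s = pres_cong_sets[OF assms(1)] pres_cong_sets[OF assms(2)]
  have "pres_cong I R ([] @ u @ v) ([] @ u' @ v)"
    by (rule pres_cong_context[OF assms(1)]) (use s in auto)
  moreover have "pres_cong I R (u' @ v @ []) (u' @ v' @ [])"
    by (rule pres_cong_context[OF assms(2)]) (use s in auto)
  ultimately show ?thesis by (auto intro: pres_cong.trans)
qed

lemma pres_cong_relI: "(u, v) \<in> R \<Longrightarrow> set u \<subseteq> I \<Longrightarrow> set v \<subseteq> I \<Longrightarrow> pres_cong I R u v"
  using pres_cong.rel[of u v R I "[]" "[]"] by simp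

lemma pres_class_eqI: "pres_cong I R u v \<Longrightarrow> pres_class I R u = pres_class I R v"
  unfolding pres_class_def by (rule Collect_cong) (meson pres_cong.sym pres_cong.trans)

lemma pres_class_eq_iff:
  assumes "set u \<subseteq> I"
  shows "pres_class I R u = pres_class I R v \<longleftrightarrow> pres_cong I R u v"
  using assms pres_class_eqI[of I R u v] pres_cong.refl[of u I R] pres_cong.sym[of I R v u]
  unfolding pres_class_def by blast

lemma pres_mult:
  assumes "set u \<subseteq> I" "set v \<subseteq> I"
  shows "pres_class I R u \<otimes>\<^bsub>presented_monoid I R\<^esub> pres_class I R v = pres_class I R (u @ v)"
proof -
  have "pres_class I R (u' @ v') = pres_class I R (u @ v)"
    if "pres_cong I R u u'" "pres_cong I R v v'" for u' v'
    using pres_class_eqI[OF pres_cong_append[OF that]] by simp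
  then have "pres_class I R (u' @ v') = pres_class I R (u @ v)"
    if "u' \<in> pres_class I R u" "v' \<in> pres_class I R v" for u' v'
    using that by (simp add: pres_class_def)
  moreover have "u \<in> pres_class I R u" "v \<in> pres_class I R v"
    using assms by (simp_all add: pres_class_def pres_cong.refl)
  ultimately have "(\<Union>u'\<in>pres_class I R u. \<Union>v'\<in>pres_class I R v. pres_class I R (u' @ v'))
      = pres_class I R (u @ v)" by blast
  then show ?thesis unfolding presented_monoid_def by simp
qed

lemma presented_monoid_is_monoid: "monoid (presented_monoid I R)"
proof -
  have c: "carrier (presented_monoid I R) = pres_class I R ` lists I"
    and o: "\<one>\<^bsub>presented_monoid I R\<^esub> = pres_class I R []"
    by (simp_all add: presented_monoid_def)
  show ?thesis
    by (rule monoidI; unfold c o) (auto simp: pres_mult lists_eq_set)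
qed

text \<open>Substituting words for letters respects the congruence once it does so on the relations.
  It serves diagram automorphisms as well as the homomorphism out of the monoid of type B2.\<close>

lemma pres_cong_hom:
  assumes "pres_cong I R u v"
    and "\<And>i. i \<in> I \<Longrightarrow> set (g i) \<subseteq> I'"
    and "\<And>a b. (a, b) \<in> R \<Longrightarrow> set a \<subseteq> I \<Longrightarrow> set b \<subseteq> I
           \<Longrightarrow> pres_cong I' R' (concat (map g a)) (concat (map g b))"
  shows "pres_cong I' R' (concat (map g u)) (concat (map g v))"
  using assms(1)
proof (induction rule: pres_cong.induct)
  case (rel u v p q)
  have "pres_cong I' R' (concat (map g p) @ concat (map g u) @ concat (map g q))
          (concat (map g p) @ concat (map g v) @ concat (map g q))"
    by (rule pres_cong_context) (use rel assms(2,3) in fastforce)+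
  then show ?case by simp
next
  case (refl u)
  then show ?case using assms(2) by (intro pres_cong.refl) fastforce
next
  case (sym u v)
  then show ?case by (blast intro: pres_cong.sym)
next
  case (trans u v w)
  then show ?case by (blast intro: pres_cong.trans)
qed

text \<open>Letters that satisfy the relations as maps give an action of the presented monoid; this
  is the way in which words are shown not to be congruent.\<close>

lemma pres_cong_action:
  assumes "pres_cong I R u v"
    and "\<And>a b x. (a, b) \<in> R \<Longrightarrow> set a \<subseteq> I \<Longrightarrow> set b \<subseteq> I \<Longrightarrow> foldr f a x = foldr f b x"
  shows "foldr f u x = foldr f v x"
  using assms(1)
proof (induction arbitrary: x rule: pres_cong.induct)
  case (rel u v p q)
  then show ?case using assms(2)[of u v] by simp
qed simp_all

section \<open>Alternating words\<close>

lemma length_alt_word [simp]: "length (alt_word i j k) = k"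
  by (induction i j k rule: alt_word.induct) auto

lemma set_alt_word: "set (alt_word i j k) \<subseteq> {i, j}"
  by (induction i j k rule: alt_word.induct) auto

lemma alt_word_add:
  "alt_word i j (k + l) = alt_word i j k @ (if even k then alt_word i j l else alt_word j i l)"
  by (induction i j k rule: alt_word.induct) auto

lemma alt_word_snoc: "alt_word i j (Suc k) = alt_word i j k @ [if even k then i else j]"
  using alt_word_add[of i j k 1] by simp

lemma rev_alt_word: "rev (alt_word i j k) = (if even k then alt_word j i k else alt_word i j k)"
proof (induction k arbitrary: i j)
  case (Suc k)
  have "rev (alt_word i j (Suc k)) = rev (alt_word j i k) @ [i]" by simp
  then show ?case using Suc[of j i] by (auto simp: alt_word_snoc simp del: alt_word.simps(2))
qed simp

lemma concat_replicate_pair: "concat (replicate k [i, j]) = alt_word i j (2 * k)"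
  by (induction k) auto

section \<open>Coxeter systems\<close>

text \<open>The last assumption says that the product of two generators has exactly the prescribed
  order. It holds for every Coxeter matrix, by the geometric representation; here it is verified
  on permutation representations.\<close>

locale coxeter_system =
  fixes M :: "'i coxeter_matrix"
  assumes bond_sym: "i \<in> nodes M \<Longrightarrow> j \<in> nodes M \<Longrightarrow> bond M i j = bond M j i"
    and bond_diag: "i \<in> nodes M \<Longrightarrow> bond M i i = 1"
    and bond_ge2: "i \<in> nodes M \<Longrightarrow> j \<in> nodes M \<Longrightarrow> i \<noteq> j \<Longrightarrow> bond M i j \<ge> 2"
    and exact_order: "i \<in> nodes M \<Longrightarrow> j \<in> nodes M \<Longrightarrow> i \<noteq> j \<Longrightarrow> 0 < k \<Longrightarrow> k < bond M i j
          \<Longrightarrow> \<not> pres_cong (nodes M) (coxeter_relations M) (alt_word i j (2 * k)) []"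
begin

abbreviation ceq :: "'i list \<Rightarrow> 'i list \<Rightarrow> bool" (infix "\<approx>" 50) where
  "u \<approx> v \<equiv> pres_cong (nodes M) (coxeter_relations M) u v"

abbreviation aeq :: "'i list \<Rightarrow> 'i list \<Rightarrow> bool" (infix "\<equiv>\<^sub>A" 50) where
  "u \<equiv>\<^sub>A v \<equiv> pres_cong (nodes M) (braid_relations M) u v"

abbreviation over :: "'i list \<Rightarrow> bool" where
  "over u \<equiv> set u \<subseteq> nodes M"

lemmas ceq_sym = pres_cong.sym[of "nodes M" "coxeter_relations M"]
lemmas ceq_trans [trans] = pres_cong.trans[of "nodes M" "coxeter_relations M"]
lemmas ceq_refl = pres_cong.refl[of _ "nodes M" "coxeter_relations M"]
lemmas ceq_over = pres_cong_sets[of "nodes M" "coxeter_relations M"]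
lemmas ceq_app = pres_cong_append[of "nodes M" "coxeter_relations M"]
lemmas aeq_sym = pres_cong.sym[of "nodes M" "braid_relations M"]
lemmas aeq_trans [trans] = pres_cong.trans[of "nodes M" "braid_relations M"]
lemmas aeq_refl = pres_cong.refl[of _ "nodes M" "braid_relations M"]
lemmas aeq_over = pres_cong_sets[of "nodes M" "braid_relations M"]
lemmas aeq_app = pres_cong_append[of "nodes M" "braid_relations M"]

lemma ceq_sym_trans: "u \<approx> v \<Longrightarrow> u \<approx> w \<Longrightarrow> v \<approx> w"
  using ceq_sym ceq_trans by blast

lemma ceq_cong_iff: "u \<approx> u' \<Longrightarrow> v \<approx> v' \<Longrightarrow> u \<approx> v \<longleftrightarrow> u' \<approx> v'"
  using ceq_sym ceq_trans by meson

section \<open>Inverses and cancellation in the Coxeter group\<close>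

lemma coxeter_rel: "i \<in> nodes M \<Longrightarrow> j \<in> nodes M \<Longrightarrow> alt_word i j (2 * bond M i j) \<approx> []"
  using set_alt_word[of i j] unfolding concat_replicate_pair[symmetric]
  by (intro pres_cong_relI) (auto simp: coxeter_relations_def concat_replicate_pair)

lemma ceq_square: "i \<in> nodes M \<Longrightarrow> [i, i] \<approx> []"
  using coxeter_rel[of i i] by (simp add: bond_diag numeral_2_eq_2)

lemma rev_cancel: "over u \<Longrightarrow> rev u @ u \<approx> []"
proof (induction u)
  case (Cons a u)
  have "rev u @ [a, a] @ u \<approx> rev u @ [] @ u"
    using Cons.prems by (intro pres_cong_context ceq_square) auto
  then have "rev (a # u) @ a # u \<approx> rev u @ u" by simp
  then show ?case using Cons by (simp add: ceq_trans)
qed (simp add: ceq_refl)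

lemma cancel_rev: "over u \<Longrightarrow> u @ rev u \<approx> []"
  using rev_cancel[of "rev u"] by simp

lemma ceq_append_cancel_left:
  assumes "over p"
  shows "p @ u \<approx> p @ v \<longleftrightarrow> u \<approx> v"
proof
  assume h: "p @ u \<approx> p @ v"
  then have o: "over u" "over v" using ceq_over[OF h] by auto
  have "rev p @ p @ u \<approx> rev p @ p @ v"
    using assms by (intro ceq_app[OF ceq_refl h]) auto
  moreover have "rev p @ p @ w \<approx> w" if "over w" for w
    using ceq_app[OF rev_cancel[OF assms] ceq_refl[OF that]] by simp
  ultimately show "u \<approx> v" using o ceq_cong_iff by blast
qed (rule ceq_app[OF ceq_refl[OF assms]])

lemma ceq_append_cancel_right:
  assumes "over p"
  shows "u @ p \<approx> v @ p \<longleftrightarrow> u \<approx> v"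
proof
  assume h: "u @ p \<approx> v @ p"
  then have o: "over u" "over v" using ceq_over[OF h] by auto
  have "(u @ p) @ rev p \<approx> (v @ p) @ rev p"
    using assms by (intro ceq_app[OF h ceq_refl]) auto
  moreover have "(w @ p) @ rev p \<approx> w" if "over w" for w
    using ceq_app[OF ceq_refl[OF that] cancel_rev[OF assms]] by simp
  ultimately show "u \<approx> v" using o ceq_cong_iff by blast
qed (rule ceq_app[OF _ ceq_refl[OF assms]])

lemma ceq_Cons_cancel: "s \<in> nodes M \<Longrightarrow> s # u \<approx> s # v \<longleftrightarrow> u \<approx> v"
  using ceq_append_cancel_left[of "[s]" u v] by simp

lemma ceq_Cons_Cons: "s \<in> nodes M \<Longrightarrow> over w \<Longrightarrow> s # s # w \<approx> w"
  using ceq_app[OF ceq_square ceq_refl, of s w] by simp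

lemma ceq_Cons_move:
  assumes "s \<in> nodes M"
  shows "s # u \<approx> v \<longleftrightarrow> u \<approx> s # v"
proof
  assume h: "s # u \<approx> v"
  then have "s # s # u \<approx> s # v" using ceq_Cons_cancel[OF assms] by blast
  moreover have "s # s # u \<approx> u" using ceq_over[OF h] by (intro ceq_Cons_Cons assms) auto
  ultimately show "u \<approx> s # v" using ceq_sym_trans by blast
next
  assume h: "u \<approx> s # v"
  then have "s # u \<approx> s # s # v" using ceq_Cons_cancel[OF assms] by blast
  moreover have "s # s # v \<approx> v" using ceq_over[OF h] by (intro ceq_Cons_Cons assms) auto
  ultimately show "s # u \<approx> v" using ceq_trans by blast
qed

lemma ceq_snoc_move:
  assumes "s \<in> nodes M"
  shows "u @ [s] \<approx> v \<longleftrightarrow> u \<approx> v @ [s]"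
proof -
  have *: "w @ [s, s] \<approx> w" if "over w" for w
    using ceq_app[OF ceq_refl[OF that] ceq_square[OF assms]] by simp
  have "u @ [s] \<approx> v \<longleftrightarrow> (u @ [s]) @ [s] \<approx> v @ [s]"
    using ceq_append_cancel_right[of "[s]" "u @ [s]" v] assms by simp
  also have "\<dots> \<longleftrightarrow> u \<approx> v @ [s]"
    using *[of u] ceq_over[of "(u @ [s]) @ [s]"] ceq_over[of u] ceq_trans[of u] ceq_sym_trans
    by (metis append.assoc append_Cons append_Nil le_sup_iff set_append ceq_sym)
  finally show ?thesis .
qed

lemma ceq_conj_move: "s \<in> nodes M \<Longrightarrow> s # u @ [s] \<approx> v \<longleftrightarrow> u \<approx> s # v @ [s]"
  using ceq_Cons_move[of s "u @ [s]" v] ceq_snoc_move[of s u "s # v"] by simp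

section \<open>The sign character and Tits' reflection cocycle\<close>

lemma ceq_parity: "u \<approx> v \<Longrightarrow> even (length u) = even (length v)"
  by (induction rule: pres_cong.induct) (auto simp: coxeter_relations_def concat_replicate_pair)

text \<open>\<open>np u t\<close> is the parity of the number of positions of \<open>u\<close> whose reflection is \<open>t\<close>.\<close>

fun np :: "'i list \<Rightarrow> 'i list \<Rightarrow> bool" where
  "np [] t \<longleftrightarrow> False"
| "np (s # u) t \<longleftrightarrow> (t \<approx> [s]) \<noteq> np u (s # t @ [s])"

lemma np_cong:
  assumes "t \<approx> t'" "over u"
  shows "np u t = np u t'"
  using assms
proof (induction u arbitrary: t t')
  case (Cons s u)
  have "[s] @ t @ [s] \<approx> [s] @ t' @ [s]" using Cons.prems by (intro pres_cong_context) auto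
  then have "np u (s # t @ [s]) = np u (s # t' @ [s])" using Cons by simp
  moreover have "t \<approx> [s] \<longleftrightarrow> t' \<approx> [s]"
    using ceq_trans[OF Cons.prems(1)] ceq_sym_trans[OF Cons.prems(1)] by blast
  ultimately show ?case by simp
qed simp

lemma np_append: "np (u @ v) t \<longleftrightarrow> np u t \<noteq> np v (rev u @ t @ u)"
  by (induction u arbitrary: t) auto

text \<open>The reflection at position \<open>k\<close> of an alternating word is itself
  alternating, of length \<open>2 * k + 1\<close>, so \<open>np\<close> counts the \<open>k\<close>
  that give \<open>t\<close>.\<close>

lemma np_alt_word:
  assumes "i \<in> nodes M" "j \<in> nodes M" "over t"
  shows "np (alt_word i j n) t \<longleftrightarrow> odd (card {k. k < n \<and> t \<approx> alt_word i j (2 * k + 1)})"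
  using assms
proof (induction n arbitrary: i j t)
  case (Suc n)
  have e: "t \<approx> alt_word i j (2 * Suc k + 1) \<longleftrightarrow> i # t @ [i] \<approx> alt_word j i (2 * k + 1)" for k
  proof -
    have "alt_word i j (2 * Suc k + 1) = i # alt_word j i (2 * k + 1) @ [i]"
      using alt_word_snoc[of i j "2 * Suc k"] by simp
    then show ?thesis using ceq_conj_move Suc.prems by metis
  qed
  have "{k. k < Suc n \<and> t \<approx> alt_word i j (2 * k + 1)}
     = (if t \<approx> [i] then {0} else {}) \<union> Suc ` {k. k < n \<and> t \<approx> alt_word i j (2 * Suc k + 1)}"
    (is "?A = ?B \<union> Suc ` ?C")
    by (auto simp: image_iff less_Suc_eq_0_disj simp del: alt_word.simps(2)) auto
  moreover have "card (?B \<union> Suc ` ?C) = card ?B + card ?C"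
    by (subst card_Un_disjoint) (auto simp: card_image)
  moreover have "odd (card ?C) \<longleftrightarrow> np (alt_word j i n) (i # t @ [i])"
    unfolding e using Suc by auto
  ultimately show ?case by (auto simp del: alt_word.simps(2) simp: alt_word.simps(2)[of i j n])
qed simp

text \<open>The reflections along the relator repeat with period \<open>bond M i j\<close>, and the
  relator runs through two periods: each reflection is met an even number of times.\<close>

lemma np_relation:
  assumes "i \<in> nodes M" "j \<in> nodes M" "over t"
  shows "\<not> np (alt_word i j (2 * bond M i j)) t"
proof -
  let ?m = "bond M i j"
  let ?P = "\<lambda>k. t \<approx> alt_word i j (2 * k + 1)"
  have per: "?P (?m + k) = ?P k" for k
  proof -
    have "alt_word i j (2 * (?m + k) + 1) = alt_word i j (2 * ?m) @ alt_word i j (2 * k + 1)"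
      using alt_word_add[of i j "2 * ?m" "2 * k + 1"] by (simp add: add.assoc del: alt_word.simps)
    also have "\<dots> \<approx> [] @ alt_word i j (2 * k + 1)"
      using set_alt_word[of i j "2 * k + 1"] assms by (intro ceq_app coxeter_rel ceq_refl) auto
    finally have "alt_word i j (2 * (?m + k) + 1) \<approx> alt_word i j (2 * k + 1)"
      by (simp only: append_Nil)
    then show ?thesis using ceq_trans[of t] ceq_sym by blast
  qed
  have "{k. k < 2 * ?m \<and> ?P k} = {k. k < ?m \<and> ?P k} \<union> (+) ?m ` {k. k < ?m \<and> ?P k}" (is "?A = ?B")
  proof -
    have "k \<in> ?B" if "k \<in> ?A" for k
    proof (cases "k < ?m")
      case False
      then have "k = ?m + (k - ?m)" by simp
      moreover have "?P (k - ?m)" using that per[of "k - ?m"] False by simp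
      ultimately show ?thesis using that by (auto simp: image_iff intro!: exI[of _ "k - ?m"])
    qed (use that in auto)
    then show ?thesis using per by fastforce
  qed
  moreover have "card (A \<union> (+) ?m ` A) = 2 * card A" if "A \<subseteq> {..<?m}" for A
    using that finite_subset[OF that] by (subst card_Un_disjoint) (auto simp: card_image)
  moreover have "{k. k < ?m \<and> ?P k} \<subseteq> {..<?m}" by blast
  ultimately have "even (card {k. k < 2 * ?m \<and> ?P k})"
    by (simp only: even_mult_iff) simp
  then show ?thesis unfolding np_alt_word[OF assms] by simp
qed

lemma ceq_conj:
  assumes a: "r \<approx> []" "over t"
  shows "rev r @ t @ r \<approx> t"
proof -
  have r: "over r" using ceq_over a by blast
  have "rev r @ r \<approx> rev r @ []" using a r by (intro ceq_app ceq_refl) auto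
  then have "rev r \<approx> []" using ceq_sym_trans[of "rev r @ r" "rev r" "[]"] rev_cancel[OF r] by simp
  then have "rev r @ t @ r \<approx> [] @ t @ []" using a by (intro ceq_app ceq_refl) auto
  then show ?thesis by simp
qed

text \<open>Relators contribute nothing by \<open>np_relation\<close> and conjugate trivially, so
  the parity depends only on the group element. This is what makes the exchange condition
  work.\<close>

lemma np_invariant:
  assumes "u \<approx> v" "over t"
  shows "np u t = np v t"
  using assms
proof (induction arbitrary: t rule: pres_cong.induct)
  case (rel u v p q)
  then obtain i j where ij: "i \<in> nodes M" "j \<in> nodes M" "u = alt_word i j (2 * bond M i j)" "v = []"
    by (auto simp: coxeter_relations_def concat_replicate_pair)
  let ?t = "rev p @ t @ p"
  have ot: "over ?t" using rel by auto
  have "\<not> np u ?t" using ij np_relation ot by blast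
  moreover have "np q (rev u @ ?t @ u) = np q ?t"
    using rel(5) ot coxeter_rel[OF ij(1,2)] by (intro np_cong ceq_conj) (simp_all add: ij(3))
  ultimately show ?case using ij by (simp add: np_append)
qed auto

text \<open>The strong exchange property: an odd count means that some position of \<open>u\<close>
  has reflection \<open>t\<close>, and multiplying by \<open>t\<close> deletes the letter
  there.\<close>

lemma np_delete:
  assumes "np u t" "over u" "over t"
  shows "\<exists>p a q. u = p @ a # q \<and> t @ u \<approx> p @ q \<and> t \<approx> p @ [a] @ rev p"
  using assms
proof (induction u arbitrary: t)
  case (Cons s u)
  have s: "s \<in> nodes M" "over u" using Cons.prems by auto
  show ?case
  proof (cases "t \<approx> [s]")
    case True
    have "t @ s # u \<approx> [s] @ s # u" using True Cons.prems by (intro ceq_app ceq_refl) auto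
    also have "[s] @ s # u \<approx> [] @ u" using ceq_app[OF ceq_square ceq_refl, of s u] s by simp
    finally have "t @ s # u \<approx> u" by simp
    with True show ?thesis by (intro exI[of _ "[]"] exI[of _ s] exI[of _ u]) auto
  next
    case False
    then have "np u (s # t @ [s])" using Cons.prems by simp
    then obtain p a q where *: "u = p @ a # q" "(s # t @ [s]) @ u \<approx> p @ q"
        "s # t @ [s] \<approx> p @ [a] @ rev p"
      using Cons.IH[of "s # t @ [s]"] Cons.prems by auto
    have "t @ s # u \<approx> s # p @ q" using *(2) ceq_Cons_move[OF s(1)] by auto
    moreover have "t \<approx> (s # p) @ [a] @ rev (s # p)" using *(3) ceq_conj_move[OF s(1)] by simp
    ultimately show ?thesis
      using *(1) by (intro exI[of _ "s # p"] exI[of _ a] exI[of _ q]) auto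
  qed
qed simp

section \<open>Reduced words and the exchange condition\<close>

definition reduced :: "'i list \<Rightarrow> bool" where
  "reduced u \<longleftrightarrow> over u \<and> (\<forall>v. v \<approx> u \<longrightarrow> length u \<le> length v)"

lemma reduced_over: "reduced u \<Longrightarrow> over u"
  by (simp add: reduced_def)

lemma reduced_length_le: "reduced u \<Longrightarrow> u \<approx> v \<Longrightarrow> length u \<le> length v"
  unfolding reduced_def using ceq_sym by blast

lemma reduced_cong: "u \<approx> v \<Longrightarrow> length u = length v \<Longrightarrow> reduced u \<longleftrightarrow> reduced v"
  unfolding reduced_def using ceq_over[of u v] by (metis ceq_sym ceq_trans)

lemma reduced_infix:
  assumes "reduced (p @ u @ q)"
  shows "reduced u"
  unfolding reduced_def
proof safe
  fix v assume v: "v \<approx> u"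
  have "over p" "over q" using assms by (auto simp: reduced_def)
  then have "p @ v @ q \<approx> p @ u @ q" by (intro pres_cong_context v)
  then show "length u \<le> length v" using assms by (force simp: reduced_def)
qed (use assms in \<open>auto simp: reduced_def\<close>)

lemma reduced_suffix: "reduced (p @ u) \<Longrightarrow> reduced u"
  using reduced_infix[of p u "[]"] by simp

lemma reduced_prefix: "reduced (u @ q) \<Longrightarrow> reduced u"
  using reduced_infix[of "[]" u q] by simp

lemma reduced_Nil: "reduced []"
  by (simp add: reduced_def)

lemma reduced_single: "s \<in> nodes M \<Longrightarrow> reduced [s]"
  unfolding reduced_def using ceq_parity[of _ "[s]"] by (auto simp: Suc_le_eq dest: ceq_parity)

lemma not_reduced_np:
  assumes "reduced u" "s \<in> nodes M" "\<not> reduced (s # u)"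
  shows "np u [s]"
proof -
  obtain w where w: "w \<approx> s # u" "length w < Suc (length u)"
    using assms by (auto simp: reduced_def not_le)
  \<comment> \<open>Congruent words have lengths of equal parity, so failing to be reduced costs at
    least two letters.\<close>
  moreover have "length w \<noteq> length u" using ceq_parity[OF w(1)] by auto
  ultimately have lw: "length w < length u" by simp
  have u: "u \<approx> s # w" using ceq_Cons_move[OF assms(2)] ceq_sym[OF w(1)] by blast
  have ow: "over w" using ceq_over w by blast
  \<comment> \<open>Otherwise a letter of \<open>w\<close> could be deleted from
    \<open>s # w\<close>, leaving a word for \<open>u\<close> that is shorter than
    \<open>u\<close>.\<close>
  have "\<not> np w [s]"
  proof
    assume "np w [s]"
    then obtain p a q where "w = p @ a # q" "[s] @ w \<approx> p @ q"
      using np_delete[of w "[s]"] ow assms(2) by auto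
    then have "u \<approx> p @ q" "length (p @ q) < length u" using ceq_trans[OF u] lw by auto
    then show False using reduced_length_le[OF assms(1), of "p @ q"] by simp
  qed
  moreover have "np w [s, s, s] = np w [s]"
    using ceq_app[OF ceq_square ceq_refl, of s "[s]"] assms(2) by (intro np_cong ow) auto
  moreover have "[s] \<approx> [s]" using assms(2) by (intro ceq_refl) auto
  ultimately have "np (s # w) [s]" by simp
  then show ?thesis using np_invariant[OF u] assms(2) by auto
qed

lemma exchange:
  assumes "reduced u" "s \<in> nodes M" "\<not> reduced (s # u)"
  shows "\<exists>p a q. u = p @ a # q \<and> s # u \<approx> p @ q"
proof -
  have "over u" "over [s]" using assms(1,2) by (simp_all add: reduced_over)
  then show ?thesis using np_delete[OF not_reduced_np[OF assms]] by fastforce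
qed

text \<open>Letters are prepended one at a time; if the result is not reduced, exchange deletes an
  old letter instead. No letter outside \<open>L\<close> ever appears.\<close>

lemma reduced_subword:
  assumes "set u \<subseteq> L" "L \<subseteq> nodes M"
  shows "\<exists>v. reduced v \<and> v \<approx> u \<and> set v \<subseteq> L"
  using assms(1)
proof (induction u)
  case Nil
  show ?case by (intro exI[of _ "[]"]) (simp add: reduced_Nil ceq_refl)
next
  case (Cons s u)
  then obtain v where v: "reduced v" "v \<approx> u" "set v \<subseteq> L" by auto
  have s: "s \<in> nodes M" "s \<in> L" using Cons.prems assms(2) by auto
  have sv: "s # v \<approx> s # u" using v s ceq_Cons_cancel by blast
  show ?case
  proof (cases "reduced (s # v)")
    case True
    then show ?thesis using v s sv by (intro exI[of _ "s # v"]) auto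
  next
    case False
    then obtain p a q where pq: "v = p @ a # q" "s # v \<approx> p @ q"
      using exchange v s by blast
    have "reduced (p @ q)" unfolding reduced_def
    proof safe
      fix w assume "w \<approx> p @ q"
      then have "s # v \<approx> w" using pq(2) ceq_sym ceq_trans by blast
      then have "v \<approx> s # w" using ceq_Cons_move s by blast
      then show "length (p @ q) \<le> length w" using reduced_length_le[OF v(1), of "s # w"] pq(1) by simp
    qed (use reduced_over[OF v(1)] pq in auto)
    then show ?thesis using pq v sv ceq_sym_trans[of "s # v" "p @ q" "s # u"]
      by (intro exI[of _ "p @ q"]) auto
  qed
qed

text \<open>By induction on \<open>v\<close>: the letter exchanged against \<open>s\<close> lies outside \<open>v\<close>, because \<open>s # v\<close> is
  reduced.\<close>

lemma reduced_word_prefix: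
  assumes "reduced u" "\<And>s. s \<in> L \<Longrightarrow> \<not> reduced (s # u)" "L \<subseteq> nodes M" "set u \<subseteq> L'"
    and "reduced v" "set v \<subseteq> L"
  shows "\<exists>z. v @ z \<approx> u \<and> length v + length z = length u \<and> set z \<subseteq> L'"
  using assms(5,6)
proof (induction v)
  case Nil
  then show ?case using assms(1,4) by (intro exI[of _ u]) (simp add: ceq_refl reduced_over)
next
  case (Cons s v)
  have s: "s \<in> L" "s \<in> nodes M" using Cons.prems assms(3) by auto
  have rv: "reduced v" using reduced_suffix[of "[s]" v] Cons.prems by simp
  then obtain z where z: "v @ z \<approx> u" "length v + length z = length u" "set z \<subseteq> L'"
    using Cons by auto
  have red: "reduced (v @ z)" using reduced_cong[OF z(1)] z(2) assms(1) by simp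
  have "s # v @ z \<approx> s # u" using z ceq_Cons_cancel s by blast
  then have "\<not> reduced (s # v @ z)" using reduced_cong z(2) assms(2)[OF s(1)] by fastforce
  then obtain p a q where pq: "v @ z = p @ a # q" "s # v @ z \<approx> p @ q"
    using exchange[OF red s(2)] by auto
  have oz: "over z" "over v" using red by (auto simp: reduced_def)
  from pq(1) consider p' where "v = p @ a # p'" "q = p' @ z" | p' where "p = v @ p'" "z = p' @ a # q"
    by (auto simp: append_eq_append_conv2 append_eq_Cons_conv Cons_eq_append_conv)
  then show ?case
  proof cases
    case 1
    then have "(s # v) @ z \<approx> (p @ p') @ z" using pq by simp
    then have "s # v \<approx> p @ p'" using ceq_append_cancel_right oz by blast
    then show ?thesis using reduced_length_le[OF Cons.prems(1), of "p @ p'"] 1 by simp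
  next
    case 2
    then have "v @ z \<approx> s # v @ p' @ q" using pq(2) ceq_Cons_move[OF s(2)] by simp
    then have "(s # v) @ p' @ q \<approx> u" using z(1) ceq_sym_trans[of "v @ z"] by simp
    then show ?thesis using z 2 by (intro exI[of _ "p' @ q"]) auto
  qed
qed

section \<open>Matsumoto's theorem\<close>

text \<open>If prepending \<open>i\<close> failed, the cocycle would make \<open>[i]\<close> a
  reflection of the shorter alternating word, so a power of the product of \<open>i\<close> and
  \<open>j\<close> below the bond would be trivial, against \<open>exact_order\<close>.\<close>

lemma alt_word_reduced:
  assumes "i \<in> nodes M" "j \<in> nodes M" "i \<noteq> j" "k \<le> bond M i j"
  shows "reduced (alt_word i j k)"
  using assms
proof (induction k arbitrary: i j)
  case (Suc k)
  have r: "reduced (alt_word j i k)" 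
  proof (rule Suc.IH)
    show "k \<le> bond M j i" using Suc.prems bond_sym[of i j] by linarith
  qed (use Suc.prems in blast)+
  show ?case
  proof (rule ccontr)
    assume "\<not> reduced (alt_word i j (Suc k))"
    then have "np (alt_word j i k) [i]" using not_reduced_np[OF r Suc.prems(1)] by simp
    then have "odd (card {l. l < k \<and> [i] \<approx> alt_word j i (2 * l + 1)})"
      using np_alt_word[of j i "[i]" k] Suc.prems(1,2) by simp
    then have "{l. l < k \<and> [i] \<approx> alt_word j i (2 * l + 1)} \<noteq> {}"
      by (metis card.empty even_zero)
    then obtain l where l: "l < k" "[i] \<approx> alt_word j i (2 * l + 1)" by blast
    have "alt_word i j (2 * (l + 1)) = i # alt_word j i (2 * l + 1)" by simp
    moreover have "[] \<approx> i # alt_word j i (2 * l + 1)"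
      using l(2) ceq_Cons_move Suc.prems(1) by blast
    ultimately have "alt_word i j (2 * (l + 1)) \<approx> []" by (metis ceq_sym)
    then show False using exact_order[of i j "l + 1"] Suc.prems l by simp
  qed
qed (simp add: reduced_Nil)

lemma ceq_braid:
  assumes "i \<in> nodes M" "j \<in> nodes M"
  shows "alt_word i j (bond M i j) \<approx> alt_word j i (bond M i j)"
proof -
  let ?m = "bond M i j"
  let ?v = "alt_word j i ?m"
  have o: "over ?v" using set_alt_word[of j i ?m] assms by auto
  have "alt_word i j (2 * ?m) = alt_word i j ?m @ rev ?v"
    using alt_word_add[of i j ?m ?m] by (auto simp: rev_alt_word mult_2)
  then have "alt_word i j ?m @ rev ?v \<approx> ?v @ rev ?v"
    using coxeter_rel[OF assms] cancel_rev[OF o] ceq_trans ceq_sym by metis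
  then show ?thesis using ceq_append_cancel_right[of "rev ?v"] o by auto
qed

lemma aeq_braid:
  assumes "i \<in> nodes M" "j \<in> nodes M" "i \<noteq> j"
  shows "alt_word i j (bond M i j) \<equiv>\<^sub>A alt_word j i (bond M i j)"
  using assms set_alt_word[of i j] set_alt_word[of j i]
  by (intro pres_cong_relI) (auto simp: braid_relations_def)

lemma aeq_imp_ceq: "u \<equiv>\<^sub>A v \<Longrightarrow> u \<approx> v"
proof (induction rule: pres_cong.induct)
  case (rel u v p q)
  then have "u \<approx> v" by (auto simp: braid_relations_def intro: ceq_braid)
  then show ?case using rel pres_cong_context by blast
next
  case (trans u v w)
  then show ?case using ceq_trans by blast
qed (simp_all add: ceq_refl ceq_sym)

lemma aeq_length: "u \<equiv>\<^sub>A v \<Longrightarrow> length u = length v"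
  by (induction rule: pres_cong.induct) (auto simp: braid_relations_def)

text \<open>Induction on the length. If the first letters \<open>a\<close>, \<open>b\<close> differ,
  both are left descents of the common element, so the element also has reduced words starting with
  either alternating word of length \<open>bond M a b\<close>. These two differ by one braid
  relation, and each shares its first letter with \<open>u\<close> or \<open>v\<close>.\<close>

theorem matsumoto:
  assumes "reduced u" "reduced v" "u \<approx> v"
  shows "u \<equiv>\<^sub>A v"
  using assms
proof (induction "length u" arbitrary: u v)
  case 0
  then have "length v = 0" using reduced_length_le[OF 0(3), of u] ceq_sym 0 by simp
  then show ?case using 0 by (simp add: aeq_refl)
next
  case (Suc n)
  have len: "length v = length u"
    using reduced_length_le[OF Suc.prems(1)] reduced_length_le[OF Suc.prems(2)] Suc.prems ceq_sym
    by (meson antisym)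
  \<comment> \<open>The common first letter is cancelled in the Coxeter group, and the induction
    hypothesis lifts the result to the Artin monoid.\<close>
  have IH: "b # x \<equiv>\<^sub>A b # y" if "length x = n" "length y = n" "reduced (b # x)" "b # x \<approx> b # y" for b x y
  proof -
    have b: "b \<in> nodes M" using that(3) by (auto simp: reduced_def)
    have "reduced (b # y)" using reduced_cong[OF that(4)] that by simp
    then have "reduced x" "reduced y" using that reduced_suffix[of "[b]"] by auto
    moreover have "x \<approx> y" using that ceq_Cons_cancel b by blast
    ultimately have "x \<equiv>\<^sub>A y" using Suc.hyps(1)[of x y] that by simp
    then show ?thesis using pres_cong_context[of _ _ x y "[b]" "[]"] b by simp
  qed
  obtain a u' where u: "u = a # u'" "length u' = n" using Suc(2) by (cases u) auto
  obtain b v' where v: "v = b # v'" "length v' = n" using Suc(2) len by (cases v) auto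
  have ab: "a \<in> nodes M" "b \<in> nodes M" using Suc.prems u v by (auto simp: reduced_def)
  show ?case
  proof (cases "a = b")
    case True
    then show ?thesis using IH[of u' v' a] u v Suc.prems by simp
  next
    case False
    let ?m = "bond M a b"
    obtain k where m: "?m = Suc k" using bond_ge2[OF ab False] by (cases ?m) auto
    have "\<not> reduced (s # u)" if "s \<in> {a, b}" for s
    proof -
      have "u' \<approx> a # u" "v' \<approx> b # u"
        using ceq_Cons_move ab u v Suc.prems(3) ceq_sym ceq_refl reduced_over[OF Suc.prems(1)]
        by (metis)+
      then have "a # u \<approx> u'" "b # u \<approx> v'" by (blast intro: ceq_sym)+
      then show ?thesis using reduced_length_le[of "s # u"] that u v Suc(2)
        by (metis insertE length_Cons not_less_eq_eq le_SucI order_refl singletonD)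
    qed
    \<comment> \<open>Applied with \<open>L = {a, b}\<close>: both letters are descents of
      \<open>u\<close>, so the reduced alternating word can be taken as a prefix.\<close>
    then obtain z where z: "alt_word a b ?m @ z \<approx> u" "?m + length z = length u" "over z"
      using reduced_word_prefix[of u "{a, b}" "nodes M" "alt_word a b ?m"] Suc.prems(1) ab
        alt_word_reduced[OF ab False] set_alt_word[of a b ?m] by (auto simp: reduced_def)
    have z': "alt_word b a ?m @ z \<approx> v"
      using ceq_app[OF ceq_braid[OF ab] ceq_refl[OF z(3)]] z(1) Suc.prems(3)
      by (meson ceq_sym ceq_trans)
    have len': "length (alt_word b a k @ z) = n" "length (alt_word a b k @ z) = n"
      using z(2) m Suc(2) by simp_all
    have "a # u' \<equiv>\<^sub>A a # alt_word b a k @ z"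
    proof (rule IH)
      show "reduced (a # u')" using Suc.prems(1) u(1) by simp
      show "a # u' \<approx> a # alt_word b a k @ z" using ceq_sym[OF z(1)] unfolding m u(1) by simp
    qed (use u(2) len' in blast)+
    then have "u \<equiv>\<^sub>A alt_word a b ?m @ z" unfolding m u(1) by simp
    moreover have "alt_word a b ?m @ z \<equiv>\<^sub>A alt_word b a ?m @ z"
      by (intro aeq_app aeq_braid aeq_refl ab False z)
    moreover have "b # v' \<equiv>\<^sub>A b # alt_word a b k @ z"
    proof (rule IH)
      show "reduced (b # v')" using Suc.prems(2) v(1) by simp
      show "b # v' \<approx> b # alt_word a b k @ z" using ceq_sym[OF z'] unfolding m v(1) by simp
    qed (use v(2) len' in blast)+
    then have v_eq: "alt_word b a ?m @ z \<equiv>\<^sub>A v" unfolding m v(1) using aeq_sym by fastforce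
    ultimately show ?thesis using v_eq aeq_trans by meson
  qed
qed

end

context coxeter_system
begin

section \<open>Longest elements\<close>

text \<open>Maximality is expressed by left descents, since these can be checked by exhibiting a
  factorization for each letter; \<open>longest_word_prefix\<close> recovers the comparison of
  lengths.\<close>

definition longest_word :: "'i set \<Rightarrow> 'i list \<Rightarrow> bool" where
  "longest_word L u \<longleftrightarrow> set u \<subseteq> L \<and> reduced u \<and> (\<forall>s\<in>L. \<not> reduced (s # u))"

lemma longest_word_prefix:
  assumes "longest_word L u" "L \<subseteq> nodes M" "reduced v" "set v \<subseteq> L"
  shows "\<exists>z. v @ z \<approx> u \<and> length v + length z = length u \<and> set z \<subseteq> L"
  using reduced_word_prefix[of u L L v] assms by (simp add: longest_word_def)

lemma longest_word_length_le:
  "longest_word L u \<Longrightarrow> L \<subseteq> nodes M \<Longrightarrow> reduced v \<Longrightarrow> set v \<subseteq> L \<Longrightarrow> length v \<le> length u"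
  using longest_word_prefix[of L u v] by auto

lemma longest_word_unique:
  assumes "longest_word L u" "L \<subseteq> nodes M" "reduced v" "set v \<subseteq> L" "length u \<le> length v"
  shows "v \<approx> u"
proof -
  obtain z where z: "v @ z \<approx> u" "length v + length z = length u"
    using longest_word_prefix[OF assms(1-4)] by blast
  then have "length z = 0" using assms(5) by linarith
  then show ?thesis using z(1) by simp
qed

lemma longest_word_aeq:
  assumes "longest_word L u" "longest_word L v" "L \<subseteq> nodes M"
  shows "u \<equiv>\<^sub>A v"
proof -
  have "reduced u" "reduced v" "set u \<subseteq> L" "set v \<subseteq> L"
    using assms by (simp_all add: longest_word_def)
  moreover have "length v \<le> length u"
    using calculation longest_word_length_le[OF assms(1,3)] by blast
  ultimately show ?thesis
    using longest_word_unique[OF assms(2,3), of u] by (intro matsumoto) auto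
qed

lemma not_reduced_ConsI:
  assumes "s \<in> nodes M" "u \<approx> s # w" "length u = Suc (length w)"
  shows "\<not> reduced (s # u)"
proof
  assume "reduced (s # u)"
  moreover have "s # u \<approx> w" using ceq_Cons_move assms by blast
  ultimately show False using reduced_length_le assms(3) by fastforce
qed

text \<open>A longest word over \<open>L0\<close> bounds the lengths of reduced words over
  \<open>L\<close>, so one of maximal length exists. This covers the arbitrary sets \<open>J\<close>
  and \<open>K\<close>, for which no explicit word is given.\<close>

lemma longest_word_exists:
  assumes "longest_word L0 u0" "L0 \<subseteq> nodes M" "L \<subseteq> L0"
  shows "\<exists>u. longest_word L u"
proof -
  let ?P = "\<lambda>v. reduced v \<and> set v \<subseteq> L"
  have "\<forall>v. ?P v \<longrightarrow> length v \<le> length u0"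
    using longest_word_length_le[OF assms(1,2)] assms(3) by blast
  moreover have "?P []" by (simp add: reduced_Nil)
  ultimately obtain u where u: "?P u" "\<forall>v. ?P v \<longrightarrow> length v \<le> length u"
    using ex_has_greatest_nat[of ?P "[]" length "Suc (length u0)"]
    by (auto simp: less_Suc_eq_le)
  have "\<not> reduced (s # u)" if "s \<in> L" for s
    using u(2)[rule_format, of "s # u"] u(1) that by auto
  then show ?thesis using u(1) unfolding longest_word_def by blast
qed

section \<open>Parabolic subgroups and canonical lifts in terms of words\<close>

lemma monoid_coxeter_group: "monoid (coxeter_group M)"
  unfolding coxeter_group_def by (rule presented_monoid_is_monoid)

lemma coxeter_word_eq_iff: "over u \<Longrightarrow> coxeter_word M u = coxeter_word M v \<longleftrightarrow> u \<approx> v"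
  unfolding coxeter_word_def by (rule pres_class_eq_iff)

lemma coxeter_word_mult:
  "over u \<Longrightarrow> over v \<Longrightarrow>
    coxeter_word M u \<otimes>\<^bsub>coxeter_group M\<^esub> coxeter_word M v = coxeter_word M (u @ v)"
  unfolding coxeter_word_def coxeter_group_def by (rule pres_mult)

lemma coxeter_group_one: "\<one>\<^bsub>coxeter_group M\<^esub> = coxeter_word M []"
  by (simp add: coxeter_group_def presented_monoid_def coxeter_word_def)

lemma coxeter_word_carrier: "over u \<Longrightarrow> coxeter_word M u \<in> carrier (coxeter_group M)"
  by (auto simp: coxeter_group_def presented_monoid_def coxeter_word_def)

lemma coxeter_word_inv:
  assumes "s \<in> nodes M"
  shows "inv\<^bsub>coxeter_group M\<^esub> (coxeter_word M [s]) = coxeter_word M [s]"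
proof -
  interpret G: monoid "coxeter_group M" by (rule monoid_coxeter_group)
  have "coxeter_word M [s, s] = coxeter_word M []"
    using ceq_square[OF assms] assms by (subst coxeter_word_eq_iff) auto
  then have "coxeter_word M [s] \<otimes>\<^bsub>coxeter_group M\<^esub> coxeter_word M [s] = \<one>\<^bsub>coxeter_group M\<^esub>"
    using assms by (simp add: coxeter_word_mult coxeter_group_one)
  then show ?thesis using assms by (intro G.inv_unique'[symmetric] coxeter_word_carrier) auto
qed

text \<open>The generators are involutions, so the inverses allowed in \<open>generate\<close> add
  nothing to words in \<open>L\<close>.\<close>

lemma parabolic_eq:
  assumes "L \<subseteq> nodes M"
  shows "parabolic M L = coxeter_word M ` lists L"
proof
  show "parabolic M L \<subseteq> coxeter_word M ` lists L"
  proof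
    fix x assume "x \<in> parabolic M L"
    then show "x \<in> coxeter_word M ` lists L" unfolding parabolic_def
    proof (induction rule: generate.induct)
      case one
      show ?case unfolding coxeter_group_one by (intro imageI) auto
    next
      case (incl h)
      then obtain l where "l \<in> L" "h = coxeter_word M [l]" by auto
      then show ?case by (auto intro!: imageI)
    next
      case (inv h)
      then obtain l where "l \<in> L" "h = coxeter_word M [l]" by auto
      then show ?case using coxeter_word_inv[of l] assms by (auto intro!: imageI)
    next
      case (eng h1 h2)
      then obtain u v where "u \<in> lists L" "v \<in> lists L" "h1 = coxeter_word M u" "h2 = coxeter_word M v"
        by auto
      moreover from this have "over u" "over v" using assms by (auto simp: lists_eq_set)
      ultimately have "h1 \<otimes>\<^bsub>coxeter_group M\<^esub> h2 = coxeter_word M (u @ v)" "u @ v \<in> lists L"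
        by (simp_all add: coxeter_word_mult)
      then show ?case by (metis imageI)
    qed
  qed
  show "coxeter_word M ` lists L \<subseteq> parabolic M L"
  proof (rule image_subsetI)
    fix u assume "u \<in> lists L"
    then show "coxeter_word M u \<in> parabolic M L"
    proof (induction rule: lists.induct)
      case Nil
      show ?case using generate.one unfolding parabolic_def coxeter_group_one[symmetric] .
    next
      case (Cons a u)
      then have o: "over [a]" "over u" using assms by (auto simp: lists_eq_set)
      have "coxeter_word M [a] \<in> parabolic M L"
        unfolding parabolic_def by (rule generate.incl) (use Cons in auto)
      then have "coxeter_word M [a] \<otimes>\<^bsub>coxeter_group M\<^esub> coxeter_word M u \<in> parabolic M L"
        using Cons.IH unfolding parabolic_def by (rule generate.eng)
      then show ?case using coxeter_word_mult[OF o] by simp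
    qed
  qed
qed

lemma coxeter_length_reduced:
  assumes "reduced u"
  shows "coxeter_length M (coxeter_word M u) = length u"
  unfolding coxeter_length_def
proof (rule Least_equality)
  show "\<exists>v\<in>lists (nodes M). coxeter_word M v = coxeter_word M u \<and> length v = length u"
    using reduced_over[OF assms] by (intro bexI[of _ u]) auto
  fix k
  assume "\<exists>v\<in>lists (nodes M). coxeter_word M v = coxeter_word M u \<and> length v = k"
  then obtain v where v: "v \<in> lists (nodes M)" "coxeter_word M v = coxeter_word M u" "length v = k"
    by blast
  then have "v \<approx> u" using coxeter_word_eq_iff[of v u] by (auto simp: lists_eq_set)
  then show "length u \<le> k" using assms v(3) by (auto simp: reduced_def)
qed

text \<open>\<open>arg_max_on\<close> is a choice, so uniqueness has to be shown: every element of
  the parabolic has a reduced word over \<open>L\<close>, and one as long as \<open>u\<close> is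
  congruent to \<open>u\<close>.\<close>

lemma longest_element_eq:
  assumes "longest_word L u" "L \<subseteq> nodes M"
  shows "longest_element M L = coxeter_word M u"
proof -
  let ?P = "\<lambda>x. x \<in> parabolic M L"
  have u: "set u \<subseteq> L" "reduced u" using assms(1) by (simp_all add: longest_word_def)
  have norm: "\<exists>v. reduced v \<and> set v \<subseteq> L \<and> x = coxeter_word M v" if "?P x" for x
  proof -
    have "x \<in> coxeter_word M ` lists L" using that parabolic_eq[OF assms(2)] by simp
    then obtain w where w: "x = coxeter_word M w" "w \<in> lists L" by blast
    then have wL: "set w \<subseteq> L" by auto
    obtain v where v: "reduced v" "v \<approx> w" "set v \<subseteq> L" using reduced_subword[OF wL assms(2)] by blast
    have "coxeter_word M v = coxeter_word M w"
      using coxeter_word_eq_iff[OF reduced_over[OF v(1)]] v(2) by blast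
    then show ?thesis using v(1,3) w(1) by (intro exI[of _ v]) simp
  qed
  have Pu: "?P (coxeter_word M u)" unfolding parabolic_eq[OF assms(2)] using u by auto
  have "is_arg_max (coxeter_length M) ?P x \<longleftrightarrow> x = coxeter_word M u" for x
  proof
    assume a: "is_arg_max (coxeter_length M) ?P x"
    then have "?P x" by (simp add: is_arg_max_def)
    then obtain v where v: "reduced v" "set v \<subseteq> L" "x = coxeter_word M v" using norm by blast
    have "\<not> coxeter_length M x < coxeter_length M (coxeter_word M u)"
      using a Pu by (simp add: is_arg_max_def)
    then have "length u \<le> length v" using v u by (simp add: coxeter_length_reduced)
    then have "v \<approx> u" using longest_word_unique[OF assms v(1,2)] by blast
    then show "x = coxeter_word M u"
      using coxeter_word_eq_iff[OF reduced_over[OF v(1)]] v(3) by blast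
  next
    assume x: "x = coxeter_word M u"
    have "\<not> coxeter_length M x < coxeter_length M y" if y: "?P y" for y
    proof -
      obtain v where "reduced v" "set v \<subseteq> L" "y = coxeter_word M v" using norm[OF y] by blast
      then show ?thesis using longest_word_length_le[OF assms, of v] u x
        by (simp add: coxeter_length_reduced not_less)
    qed
    then show "is_arg_max (coxeter_length M) ?P x" using Pu x unfolding is_arg_max_def by blast
  qed
  then have "is_arg_max (coxeter_length M) ?P = (\<lambda>x. x = coxeter_word M u)" by (rule ext)
  then show ?thesis unfolding longest_element_def arg_max_on_def arg_max_def by simp
qed

text \<open>Whichever reduced expression is chosen in \<open>artin_lift\<close>, Matsumoto's theorem
  makes it congruent to \<open>u\<close> in the Artin monoid.\<close>

theorem artin_lift_longest_element:
  assumes "longest_word L u" "L \<subseteq> nodes M"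
  shows "artin_lift M (longest_element M L) = artin_word M u"
proof -
  let ?w = "coxeter_word M u"
  have u: "reduced u" using assms(1) by (simp add: longest_word_def)
  have "reduced_expression M ?w u"
    using reduced_over[OF u] coxeter_length_reduced[OF u] by (auto simp: reduced_expression_def)
  then have r: "reduced_expression M ?w (SOME v. reduced_expression M ?w v)" (is "reduced_expression M ?w ?v")
    by (rule someI)
  then have v: "over ?v" "coxeter_word M ?v = ?w" "length ?v = length u"
    using coxeter_length_reduced[OF u] by (auto simp: reduced_expression_def lists_eq_set)
  have "?v \<approx> u" using v coxeter_word_eq_iff[OF v(1)] by blast
  moreover from this have "reduced ?v" using reduced_cong[of ?v u] v(3) u by blast
  ultimately have "?v \<equiv>\<^sub>A u" using matsumoto u by blast
  then show ?thesis
    unfolding longest_element_eq[OF assms] artin_lift_def artin_word_def by (rule pres_class_eqI)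
qed

section \<open>Orthogonal unions, diagram automorphisms and coset representatives\<close>

lemma aeq_commute_letters:
  "i \<in> nodes M \<Longrightarrow> j \<in> nodes M \<Longrightarrow> bond M i j = 2 \<Longrightarrow> [i, j] \<equiv>\<^sub>A [j, i]"
  using aeq_braid[of i j] bond_diag[of i] by (cases "i = j") (simp_all add: numeral_2_eq_2)

lemma aeq_commute_letter:
  assumes "s \<in> nodes M" "over u" "\<And>j. j \<in> set u \<Longrightarrow> bond M s j = 2"
  shows "s # u \<equiv>\<^sub>A u @ [s]"
  using assms(2,3)
proof (induction u)
  case Nil
  then show ?case using assms(1) by (simp add: aeq_refl)
next
  case (Cons j u)
  have "[s, j] @ u \<equiv>\<^sub>A [j, s] @ u"
    using Cons.prems assms(1) by (intro aeq_app aeq_commute_letters aeq_refl) auto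
  moreover have "[j] @ (s # u) \<equiv>\<^sub>A [j] @ (u @ [s])"
    using Cons by (intro aeq_app aeq_refl) auto
  ultimately show ?case using aeq_trans[of "s # j # u"] by simp
qed

lemma aeq_commute_words:
  assumes "over u" "over v" "\<And>i j. i \<in> set u \<Longrightarrow> j \<in> set v \<Longrightarrow> bond M i j = 2"
  shows "u @ v \<equiv>\<^sub>A v @ u"
  using assms(1,3)
proof (induction u)
  case Nil
  then show ?case using assms(2) by (simp add: aeq_refl)
next
  case (Cons i u)
  have "[i] @ (u @ v) \<equiv>\<^sub>A [i] @ (v @ u)"
    using Cons by (intro aeq_app[OF aeq_refl]) auto
  moreover have "(i # v) @ u \<equiv>\<^sub>A (v @ [i]) @ u"
    using Cons.prems assms(2) by (intro aeq_app aeq_commute_letter aeq_refl) auto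
  ultimately show ?case using aeq_trans[of "i # u @ v"] by simp
qed

text \<open>A reduced word over \<open>L\<close> for this element would be a single letter
  \<open>b\<close> different from \<open>a\<close>, and then the product of \<open>a\<close> and
  \<open>b\<close> would be trivial.\<close>

lemma generator_not_in_disjoint_parabolic:
  assumes "a \<in> nodes M" "set w \<subseteq> L" "L \<subseteq> nodes M" "a \<notin> L"
  shows "\<not> [a] \<approx> w"
proof
  assume aw: "[a] \<approx> w"
  obtain r where r: "reduced r" "r \<approx> w" "set r \<subseteq> L" using reduced_subword[OF assms(2,3)] by blast
  have ra: "r \<approx> [a]" using aw r(2) ceq_sym ceq_trans by meson
  then have "length r = length [a]"
    using reduced_length_le[OF r(1) ra] reduced_length_le[OF reduced_single[OF assms(1)] ceq_sym[OF ra]]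
    by simp
  then obtain b where b: "r = [b]" by (auto simp: length_Suc_conv)
  then have "b \<noteq> a" "b \<in> nodes M" using r(3) assms(3,4) by auto
  moreover have "[a, b] \<approx> []" using ra ceq_Cons_move[OF assms(1), of "[b]" "[]"] b by simp
  ultimately show False
    using exact_order[of a b 1] bond_ge2[of a b] assms(1) by (simp add: numeral_2_eq_2)
qed

text \<open>The point is that \<open>v @ u2\<close> is reduced. A letter exchanged inside
  \<open>v\<close> contradicts reducedness of the longer prefix; one exchanged inside
  \<open>u2\<close> would place a generator of \<open>L1\<close> in the parabolic of
  \<open>L2\<close>.\<close>

lemma longest_word_union:
  assumes "longest_word L1 u1" "longest_word L2 u2" "L1 \<subseteq> nodes M" "L2 \<subseteq> nodes M"
    and "L1 \<inter> L2 = {}" "\<And>i j. i \<in> L1 \<Longrightarrow> j \<in> L2 \<Longrightarrow> bond M i j = 2"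
  shows "longest_word (L1 \<union> L2) (u1 @ u2)"
proof -
  have u: "set u1 \<subseteq> L1" "set u2 \<subseteq> L2" "reduced u1" "reduced u2" "over u1" "over u2"
    using assms(1-4) by (auto simp: longest_word_def)
  have red: "reduced (v @ u2)" if "reduced v" "set v \<subseteq> L1" for v
    using that
  proof (induction v)
    case Nil
    then show ?case using u by simp
  next
    case (Cons a v)
    have a: "a \<in> L1" "a \<in> nodes M" using Cons.prems assms(3) by auto
    have v: "reduced v" "set v \<subseteq> L1" "over v"
      using Cons.prems reduced_suffix[of "[a]" v] assms(3) by auto
    have rv: "reduced (v @ u2)" using Cons.IH v by blast
    show ?case
    proof (rule ccontr)
      assume "\<not> reduced ((a # v) @ u2)"
      then obtain p b q where pq: "v @ u2 = p @ b # q" "a # v @ u2 \<approx> p @ q"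
        using exchange[OF rv a(2)] by auto
      from pq(1) consider p' where "v = p @ b # p'" "q = p' @ u2" | p' where "p = v @ p'" "u2 = p' @ b # q"
        by (auto simp: append_eq_append_conv2 append_eq_Cons_conv Cons_eq_append_conv)
      then show False
      proof cases
        case 1
        then have "(a # v) @ u2 \<approx> (p @ p') @ u2" using pq by simp
        then have "a # v \<approx> p @ p'" using ceq_append_cancel_right u by blast
        then show False using reduced_length_le[OF Cons.prems(1), of "p @ p'"] 1 by simp
      next
        case 2
        \<comment> \<open>Cancelling \<open>u2\<close> on the right and moving \<open>v\<close> past
          the \<open>L2\<close>-word leaves \<open>[a]\<close> congruent to
          \<open>?w\<close>.\<close>
        let ?w = "p' @ q @ rev u2"
        have w: "set ?w \<subseteq> L2" using 2(2) u(2) by auto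
        have ow: "over ?w" using w assms(4) by blast
        have "(a # v) @ u2 \<approx> v @ p' @ q" using pq 2 by simp
        then have "((a # v) @ u2) @ rev u2 \<approx> (v @ p' @ q) @ rev u2"
          using u(6) by (intro ceq_app[OF _ ceq_refl]) auto
        moreover have "(a # v) @ (u2 @ rev u2) \<approx> (a # v) @ []"
          using u(6) a v by (intro ceq_app cancel_rev ceq_refl) auto
        ultimately have "a # v \<approx> v @ ?w"
          using ceq_sym_trans[of "(a # v) @ (u2 @ rev u2)" "a # v" "v @ ?w"] by simp
        moreover have "v @ ?w \<approx> ?w @ v"
          using v(2,3) w ow assms(6) by (intro aeq_imp_ceq aeq_commute_words) blast+
        ultimately have "[a] @ v \<approx> ?w @ v" using ceq_trans[of "a # v" "v @ ?w"] by simp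
        then have "[a] \<approx> ?w" using ceq_append_cancel_right[OF v(3)] by blast
        then show False
          using generator_not_in_disjoint_parabolic[OF a(2) w assms(4)] a(1) assms(5) by blast
      qed
    qed
  qed
  have "\<not> reduced (s # u1 @ u2)" if "s \<in> L1 \<union> L2" for s
  proof (cases "s \<in> L1")
    case True
    then have "\<not> reduced (s # u1)" using assms(1) by (simp add: longest_word_def)
    then show ?thesis using reduced_prefix[of "s # u1" u2] by auto
  next
    case False
    then have s: "s \<in> L2" using that by blast
    have "(s # u1) @ u2 \<approx> (u1 @ [s]) @ u2"
    proof (rule ceq_app[OF aeq_imp_ceq[OF aeq_commute_letter] ceq_refl])
      show "bond M s j = 2" if "j \<in> set u1" for j
      proof -
        have "j \<in> L1" "j \<in> nodes M" "s \<in> nodes M" using that u(1) s assms(3,4) by blast+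
        then show ?thesis using assms(6)[OF _ s] bond_sym[of j s] by metis
      qed
    qed (use u s assms(4) in auto)
    moreover have "\<not> reduced (u1 @ s # u2)"
      using assms(2) s reduced_suffix[of u1 "s # u2"] by (auto simp: longest_word_def)
    ultimately show ?thesis using reduced_cong[of "(s # u1) @ u2" "(u1 @ [s]) @ u2"] by auto
  qed
  then show ?thesis using red[of u1] u unfolding longest_word_def by auto
qed

definition diagram_involution :: "('i \<Rightarrow> 'i) \<Rightarrow> bool" where
  "diagram_involution \<sigma> \<longleftrightarrow> (\<forall>i\<in>nodes M. \<sigma> i \<in> nodes M \<and> \<sigma> (\<sigma> i) = i)
     \<and> (\<forall>i\<in>nodes M. \<forall>j\<in>nodes M. bond M (\<sigma> i) (\<sigma> j) = bond M i j)"

lemma map_alt_word: "map f (alt_word i j k) = alt_word (f i) (f j) k"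
  by (induction i j k rule: alt_word.induct) auto

context
  fixes \<sigma>
  assumes \<sigma>: "diagram_involution \<sigma>"
begin

lemma ceq_map: "u \<approx> v \<Longrightarrow> map \<sigma> u \<approx> map \<sigma> v"
proof -
  assume "u \<approx> v"
  then have "concat (map (\<lambda>i. [\<sigma> i]) u) \<approx> concat (map (\<lambda>i. [\<sigma> i]) v)"
  proof (rule pres_cong_hom)
    show "set [\<sigma> i] \<subseteq> nodes M" if "i \<in> nodes M" for i
      using that \<sigma> by (simp add: diagram_involution_def)
    fix a b assume "(a, b) \<in> coxeter_relations M"
    then obtain i j where ij: "i \<in> nodes M" "j \<in> nodes M" "a = alt_word i j (2 * bond M i j)" "b = []"
      by (auto simp: coxeter_relations_def concat_replicate_pair)
    then have "\<sigma> i \<in> nodes M" "\<sigma> j \<in> nodes M" "bond M (\<sigma> i) (\<sigma> j) = bond M i j"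
      using \<sigma> by (simp_all add: diagram_involution_def)
    then have "map \<sigma> a \<approx> map \<sigma> b"
      using coxeter_rel[of "\<sigma> i" "\<sigma> j"] ij by (simp add: map_alt_word)
    then show "concat (map (\<lambda>i. [\<sigma> i]) a) \<approx> concat (map (\<lambda>i. [\<sigma> i]) b)" by simp
  qed
  then show ?thesis by simp
qed

lemma over_map: "over u \<Longrightarrow> over (map \<sigma> u)"
  using \<sigma> by (auto simp: diagram_involution_def)

lemma map_involution: "over u \<Longrightarrow> map \<sigma> (map \<sigma> u) = u"
  using \<sigma> by (induction u) (auto simp: diagram_involution_def)

lemma reduced_map:
  assumes "reduced u"
  shows "reduced (map \<sigma> u)"
  unfolding reduced_def
proof (intro conjI allI impI)
  have o: "over u" using reduced_over[OF assms] .
  then show "over (map \<sigma> u)" by (rule over_map)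
  fix v assume "v \<approx> map \<sigma> u"
  then have "map \<sigma> v \<approx> u" using ceq_map map_involution[OF o] by metis
  then have "length u \<le> length (map \<sigma> v)" using assms unfolding reduced_def by blast
  then show "length (map \<sigma> u) \<le> length v" by simp
qed

lemma longest_word_map:
  assumes "longest_word L u" "L \<subseteq> nodes M"
  shows "longest_word (\<sigma> ` L) (map \<sigma> u)"
proof -
  have u: "set u \<subseteq> L" "reduced u" using assms(1) by (simp_all add: longest_word_def)
  have "\<not> reduced (\<sigma> s # map \<sigma> u)" if "s \<in> L" for s
  proof
    assume "reduced (\<sigma> s # map \<sigma> u)"
    then have "reduced (map \<sigma> (map \<sigma> (s # u)))" using reduced_map by fastforce
    moreover have "over (s # u)" using u assms that by auto
    ultimately have "reduced (s # u)" using map_involution by metis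
    then show False using assms(1) that by (simp add: longest_word_def)
  qed
  then show ?thesis using u reduced_map[of u] by (auto simp: longest_word_def)
qed

end

text \<open>A word that moves a point fixed by the letters of \<open>u\<close> as fast as the potential \<open>h\<close> allows
  is a minimal coset representative.\<close>

lemma reduced_coset:
  fixes f :: "'i \<Rightarrow> 'x \<Rightarrow> 'x" and h :: "'x \<Rightarrow> int"
  assumes act: "\<And>i j y. i \<in> nodes M \<Longrightarrow> j \<in> nodes M \<Longrightarrow> foldr f (alt_word i j (2 * bond M i j)) y = y"
    and pot: "\<And>i y. i \<in> nodes M \<Longrightarrow> \<bar>h (f i y) - h y\<bar> \<le> 1"
    and fix_x: "\<And>i. i \<in> set u \<Longrightarrow> f i x = x"
    and u: "reduced u" and c: "over c" and drop: "h (foldr f c x) = h x - int (length c)"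
  shows "reduced (c @ u)"
proof -
  have inv: "foldr f v y = foldr f w y" if "v \<approx> w" for v w y
    using that
  proof (rule pres_cong_action)
    fix a b z assume "(a, b) \<in> coxeter_relations M"
    then show "foldr f a z = foldr f b z" using act by (auto simp: coxeter_relations_def concat_replicate_pair)
  qed
  have lip: "h x - h (foldr f v x) \<le> int (length v)" if "over v" for v
    using that
  proof (induction v)
    case (Cons i v)
    then show ?case using pot[of i "foldr f v x"] by simp
  qed simp
  have fixw: "foldr f w x = x" if "set w \<subseteq> set u" for w
    using that fix_x by (induction w) auto
  show ?thesis using c drop
  proof (induction c)
    case Nil
    then show ?case using u by simp
  next
    case (Cons s c)
    have s: "s \<in> nodes M" and oc: "over c" using Cons.prems by auto
    \<comment> \<open>The total drop is the largest that the length allows, so every suffix drops at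
      full speed too. An exchange would leave a word that is too short, or one acting like
      \<open>c\<close>, to account for the drop of \<open>s # c\<close>.\<close>
    have d: "h (foldr f c x) = h x - int (length c)"
      using lip[OF oc] pot[OF s, of "foldr f c x"] Cons.prems(2) by simp
    have rc: "reduced (c @ u)" using Cons.IH[OF oc d] .
    show ?case
    proof (rule ccontr)
      assume "\<not> reduced ((s # c) @ u)"
      then obtain p b q where pq: "c @ u = p @ b # q" "s # c @ u \<approx> p @ q"
        using exchange[OF rc s] by auto
      have act_eq: "foldr f (s # c) x = foldr f (p @ q) x"
        using inv[OF pq(2), of x] fixw[of u] by simp
      from pq(1) consider p' where "c = p @ b # p'" "q = p' @ u" | p' where "p = c @ p'" "u = p' @ b # q"
        by (auto simp: append_eq_append_conv2 append_eq_Cons_conv Cons_eq_append_conv)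
      then show False
      proof cases
        case 1
        then have "foldr f (s # c) x = foldr f (p @ p') x" using act_eq fixw[of u] by simp
        moreover have "over (p @ p')" using oc 1 by auto
        ultimately show False using lip[of "p @ p'"] Cons.prems(2) 1 by simp
      next
        case 2
        then have "foldr f (s # c) x = foldr f c x" using act_eq fixw[of p'] fixw[of q]
            by (simp add: subset_insertI2)
        then show False using d Cons.prems(2) by simp
      qed
    qed
  qed
qed

section \<open>The Artin monoid acting on itself\<close>

text \<open>Applied to arbitrary sets of words, so that relations in the Artin monoid become unconditional
  identities between compositions of operators, with associativity for free.\<close>

definition gen_op :: "'i \<Rightarrow> 'i list set \<Rightarrow> 'i list set" where
  "gen_op i X = (\<Union>v\<in>X. artin_word M (i # v))"

text \<open>The congruence relates only words over \<open>nodes M\<close>, so any other word has an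
  empty class. With this default the operator identities hold for every argument.\<close>

lemma artin_word_not_over: "\<not> over u \<Longrightarrow> artin_word M u = {}"
  using aeq_over[of u] by (auto simp: artin_word_def pres_class_def)

lemma artin_word_eqI: "u \<equiv>\<^sub>A v \<Longrightarrow> artin_word M u = artin_word M v"
  unfolding artin_word_def by (rule pres_class_eqI)

lemma gen_op_artin_word: "gen_op i (artin_word M u) = artin_word M (i # u)"
proof (cases "over (i # u)")
  case True
  have "artin_word M (i # v) = artin_word M (i # u)" if "v \<in> artin_word M u" for v
  proof (rule artin_word_eqI)
    have "u \<equiv>\<^sub>A v" using that by (simp add: artin_word_def pres_class_def)
    then have "[i] @ v \<equiv>\<^sub>A [i] @ u" using True by (intro aeq_app aeq_refl aeq_sym[of u v]) auto
    then show "i # v \<equiv>\<^sub>A i # u" by simp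
  qed
  moreover have "u \<in> artin_word M u" using True by (simp add: artin_word_def pres_class_def aeq_refl)
  ultimately show ?thesis unfolding gen_op_def by blast
next
  case False
  have "artin_word M (i # v) = {}" if "v \<in> artin_word M u" for v
  proof (rule artin_word_not_over)
    have "u \<equiv>\<^sub>A v" using that by (simp add: artin_word_def pres_class_def)
    then show "\<not> over (i # v)" using aeq_over[of u v] False by auto
  qed
  then show ?thesis using artin_word_not_over[OF False] unfolding gen_op_def by blast
qed

lemma gen_op_Union: "gen_op i (\<Union>v\<in>X. F v) = (\<Union>v\<in>X. gen_op i (F v))"
  unfolding gen_op_def by blast

text \<open>For the empty word the left side is \<open>X\<close> itself, while the right side would
  saturate \<open>X\<close> under the congruence; hence the hypothesis.\<close>

lemma foldr_gen_op:
  assumes "u \<noteq> []"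
  shows "foldr gen_op u X = (\<Union>v\<in>X. artin_word M (u @ v))"
  using assms
proof (induction u)
  case (Cons i u)
  show ?case
  proof (cases "u = []")
    case True
    then show ?thesis by (simp add: gen_op_def)
  next
    case False
    then show ?thesis using Cons.IH by (simp add: gen_op_Union gen_op_artin_word)
  qed
qed simp

lemma foldr_gen_op_artin_word: "foldr gen_op u (artin_word M v) = artin_word M (u @ v)"
  by (induction u) (simp_all add: gen_op_artin_word)

lemma gen_op_word_eqI:
  assumes "over u" "\<And>X. foldr gen_op u X = foldr gen_op v X"
  shows "u \<equiv>\<^sub>A v"
proof -
  have "artin_word M u = artin_word M v"
    using assms(2)[of "artin_word M []"] by (simp add: foldr_gen_op_artin_word)
  then show ?thesis unfolding artin_word_def using pres_class_eq_iff[OF assms(1)] by blast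
qed

text \<open>Braid relations preserve length, so the empty word is congruent only to itself and can
  be treated apart.\<close>

lemma gen_op_aeq:
  assumes "u \<equiv>\<^sub>A v"
  shows "foldr gen_op u X = foldr gen_op v X"
proof (cases "u = []")
  case True
  then show ?thesis using aeq_length[OF assms] by simp
next
  case False
  then have "v \<noteq> []" using aeq_length[OF assms] by auto
  moreover have "artin_word M (u @ w) = artin_word M (v @ w)" for w
  proof (cases "over w")
    case True
    then show ?thesis using assms by (intro artin_word_eqI aeq_app aeq_refl)
  next
    case False
    then show ?thesis by (simp add: artin_word_not_over)
  qed
  ultimately show ?thesis using False by (simp add: foldr_gen_op)
qed

lemma gen_op_bond2:
  assumes "i \<in> nodes M" "j \<in> nodes M" "bond M i j = 2"
  shows "gen_op i (gen_op j X) = gen_op j (gen_op i X)"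
  using gen_op_aeq[OF aeq_commute_letters[OF assms], of X] by simp

lemma gen_op_bond3:
  assumes "i \<in> nodes M" "j \<in> nodes M" "bond M i j = 3"
  shows "gen_op i (gen_op j (gen_op i X)) = gen_op j (gen_op i (gen_op j X))"
proof -
  have "i \<noteq> j" using assms bond_diag[of i] by auto
  then show ?thesis using gen_op_aeq[OF aeq_braid[OF assms(1,2)], of X] assms(3) by (simp add: eval_nat_numeral)
qed

lemma gen_op_bond4:
  assumes "i \<in> nodes M" "j \<in> nodes M" "bond M i j = 4"
  shows "gen_op i (gen_op j (gen_op i (gen_op j X))) = gen_op j (gen_op i (gen_op j (gen_op i X)))"
proof -
  have "i \<noteq> j" using assms bond_diag[of i] by auto
  then show ?thesis using gen_op_aeq[OF aeq_braid[OF assms(1,2)], of X] assms(3) by (simp add: eval_nat_numeral)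
qed

text \<open>By \<open>gen_op_word_eqI\<close> an identity of operators is a congruence of words, so
  a factorization of the operator of \<open>u\<close> beginning with \<open>s\<close> shows that
  \<open>s\<close> is a left descent.\<close>

lemma longest_wordI:
  assumes "set u \<subseteq> L" "L \<subseteq> nodes M" "reduced u"
    and "\<And>s. s \<in> L \<Longrightarrow> \<exists>w. \<forall>X. foldr gen_op u X = gen_op s (foldr gen_op w X)"
  shows "longest_word L u"
  unfolding longest_word_def
proof (intro conjI ballI assms(1,3))
  fix s assume s: "s \<in> L"
  obtain w where w: "\<And>X. foldr gen_op u X = foldr gen_op (s # w) X" using assms(4)[OF s] by auto
  have "u \<equiv>\<^sub>A s # w" using gen_op_word_eqI[OF _ w] assms(1,2) by auto
  then show "\<not> reduced (s # u)"
    using not_reduced_ConsI[of s u w] aeq_imp_ceq aeq_length s assms(2) by fastforce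
qed

lemma gen_op_longest_word:
  "longest_word L u \<Longrightarrow> longest_word L v \<Longrightarrow> L \<subseteq> nodes M \<Longrightarrow> foldr gen_op u X = foldr gen_op v X"
  by (intro gen_op_aeq longest_word_aeq)

text \<open>The universal property of the presentation. The map is a union over all representatives
  of a class, and these contribute equal sets.\<close>

lemma defines_B2_homI:
  assumes "over u1" "over u2"
    and "\<And>X. foldr gen_op (u1 @ u2 @ u1 @ u2) X = foldr gen_op (u2 @ u1 @ u2 @ u1) X"
  shows "defines_B2_hom (artin_monoid M) (artin_word M u1) (artin_word M u2)"
proof -
  let ?B = "type_B 2"
  define g where "g = (\<lambda>i::int. if i = 1 then u1 else u2)"
  define \<phi> where "\<phi> = (\<lambda>X. \<Union>w\<in>X. artin_word M (concat (map g w)))"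
  have og: "over (g i)" for i using assms by (simp add: g_def)
  have nB: "nodes ?B = {1, 2}" by (auto simp: type_B_def)
  have bB: "bond ?B 1 2 = 4" "bond ?B 2 1 = 4" by (auto simp: type_B_def)
  have rel: "u1 @ u2 @ u1 @ u2 \<equiv>\<^sub>A u2 @ u1 @ u2 @ u1" using gen_op_word_eqI assms by simp
  have hom_cong: "concat (map g v) \<equiv>\<^sub>A concat (map g w)"
    if "pres_cong (nodes ?B) (braid_relations ?B) v w" for v w
    using that
  proof (rule pres_cong_hom)
    fix a b assume "(a, b) \<in> braid_relations ?B"
    then obtain i j where "i \<in> {1, 2}" "j \<in> {1, 2}" "i \<noteq> j" "a = alt_word i j (bond ?B i j)"
      "b = alt_word j i (bond ?B i j)" unfolding braid_relations_def nB by blast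
    then show "concat (map g a) \<equiv>\<^sub>A concat (map g b)"
      using rel aeq_sym[OF rel] bB by (auto simp: eval_nat_numeral g_def)
  qed (use og in auto)
  have \<phi>: "\<phi> (artin_word ?B w) = artin_word M (concat (map g w))" if "set w \<subseteq> nodes ?B" for w
  proof -
    have "artin_word M (concat (map g v)) = artin_word M (concat (map g w))" if "v \<in> artin_word ?B w" for v
      using hom_cong[of w v] that artin_word_eqI[of "concat (map g w)"]
      by (simp add: artin_word_def pres_class_def)
    moreover have "w \<in> artin_word ?B w"
      using that by (simp add: artin_word_def pres_class_def pres_cong.refl)
    ultimately show ?thesis unfolding \<phi>_def by blast
  qed
  have oc: "over (concat (map g w))" for w using og by auto
  have "\<phi> \<in> hom (artin_monoid ?B) (artin_monoid M)"
  proof (rule homI)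
    fix x assume "x \<in> carrier (artin_monoid ?B)"
    then obtain v where v: "set v \<subseteq> nodes ?B" "x = artin_word ?B v"
      by (auto simp: artin_monoid_def presented_monoid_def artin_word_def lists_eq_set)
    then have "\<phi> x = artin_word M (concat (map g v))" using \<phi> by blast
    then show "\<phi> x \<in> carrier (artin_monoid M)"
      using oc[of v] by (auto simp: artin_monoid_def presented_monoid_def artin_word_def lists_eq_set)
    fix y assume "y \<in> carrier (artin_monoid ?B)"
    then obtain w where w: "set w \<subseteq> nodes ?B" "y = artin_word ?B w"
      by (auto simp: artin_monoid_def presented_monoid_def artin_word_def lists_eq_set)
    have "x \<otimes>\<^bsub>artin_monoid ?B\<^esub> y = artin_word ?B (v @ w)"
      unfolding v(2) w(2) artin_monoid_def artin_word_def by (rule pres_mult[OF v(1) w(1)])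
    moreover have "artin_word M (concat (map g v)) \<otimes>\<^bsub>artin_monoid M\<^esub> artin_word M (concat (map g w))
        = artin_word M (concat (map g v) @ concat (map g w))"
      unfolding artin_monoid_def artin_word_def by (rule pres_mult[OF oc oc])
    ultimately show "\<phi> (x \<otimes>\<^bsub>artin_monoid ?B\<^esub> y) = \<phi> x \<otimes>\<^bsub>artin_monoid M\<^esub> \<phi> y"
      using \<phi>[OF v(1)] \<phi>[OF w(1)] \<phi>[of "v @ w"] v w by simp
  qed
  moreover have "\<phi> \<one>\<^bsub>artin_monoid ?B\<^esub> = \<one>\<^bsub>artin_monoid M\<^esub>"
    using \<phi>[of "[]"] by (simp add: artin_monoid_def presented_monoid_def artin_word_def)
  moreover have "\<phi> (artin_word ?B [1]) = artin_word M u1" "\<phi> (artin_word ?B [2]) = artin_word M u2"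
    using \<phi>[of "[1]"] \<phi>[of "[2]"] by (simp_all add: nB g_def)
  ultimately show ?thesis unfolding defines_B2_hom_def by blast
qed

lemma defines_B2_hom_longest:
  assumes "longest_word L1 u1" "longest_word L2 u2" "L1 \<subseteq> nodes M" "L2 \<subseteq> nodes M"
    and "\<And>X. foldr gen_op (u1 @ u2 @ u1 @ u2) X = foldr gen_op (u2 @ u1 @ u2 @ u1) X"
  shows "defines_B2_hom (artin_monoid M) (artin_lift M (longest_element M L1))
           (artin_lift M (longest_element M L2))"
  unfolding artin_lift_longest_element[OF assms(1,3)] artin_lift_longest_element[OF assms(2,4)]
  using assms by (intro defines_B2_homI) (auto simp: longest_word_def)

end

section \<open>Half twists on a chain of braid operators\<close>

lemma foldr_intertwine:
  assumes "\<And>s y. s \<in> set w \<Longrightarrow> g (T s y) = T' (\<sigma> s) (g y)"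
  shows "g (foldr T w x) = foldr T' (map \<sigma> w) (g x)"
  using assms by (induction w arbitrary: x) auto

lemma foldr_commute:
  assumes "\<And>s y. s \<in> set w \<Longrightarrow> g (T s y) = T s (g y)"
  shows "g (foldr T w x) = foldr T w (g x)"
  using foldr_intertwine[of w g T T "\<lambda>s. s"] assms by simp

lemma foldr_merge:
  assumes "\<And>s t y. s \<in> set w \<Longrightarrow> t \<in> set w \<Longrightarrow> T s (T' t y) = T' t (T s y)"
  shows "foldr (\<lambda>s y. T s (T' s y)) w x = foldr T w (foldr T' w x)"
  using assms
proof (induction w)
  case (Cons s w)
  have "T' s (foldr T w (foldr T' w x)) = foldr T w (T' s (foldr T' w x))"
    by (intro foldr_commute Cons.prems[symmetric]) simp_all
  moreover have "foldr (\<lambda>s y. T s (T' s y)) w x = foldr T w (foldr T' w x)"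
    by (intro Cons.IH Cons.prems) simp_all
  ultimately show ?case by simp
qed simp

lemma map_add_upto: "map (\<lambda>i. i + c) [a..b] = [a + c..b + c]"
proof (induction "nat (b + 1 - a)" arbitrary: a)
  case 0
  then show ?case by simp
next
  case (Suc n)
  then have "a \<le> b" by simp
  then show ?case using Suc(1)[of "a + 1"] Suc(2) by (simp add: upto_rec1 algebra_simps)
qed

text \<open>The word \<open>[a..b] @ [a..b - 1] @ ... @ [a]\<close>: the standard reduced word of
  the longest permutation of the points \<open>a, ..., b + 1\<close>, whose lift is the Garside half
  twist.\<close>

function delta :: "int \<Rightarrow> int \<Rightarrow> int list" where
  "delta a b = (if b < a then [] else [a..b] @ delta a (b - 1))"
  by auto
termination by (relation "measure (\<lambda>(a, b). nat (b + 1 - a))") auto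

declare delta.simps [simp del]

lemma delta_Nil [simp]: "b < a \<Longrightarrow> delta a b = []"
  by (simp add: delta.simps)

lemma delta_rec: "a \<le> b \<Longrightarrow> delta a b = [a..b] @ delta a (b - 1)"
  by (simp add: delta.simps)

lemma set_delta: "set (delta a b) \<subseteq> {a..b}"
proof (induction a b rule: delta.induct)
  case (1 a b)
  then show ?case by (cases "b < a") (force simp: delta_rec)+
qed

lemma delta_shift: "map (\<lambda>i. i + c) (delta a b) = delta (a + c) (b + c)"
proof (induction a b rule: delta.induct)
  case (1 a b)
  show ?case
  proof (cases "b < a")
    case False
    then have "map (\<lambda>i. i + c) (delta a (b - 1)) = delta (a + c) (b + c - 1)"
      using 1 by (simp add: algebra_simps)
    then show ?thesis using False by (simp add: delta_rec map_add_upto)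
  qed simp
qed

text \<open>Stated for operators, because the chain consists of single generators in one use and of
  the folded products \<open>pair\<close> in another.\<close>

locale braid_chain =
  fixes T :: "int \<Rightarrow> 'x \<Rightarrow> 'x" and lo hi :: int
  assumes far: "lo \<le> i \<Longrightarrow> i + 2 \<le> j \<Longrightarrow> j \<le> hi \<Longrightarrow> T i (T j x) = T j (T i x)"
    and braid: "lo \<le> i \<Longrightarrow> i + 1 \<le> hi \<Longrightarrow> T i (T (i + 1) (T i x)) = T (i + 1) (T i (T (i + 1) x))"
begin

abbreviation up :: "int \<Rightarrow> int \<Rightarrow> 'x \<Rightarrow> 'x" where
  "up a b \<equiv> foldr T [a..b]"

abbreviation down :: "int \<Rightarrow> int \<Rightarrow> 'x \<Rightarrow> 'x" where
  "down a b \<equiv> foldr T (rev [a..b])"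

abbreviation half_twist :: "int \<Rightarrow> int \<Rightarrow> 'x \<Rightarrow> 'x" where
  "half_twist a b \<equiv> foldr T (delta a b)"

lemma up_first: "a \<le> b \<Longrightarrow> up a b x = T a (up (a + 1) b x)"
  by (simp add: upto_rec1)

lemma up_last: "a \<le> b \<Longrightarrow> up a b x = up a (b - 1) (T b x)"
  by (simp add: upto_rec2)

lemma up_split: "a \<le> c + 1 \<Longrightarrow> c \<le> b \<Longrightarrow> up a b x = up a c (up (c + 1) b x)"
  by (cases "a = c + 1") (simp_all add: upto_split2[of a c b])

lemma down_first: "a \<le> b \<Longrightarrow> down a b x = T b (down a (b - 1) x)"
  by (simp add: upto_rec2)

lemma down_last: "a \<le> b \<Longrightarrow> down a b x = down (a + 1) b (T a x)"
  by (simp add: upto_rec1)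

lemma down_split: "a \<le> c + 1 \<Longrightarrow> c \<le> b \<Longrightarrow> down a b x = down (c + 1) b (down a c x)"
  by (cases "a = c + 1") (simp_all add: upto_split2[of a c b])

lemma far_word:
  assumes "lo \<le> i" "i \<le> hi" "\<And>s. s \<in> set w \<Longrightarrow> lo \<le> s \<and> s \<le> hi \<and> (s + 2 \<le> i \<or> i + 2 \<le> s)"
  shows "T i (foldr T w x) = foldr T w (T i x)"
proof (rule foldr_commute)
  fix s y assume "s \<in> set w"
  then show "T i (T s y) = T s (T i y)"
    using assms(3)[of s] far[of i s y] far[of s i y] assms(1,2) by auto
qed

lemma far_words:
  assumes "\<And>i j. i \<in> set v \<Longrightarrow> j \<in> set w \<Longrightarrow> lo \<le> i \<and> i \<le> hi \<and> lo \<le> j \<and> j \<le> hi \<and> (i + 2 \<le> j \<or> j + 2 \<le> i)"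
  shows "foldr T v (foldr T w x) = foldr T w (foldr T v x)"
  using assms
proof (induction v)
  case (Cons i v)
  have "T i (foldr T w z) = foldr T w (T i z)" for z
  proof (cases "w = []")
    case False
    then obtain j where "j \<in> set w" by fastforce
    then have "lo \<le> i" "i \<le> hi" using Cons.prems[of i j] by simp_all
    then show ?thesis using Cons.prems[of i] by (intro far_word) auto
  qed simp
  moreover have "foldr T v (foldr T w x) = foldr T w (foldr T v x)"
    by (intro Cons.IH Cons.prems) simp_all
  ultimately show ?case by simp
qed simp

text \<open>Only the factors \<open>j\<close> and \<open>j + 1\<close> of \<open>up a b\<close>
  interact with \<open>T j\<close>, through one braid relation; it comes out on the other side with
  its index raised.\<close>

lemma up_T:
  assumes "lo \<le> a" "a \<le> j" "j < b" "b \<le> hi"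
  shows "up a b (T j x) = T (j + 1) (up a b x)"
proof -
  have e: "up a b y = up a (j - 1) (T j (T (j + 1) (up (j + 2) b y)))" for y
    using up_split[of a "j - 1" b y] up_first[of j b y] up_first[of "j + 1" b y] assms
    by (simp add: add.commute)
  have "up (j + 2) b (T j x) = T j (up (j + 2) b x)"
    using far_word[of j "[j + 2..b]" x] assms by simp
  moreover have "up a (j - 1) (T (j + 1) y) = T (j + 1) (up a (j - 1) y)" for y
    using far_word[of "j + 1" "[a..j - 1]" y] assms by simp
  ultimately show ?thesis unfolding e using braid[of j] assms by simp
qed

lemma down_T:
  assumes "lo \<le> a" "a \<le> j" "j < b" "b \<le> hi"
  shows "down a b (T (j + 1) x) = T j (down a b x)"
proof -
  have e: "down a b y = down (j + 2) b (T (j + 1) (T j (down a (j - 1) y)))" for y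
    using down_split[of a "j + 1" b y] down_first[of a "j + 1" y] down_first[of a j y] assms
    by (simp add: add.commute)
  have "down (j + 2) b (T j y) = T j (down (j + 2) b y)" for y
    using far_word[of j "rev [j + 2..b]" y] assms by simp
  moreover have "down a (j - 1) (T (j + 1) x) = T (j + 1) (down a (j - 1) x)"
    using far_word[of "j + 1" "rev [a..j - 1]" x] assms by simp
  ultimately show ?thesis unfolding e using braid[of j "down a (j - 1) x", symmetric] assms by simp
qed

lemma half_twist_rec1: "a \<le> b \<Longrightarrow> half_twist a b x = up a b (half_twist a (b - 1) x)"
  by (simp add: delta_rec)

text \<open>The word \<open>delta a (b - 1)\<close> slides through \<open>up a b\<close> with all
  indices raised by one. With the other three recursions, \<open>up\<close> or \<open>down\<close>
  can be peeled off on either side, which stands in for inverses.\<close>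

lemma half_twist_rec2:
  assumes "lo \<le> a" "a \<le> b" "b \<le> hi"
  shows "half_twist a b x = half_twist (a + 1) b (up a b x)"
proof -
  have "up a b (half_twist a (b - 1) x) = foldr T (map (\<lambda>i. i + 1) (delta a (b - 1))) (up a b x)"
  proof (rule foldr_intertwine)
    fix s y assume "s \<in> set (delta a (b - 1))"
    then show "up a b (T s y) = T (s + 1) (up a b y)"
      using set_delta[of a "b - 1"] assms by (intro up_T) auto
  qed
  then show ?thesis using half_twist_rec1[of a b x] delta_shift[of 1 a "b - 1"] assms by simp
qed

lemma half_twist_rec3:
  assumes "lo \<le> a" "a \<le> b" "b \<le> hi"
  shows "half_twist a b x = half_twist a (b - 1) (down a b x)"
  using assms
proof (induction "nat (b - a)" arbitrary: b x)
  case 0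
  then have "b = a" by simp
  then show ?case by (simp add: delta_rec)
next
  case (Suc n)
  then have ab: "a \<le> b - 1" by simp
  have "half_twist a b x = up a b (half_twist a (b - 1) x)"
    using Suc.prems by (intro half_twist_rec1)
  also have "\<dots> = up a (b - 1) (T b (half_twist a (b - 2) (down a (b - 1) x)))"
    using Suc.hyps(1)[of "b - 1" x] Suc.hyps(2) Suc.prems ab up_last[of a b] by simp
  also have "T b (half_twist a (b - 2) (down a (b - 1) x)) = half_twist a (b - 2) (T b (down a (b - 1) x))"
    using set_delta[of a "b - 2"] Suc.prems by (intro far_word) auto
  also have "T b (down a (b - 1) x) = down a b x" using down_first[of a b x] Suc.prems by simp
  also have "up a (b - 1) (half_twist a (b - 2) (down a b x)) = half_twist a (b - 1) (down a b x)"
    using half_twist_rec1[of a "b - 1"] ab by simp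
  finally show ?case .
qed

lemma half_twist_rec4:
  assumes "lo \<le> a" "a \<le> b" "b \<le> hi"
  shows "half_twist a b x = down a b (half_twist (a + 1) b x)"
proof -
  have "down a b (foldr T (map (\<lambda>i. i + 1) (delta a (b - 1))) x)
      = foldr T (map (\<lambda>i. i - 1) (map (\<lambda>i. i + 1) (delta a (b - 1)))) (down a b x)"
  proof (rule foldr_intertwine)
    fix s y assume "s \<in> set (map (\<lambda>i. i + 1) (delta a (b - 1)))"
    then have "s - 1 \<in> {a..b - 1}" using set_delta[of a "b - 1"] by auto
    then show "down a b (T s y) = T (s - 1) (down a b y)" using down_T[of a "s - 1" b y] assms by simp
  qed
  moreover have "map (\<lambda>i. i - 1) (map (\<lambda>i. i + 1) (delta a (b - 1))) = delta a (b - 1)"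
    by (simp add: o_def)
  ultimately show ?thesis using half_twist_rec3[OF assms] delta_shift[of 1 a "b - 1"] by simp
qed

text \<open>Conjugation by the half twist flips the interval. For \<open>j < b\<close> this is the
  flip of \<open>[a, b - 1]\<close> followed by the shift through \<open>up a b\<close>; for
  \<open>j = b\<close> the expansion from the other end is used.\<close>

lemma half_twist_T:
  assumes "lo \<le> a" "b \<le> hi" "a \<le> j" "j \<le> b"
  shows "half_twist a b (T j x) = T (a + b - j) (half_twist a b x)"
  using assms
proof (induction "nat (b - a)" arbitrary: a b j x)
  case 0
  then have "j = a" "b = a" by simp_all
  then show ?case by (simp add: delta_rec)
next
  case (Suc n)
  show ?case
  proof (cases "j < b")
    case True
    have "half_twist a (b - 1) (T j x) = T (a + b - 1 - j) (half_twist a (b - 1) x)"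
      using Suc.hyps(1)[of "b - 1" a j x] Suc.hyps(2) Suc.prems True by (simp add: algebra_simps)
    moreover have "up a b (T (a + b - 1 - j) y) = T (a + b - j) (up a b y)" for y
      using up_T[of a "a + b - 1 - j" b y] Suc.prems True by (simp add: algebra_simps)
    ultimately show ?thesis using half_twist_rec1[of a b] Suc.prems True by simp
  next
    case False
    then have j: "j = b" "a < b" using Suc by simp_all
    have "half_twist (a + 1) b (T b x) = T (a + 1) (half_twist (a + 1) b x)"
      using Suc.hyps(1)[of b "a + 1" b x] Suc.hyps(2) Suc.prems j by simp
    moreover have "down a b (T (a + 1) y) = T a (down a b y)" for y
      using down_T[of a a b y] Suc.prems j by simp
    ultimately show ?thesis using half_twist_rec4[of a b] Suc.prems j by simp
  qed
qed

lemma half_twist_word: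
  assumes "lo \<le> a" "b \<le> hi" "set w \<subseteq> {a..b}"
  shows "half_twist a b (foldr T w x) = foldr T (map (\<lambda>j. a + b - j) w) (half_twist a b x)"
  using assms by (intro foldr_intertwine half_twist_T) auto

text \<open>By \<open>half_twist_rec2\<close> the half twist begins with the one of
  \<open>[a + 1, b]\<close>, and so on until the interval begins at \<open>j\<close>.\<close>

lemma half_twist_starts:
  assumes "lo \<le> a" "b \<le> hi" "a \<le> j" "j \<le> b"
  shows "\<exists>w. \<forall>x. half_twist a b x = T j (foldr T w x)"
  using assms
proof (induction "nat (j - a)" arbitrary: a)
  case 0
  then have "j = a" by simp
  then have "half_twist a b x = T j (foldr T ([a + 1..b] @ delta a (b - 1)) x)" for x
    using half_twist_rec1[of a b x] up_first[of a b] 0 by simp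
  then show ?case by blast
next
  case (Suc n)
  then obtain w where w: "\<And>x. half_twist (a + 1) b x = T j (foldr T w x)"
    using Suc.hyps(1)[of "a + 1"] by force
  have "half_twist a b x = T j (foldr T (w @ [a..b]) x)" for x
    using half_twist_rec2[of a b x] w Suc by simp
  then show ?case by blast
qed

text \<open>The recursion for the full twist: \<open>down a b\<close> composed with
  \<open>up a b\<close> is the last strand winding once around the others.\<close>

lemma half_twist_square:
  assumes "lo \<le> a" "a \<le> b" "b \<le> hi"
  shows "half_twist a b (half_twist a b x)
    = down a b (up a b (half_twist a (b - 1) (half_twist a (b - 1) x)))"
proof -
  have "half_twist (a + 1) b (up a b y) = up a b (half_twist a (b - 1) y)" for y
    using half_twist_rec2[OF assms] half_twist_rec1[OF assms(2)] by simp
  moreover have "half_twist a b (half_twist a b x)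
      = down a b (half_twist (a + 1) b (up a b (half_twist a (b - 1) x)))"
    using half_twist_rec4[OF assms] half_twist_rec1[OF assms(2), of x] by simp
  ultimately show ?thesis by simp
qed

text \<open>Two palindromic lifts of the transposition of the end points \<open>a\<close> and
  \<open>b + 1\<close>; they agree because \<open>up a b\<close> raises each index of
  \<open>down a (b - 1)\<close> by one.\<close>

lemma down_up:
  assumes "lo \<le> a" "a \<le> b" "b \<le> hi"
  shows "down a b (up (a + 1) b x) = up a b (down a (b - 1) x)"
proof -
  have "up a b (foldr T (rev [a..b - 1]) x) = foldr T (map (\<lambda>i. i + 1) (rev [a..b - 1])) (up a b x)"
    using assms by (intro foldr_intertwine up_T) auto
  moreover have "map (\<lambda>i. i + 1) (rev [a..b - 1]) = rev [a + 1..b]"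
    using map_add_upto[of 1 a "b - 1"] by (simp add: rev_map[symmetric])
  ultimately have "up a b (down a (b - 1) x) = down (a + 1) b (up a b x)" by simp
  then show ?thesis using down_last[OF assms(2)] up_first[OF assms(2)] by simp
qed

end

section \<open>Jucys-Murphy operators\<close>

text \<open>Only these relations are used for the main identity, so one computation serves all three
  types. \<open>T_y_T\<close> replaces conjugation by a relation between positive words.\<close>

locale jucys_murphy = braid_chain T lo "n - 1" for T :: "int \<Rightarrow> 'x \<Rightarrow> 'x" and lo n :: int +
  fixes y :: "int \<Rightarrow> 'x \<Rightarrow> 'x"
  assumes y_T: "lo \<le> i \<Longrightarrow> i \<le> n \<Longrightarrow> lo \<le> j \<Longrightarrow> j \<le> n - 1 \<Longrightarrow> j \<noteq> i \<Longrightarrow> j \<noteq> i - 1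
      \<Longrightarrow> y i (T j x) = T j (y i x)"
    and y_y: "lo \<le> i \<Longrightarrow> i < j \<Longrightarrow> j \<le> n \<Longrightarrow> y i (y j x) = y j (y i x)"
    and T_y_T: "lo \<le> i \<Longrightarrow> i \<le> n - 1 \<Longrightarrow> T i (y (i + 1) (T i x)) = y i x"
begin

abbreviation ys :: "int \<Rightarrow> int \<Rightarrow> 'x \<Rightarrow> 'x" where
  "ys a b \<equiv> foldr y [a..b]"

lemma ys_last: "a \<le> b \<Longrightarrow> ys a b x = ys a (b - 1) (y b x)"
  by (simp add: upto_rec2)

lemma ys_split: "a \<le> c + 1 \<Longrightarrow> c \<le> b \<Longrightarrow> ys a b x = ys a c (ys (c + 1) b x)"
  by (cases "a = c + 1") (simp_all add: upto_split2[of a c b])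

lemma y_ys:
  assumes "lo \<le> i" "i \<le> n" "lo \<le> a" "b \<le> n"
  shows "y i (ys a b x) = ys a b (y i x)"
proof (rule foldr_commute)
  fix s z assume "s \<in> set [a..b]"
  then show "y i (y s z) = y s (y i z)"
    using y_y[of i s z] y_y[of s i z] assms by (cases i s rule: linorder_cases) auto
qed

lemma ys_ys:
  assumes "lo \<le> c" "d \<le> n" "lo \<le> a" "b \<le> n"
  shows "ys a b (ys c d x) = ys c d (ys a b x)"
proof (rule foldr_commute)
  fix s z assume "s \<in> set [c..d]"
  then show "ys a b (y s z) = y s (ys a b z)" using y_ys[of s a b z] assms by simp
qed

text \<open>\<open>T j\<close> commutes with \<open>y j\<close> composed with \<open>y (j + 1)\<close>, so only the two ends of the
  interval matter.\<close>

lemma T_ys: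
  assumes "lo \<le> a" "b \<le> n" "lo \<le> j" "j \<le> n - 1" "j \<noteq> b" "j \<noteq> a - 1"
  shows "T j (ys a b x) = ys a b (T j x)"
proof (cases "a \<le> j \<and> j < b")
  case True
  have pair: "T j (y j (y (j + 1) z)) = y j (y (j + 1) (T j z))" for z
  proof -
    have "y j (y (j + 1) (T j z)) = y (j + 1) (y j (T j z))"
      using y_y[of j "j + 1" "T j z"] assms by simp
    also have "\<dots> = y (j + 1) (T j (y (j + 1) (T j (T j z))))" using T_y_T[of j "T j z"] assms by simp
    finally have 1: "y j (y (j + 1) (T j z)) = T j (y (j + 1) (T j (y (j + 1) (T j z))))"
      using T_y_T[of j "y (j + 1) (T j z)"] assms by simp
    have "T j (y j (y (j + 1) z)) = T j (y (j + 1) (y j z))"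
      using y_y[of j "j + 1" z] assms by simp
    also have "\<dots> = T j (y (j + 1) (T j (y (j + 1) (T j z))))" using T_y_T[of j z] assms by simp
    finally show ?thesis using 1 by simp
  qed
  have e: "ys a b z = ys a (j - 1) (y j (y (j + 1) (ys (j + 2) b z)))" for z
  proof -
    have "ys a b z = ys a (j - 1) (ys j b z)" using ys_split[of a "j - 1" b z] True by simp
    also have "ys j b z = y j (y (j + 1) (ys (j + 2) b z))" using True by (simp add: upto_rec1 add.commute)
    finally show ?thesis .
  qed
  have l: "T j (ys a (j - 1) z) = ys a (j - 1) (T j z)" for z
    using assms True by (intro foldr_commute y_T[symmetric]) auto
  have r: "T j (ys (j + 2) b z) = ys (j + 2) b (T j z)" for z
    using assms True by (intro foldr_commute y_T[symmetric]) auto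
  show ?thesis unfolding e l pair r ..
next
  case False
  then show ?thesis using assms by (intro foldr_commute y_T[symmetric]) auto
qed

lemma word_ys:
  assumes "lo \<le> a" "b \<le> n" "\<And>j. j \<in> set w \<Longrightarrow> lo \<le> j \<and> j \<le> n - 1 \<and> j \<noteq> b \<and> j \<noteq> a - 1"
  shows "foldr T w (ys a b x) = ys a b (foldr T w x)"
proof -
  have "ys a b (foldr T w x) = foldr T w (ys a b x)"
    using assms by (intro foldr_commute T_ys[symmetric]) auto
  then show ?thesis ..
qed

text \<open>The outer pair of \<open>T d\<close> reaches \<open>y (d + 1)\<close> and turns it into
  \<open>y d\<close>; by induction all factors of \<open>down\<close> and \<open>up\<close> are
  absorbed and every index of a \<open>y\<close> falls by one.\<close>

lemma down_ys_up:
  assumes "lo \<le> a" "a \<le> d + 1" "d \<le> n - 1"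
  shows "down a d (ys (a + 1) (d + 1) (up a d x)) = ys a d x"
  using assms
proof (induction "nat (d + 1 - a)" arbitrary: d x)
  case 0
  then have "d = a - 1" by simp
  then show ?case by simp
next
  case (Suc k)
  then have ad: "a \<le> d" by simp
  have "down a d (ys (a + 1) (d + 1) (up a d x))
      = T d (down a (d - 1) (ys (a + 1) d (y (d + 1) (up a (d - 1) (T d x)))))"
    using down_first[OF ad] up_last[OF ad] ys_last[of "a + 1" "d + 1"] ad by simp
  also have "y (d + 1) (up a (d - 1) (T d x)) = up a (d - 1) (y (d + 1) (T d x))"
    using Suc.prems by (intro foldr_commute y_T) auto
  also have "down a (d - 1) (ys (a + 1) d (up a (d - 1) (y (d + 1) (T d x)))) = ys a (d - 1) (y (d + 1) (T d x))"
    using Suc.hyps(1)[of "d - 1" "y (d + 1) (T d x)"] Suc.hyps(2) Suc.prems ad by simp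
  also have "T d (ys a (d - 1) (y (d + 1) (T d x))) = ys a (d - 1) (T d (y (d + 1) (T d x)))"
    using Suc.prems ad by (intro T_ys) auto
  also have "T d (y (d + 1) (T d x)) = y d x" using T_y_T[of d x] Suc.prems ad by simp
  also have "ys a (d - 1) (y d x) = ys a d x" using ys_last[OF ad, of x] by simp
  finally show ?case .
qed

text \<open>The half twists carry the \<open>e - b\<close> operators at the end of
  \<open>[a, e]\<close> to its start, so they end at \<open>g - 1\<close>. Crossings between the
  blocks \<open>[a, g - 1]\<close> and \<open>[g, e]\<close> of points are absorbed; the full twist
  of each block is left over. The induction raises \<open>a\<close> with \<open>b\<close> and
  \<open>e\<close> fixed.\<close>

lemma half_twist_ys_half_twist:
  assumes "lo \<le> a" "a \<le> b + 1" "b \<le> e" "e \<le> n" "g = a + e - b"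
  shows "half_twist a (e - 1) (ys (b + 1) e (half_twist a (e - 1) x))
    = ys a (g - 1) (half_twist a (g - 2) (half_twist a (g - 2)
        (half_twist g (e - 1) (half_twist g (e - 1) x))))"
  using assms
proof (induction "nat (b + 1 - a)" arbitrary: a g x)
  case 0
  then have a: "a = b + 1" "g = e + 1" by simp_all
  have "half_twist a (e - 1) (ys a e z) = ys a e (half_twist a (e - 1) z)" for z
    using set_delta[of a "e - 1"] 0 by (intro word_ys) auto
  then show ?case using a by simp
next
  case (Suc k)
  define c where "c = e - 1"
  have ab: "a \<le> b" using Suc by simp
  then have ac: "a \<le> c + 1" "g \<le> c + 1" "a \<le> g" "c \<le> n - 1" "lo \<le> a" "g = a + e - b"
    using Suc.prems by (auto simp: c_def)
  show ?case
  proof (cases "b = e")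
    case True
    then have "g = a" using ac by simp
    then show ?thesis using True by simp
  next
    case False
    then have ac': "a \<le> c" using ab Suc.prems by (simp add: c_def)
    have IH: "half_twist (a + 1) c (ys (b + 1) e (half_twist (a + 1) c z))
      = ys (a + 1) g (half_twist (a + 1) (g - 1) (half_twist (a + 1) (g - 1)
          (half_twist (g + 1) c (half_twist (g + 1) c z))))" for z
    proof -
      have "k = nat (b + 1 - (a + 1))" "lo \<le> a + 1" "a + 1 \<le> b + 1" "g + 1 = a + 1 + e - b"
        using Suc.hyps(2) Suc.prems ab by simp_all
      from Suc.hyps(1)[OF this(1-3) Suc.prems(3,4) this(4), of z]
      show ?thesis unfolding c_def by simp
    qed
    have ht_up: "half_twist (i + 1) (j + 1) (up a c z) = up a c (half_twist i j z)"
      if "a \<le> i" "j < c" for i j z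
    proof -
      have "up a c (half_twist i j z) = foldr T (map (\<lambda>i. i + 1) (delta i j)) (up a c z)"
        using that ac set_delta[of i j] by (intro foldr_intertwine up_T) auto
      then show ?thesis by (simp add: delta_shift)
    qed
    have up_g: "half_twist (a + 1) (g - 1) (up a c z) = up a c (half_twist a (g - 2) z)" for z
      using ht_up[of a "g - 2" z] ac(2) by simp
    have up_c: "half_twist (g + 1) c (up a c z) = up a c (half_twist g (c - 1) z)" for z
      using ht_up[of g "c - 1" z] ac by simp
    have sq: "half_twist g c (half_twist g c x)
        = down g c (up g c (half_twist g (c - 1) (half_twist g (c - 1) x)))"
      using half_twist_square[of g c x] ac(2-5) by (cases "g \<le> c") simp_all
    \<comment> \<open>Split at \<open>g - 1\<close>: the lower parts of \<open>down\<close> and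
      \<open>up\<close> are absorbed by the operators, the upper parts commute out and, by
      \<open>sq\<close>, complete the full twist of the second block.\<close>
    have key: "down a c (ys (a + 1) g (up a c z)) = ys a (g - 1) (down g c (up g c z))" for z
    proof -
      have "down a c (ys (a + 1) g (up a c z))
          = down g c (down a (g - 1) (ys (a + 1) g (up a (g - 1) (up g c z))))"
        using down_split[of a "g - 1" c] up_split[of a "g - 1" c] ac by simp
      also have "\<dots> = down g c (ys a (g - 1) (up g c z))"
        using down_ys_up[of a "g - 1" "up g c z"] ac by simp
      also have "\<dots> = ys a (g - 1) (down g c (up g c z))"
        using ac by (intro word_ys) auto
      finally show ?thesis .
    qed
    have cm: "foldr T w (half_twist a (g - 2) z) = half_twist a (g - 2) (foldr T w z)"
      if "set w \<subseteq> {g..c}" for w z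
      using that ac set_delta[of a "g - 2"] by (intro far_words) force
    have cm: "up g c (half_twist a (g - 2) z) = half_twist a (g - 2) (up g c z)"
      "down g c (half_twist a (g - 2) z) = half_twist a (g - 2) (down g c z)" for z
      by (rule cm; simp)+
    have "half_twist a c (ys (b + 1) e (half_twist a c x))
        = down a c (half_twist (a + 1) c (ys (b + 1) e (half_twist (a + 1) c (up a c x))))"
      using half_twist_rec4[of a c] half_twist_rec2[of a c x] ac ac' by simp
    also have "\<dots> = down a c (ys (a + 1) g (up a c (half_twist a (g - 2) (half_twist a (g - 2)
        (half_twist g (c - 1) (half_twist g (c - 1) x))))))"
      unfolding IH up_c up_g ..
    also have "\<dots> = ys a (g - 1) (down g c (up g c (half_twist a (g - 2) (half_twist a (g - 2)
        (half_twist g (c - 1) (half_twist g (c - 1) x))))))"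
      by (rule key)
    also have "\<dots> = ys a (g - 1) (half_twist a (g - 2) (half_twist a (g - 2)
        (down g c (up g c (half_twist g (c - 1) (half_twist g (c - 1) x))))))"
      unfolding cm ..
    also have "\<dots> = ys a (g - 1) (half_twist a (g - 2) (half_twist a (g - 2)
        (half_twist g c (half_twist g c x))))"
      unfolding sq ..
    finally show ?thesis by (simp only: c_def)
  qed
qed

end

lemma (in jucys_murphy) half_twist_ys_B2:
  assumes "lo = 1" "0 \<le> m" "2 * m \<le> n"
  shows "half_twist 1 (2 * m - 1) (ys (m + 1) n (half_twist 1 (2 * m - 1) (ys (m + 1) n x)))
    = ys (m + 1) n (half_twist 1 (2 * m - 1) (ys (m + 1) n (half_twist 1 (2 * m - 1) x)))"
proof -
  define Q where "Q = (\<lambda>z. half_twist 1 (m - 1) (half_twist 1 (m - 1)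
      (half_twist (m + 1) (2 * m - 1) (half_twist (m + 1) (2 * m - 1) z))))"
  have tail: "half_twist 1 (2 * m - 1) (ys (2 * m + 1) n z) = ys (2 * m + 1) n (half_twist 1 (2 * m - 1) z)" for z
    using set_delta[of 1 "2 * m - 1"] assms by (intro word_ys) auto
  have split: "ys (m + 1) n z = ys (m + 1) (2 * m) (ys (2 * m + 1) n z)" for z
    using ys_split[of "m + 1" "2 * m" n z] assms by simp
  \<comment> \<open>Here \<open>a = 1\<close>, \<open>b = m\<close>, \<open>e = 2 * m\<close>, hence
    \<open>g = m + 1\<close>: two blocks of \<open>m\<close> points each.\<close>
  have core: "half_twist 1 (2 * m - 1) (ys (m + 1) (2 * m) (half_twist 1 (2 * m - 1) w)) = ys 1 m (Q w)" for w
  proof -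
    have g: "m + 1 - 1 = m" "m + 1 - 2 = m - 1" "m + 1 = 1 + 2 * m - m"
      and c: "lo \<le> 1" "1 \<le> m + 1" "m \<le> 2 * m" using assms by simp_all
    from half_twist_ys_half_twist[OF c assms(3) g(3), of w] show ?thesis unfolding Q_def g(1,2) .
  qed
  have main: "half_twist 1 (2 * m - 1) (ys (m + 1) n (half_twist 1 (2 * m - 1) z))
      = ys 1 m (Q (ys (2 * m + 1) n z))" for z
    unfolding split tail[symmetric] by (rule core)
  \<comment> \<open>The half twists in \<open>Q\<close> avoid \<open>T m\<close>, the only letter of
    the chain that \<open>word_ys\<close> excludes here.\<close>
  have "half_twist a b (ys (m + 1) n z) = ys (m + 1) n (half_twist a b z)"
    if "(a, b) = (1, m - 1) \<or> (a, b) = (m + 1, 2 * m - 1)" for a b z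
    using that set_delta[of a b] assms by (intro word_ys) force+
  then have "Q (ys (m + 1) n z) = ys (m + 1) n (Q z)" for z by (simp add: Q_def)
  then have "ys 1 m (Q (ys (2 * m + 1) n (ys (m + 1) n x)))
      = ys (m + 1) n (ys 1 m (Q (ys (2 * m + 1) n x)))"
    using ys_ys assms by simp
  then show ?thesis unfolding main .
qed

text \<open>Of \<open>z\<close> only commutation with the inner chain and the relation of length
  four are demanded, so it may be one generator or the product of the two tail generators of type
  D.\<close>

locale type_B_chain = braid_chain T lo "n - 1" for T :: "int \<Rightarrow> 'x \<Rightarrow> 'x" and lo n :: int +
  fixes z :: "'x \<Rightarrow> 'x"
  assumes z_T: "lo \<le> j \<Longrightarrow> j \<le> n - 2 \<Longrightarrow> z (T j x) = T j (z x)"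
    and z_braid: "lo \<le> n - 1 \<Longrightarrow> z (T (n - 1) (z (T (n - 1) x))) = T (n - 1) (z (T (n - 1) (z x)))"
begin

definition y :: "int \<Rightarrow> 'x \<Rightarrow> 'x" where
  "y i x = up i (n - 1) (z (down i (n - 1) x))"

lemma y_last: "y n x = z x"
  by (simp add: y_def)

lemma y_rec: "i \<le> n - 1 \<Longrightarrow> y i x = T i (y (i + 1) (T i x))"
  unfolding y_def using up_first[of i "n - 1"] down_last[of i "n - 1"] by simp

text \<open>The essential case is \<open>j = i + 1\<close>: unfolding \<open>y i\<close> twice, a
  braid relation turns \<open>T (i + 1)\<close> into \<open>T i\<close>, which passes
  \<open>y (i + 2)\<close>, and a second one turns it back.\<close>

lemma y_T:
  assumes "lo \<le> i" "i \<le> n" "lo \<le> j" "j \<le> n - 1" "j \<noteq> i" "j \<noteq> i - 1"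
  shows "y i (T j x) = T j (y i x)"
  using assms
proof (induction "nat (n - i)" arbitrary: i x)
  case 0
  then have "i = n" by simp
  then show ?case using 0 z_T[of j x] by (simp add: y_last)
next
  case (Suc k)
  then have i: "i \<le> n - 1" by simp
  consider "j + 2 \<le> i" | "j = i + 1" | "i + 2 \<le> j" using Suc.prems by linarith
  then show ?case
  proof cases
    case 1
    then have "foldr T w (T j v) = T j (foldr T w v)" if "set w \<subseteq> {i..n - 1}" for w v
      using that Suc.prems by (intro far_word[symmetric]) auto
    then show ?thesis using z_T[of j] Suc.prems 1 by (simp add: y_def)
  next
    case 2
    then have j: "i + 1 \<le> n - 1" using Suc.prems by simp
    have yi: "y i v = T i (T (i + 1) (y (i + 2) (T (i + 1) (T i v))))" for v
      using y_rec[OF i] y_rec[OF j] by (simp add: add.commute)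
    have c: "y (i + 2) (T i v) = T i (y (i + 2) v)" for v
    proof (cases "i + 2 = n")
      case True
      then show ?thesis using z_T[of i v] Suc.prems by (simp add: y_last[symmetric])
    next
      case False
      have "foldr T w (T i v) = T i (foldr T w v)" if "set w \<subseteq> {i + 2..n - 1}" for w v
        using that Suc.prems i by (intro far_word[symmetric]) auto
      then show ?thesis using z_T[of i] Suc.prems j by (simp add: y_def)
    qed
    have b: "T i (T (i + 1) (T i v)) = T (i + 1) (T i (T (i + 1) v))" for v
      using braid[of i v] Suc.prems j by simp
    let ?w = "T (i + 1) (T i x)"
    have "y i (T (i + 1) x) = T i (T (i + 1) (y (i + 2) (T (i + 1) (T i (T (i + 1) x)))))"
      by (rule yi)
    also have "T (i + 1) (T i (T (i + 1) x)) = T i ?w" by (rule b[symmetric])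
    also have "y (i + 2) (T i ?w) = T i (y (i + 2) ?w)" by (rule c)
    also have "T i (T (i + 1) (T i (y (i + 2) ?w))) = T (i + 1) (T i (T (i + 1) (y (i + 2) ?w)))"
      by (rule b)
    also have "T i (T (i + 1) (y (i + 2) ?w)) = y i x" by (rule yi[symmetric])
    finally show ?thesis using 2 by simp
  next
    case 3
    have "y (i + 1) (T j v) = T j (y (i + 1) v)" for v
      using Suc.hyps(1)[of "i + 1" v] Suc.hyps(2) Suc.prems 3 by simp
    moreover have "T i (T j v) = T j (T i v)" for v using far[of i j v] Suc.prems 3 by simp
    ultimately show ?thesis using y_rec[OF i] by simp
  qed
qed

text \<open>For \<open>i = n - 1\<close> this is the relation of length four; below that,
  \<open>T i\<close> commutes with \<open>z\<close> and the recursion for \<open>y i\<close>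
  applies.\<close>

lemma y_z:
  assumes "lo \<le> i" "i \<le> n"
  shows "y i (z x) = z (y i x)"
  using assms
proof (induction "nat (n - i)" arbitrary: i x)
  case 0
  then have "i = n" by simp
  then show ?case by (simp add: y_last)
next
  case (Suc k)
  then have i: "i \<le> n - 1" by simp
  show ?case
  proof (cases "i = n - 1")
    case True
    then show ?thesis using y_rec[OF i] z_braid[of x] Suc.prems by (simp add: y_last)
  next
    case False
    have "y (i + 1) (z v) = z (y (i + 1) v)" for v
      using Suc.hyps(1)[of "i + 1" v] Suc.hyps(2) Suc.prems False by simp
    moreover have "T i (z v) = z (T i v)" for v using z_T[of i v] Suc.prems False i by simp
    ultimately show ?thesis using y_rec[OF i] by simp
  qed
qed

sublocale jucys_murphy T lo n y
proof
  show "y i (T j x) = T j (y i x)"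
    if "lo \<le> i" "i \<le> n" "lo \<le> j" "j \<le> n - 1" "j \<noteq> i" "j \<noteq> i - 1" for i j x
    using y_T that .
  show "T i (y (i + 1) (T i x)) = y i x" if "lo \<le> i" "i \<le> n - 1" for i x
    using y_rec that by simp
  \<comment> \<open>\<open>y j\<close> is a word in \<open>z\<close> and the \<open>T l\<close> with
    \<open>l\<close> at least \<open>j\<close>, and \<open>y i\<close> commutes with each of these
    because \<open>i < j\<close>.\<close>
  show "y i (y j x) = y j (y i x)" if "lo \<le> i" "i < j" "j \<le> n" for i j x
  proof -
    have "y i (foldr T w v) = foldr T w (y i v)" if "set w \<subseteq> {j..n - 1}" for w v
      using that \<open>lo \<le> i\<close> \<open>i < j\<close> \<open>j \<le> n\<close> by (intro foldr_commute y_T) auto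
    then show ?thesis unfolding y_def[of j] using y_z[of i] that by simp
  qed
qed

end

text \<open>In types \<open>A\<close> and \<open>D\<close> moving \<open>\<kappa>\<close> past \<open>Y\<close> applies a diagram automorphism, whence \<open>\<kappa>'\<close>. All
  occurrences of \<open>\<kappa>\<close> and \<open>\<iota>\<close> can be moved to the right.\<close>

lemma B2_relation_with_parabolics:
  assumes "\<And>x. D (Y (D (Y x))) = Y (D (Y (D x)))"
    and "\<And>x. \<kappa> (D x) = D (\<kappa> x)" "\<And>x. \<kappa>' (D x) = D (\<kappa>' x)"
    and "\<And>x. \<kappa> (Y x) = Y (\<kappa>' x)" "\<And>x. \<kappa>' (Y x) = Y (\<kappa> x)"
    and "\<And>x. \<iota> (D x) = D (\<iota>' x)" "\<And>x. \<iota>' (D x) = D (\<iota> x)"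
    and "\<And>x. \<iota> (Y x) = Y (\<iota> x)" "\<And>x. \<iota>' (Y x) = Y (\<iota>' x)"
    and "\<And>x. \<kappa> (\<iota> x) = \<iota> (\<kappa> x)" "\<And>x. \<kappa>' (\<iota> x) = \<iota> (\<kappa>' x)"
    and "\<And>x. \<kappa> (\<iota>' x) = \<iota>' (\<kappa> x)" "\<And>x. \<kappa>' (\<iota>' x) = \<iota>' (\<kappa>' x)"
    and "\<And>x. \<kappa>' (\<kappa> x) = \<kappa> (\<kappa>' x)" "\<And>x. \<iota>' (\<iota> x) = \<iota> (\<iota>' x)"
  shows "D (\<kappa> (Y (\<iota> (D (\<kappa> (Y (\<iota> x))))))) = Y (\<iota> (D (\<kappa> (Y (\<iota> (D (\<kappa> x)))))))"
  unfolding assms(2-15) assms(1) ..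

section \<open>Permutation representations\<close>

text \<open>The action certifies both that words are reduced, through the height \<open>h\<close>,
  and that products of generators have the full order, through \<open>f_order\<close> and
  \<open>f_order4\<close>.\<close>

locale coxeter_action =
  fixes M :: "'i coxeter_matrix" and f :: "'i \<Rightarrow> 'x \<Rightarrow> 'x" and h :: "'x \<Rightarrow> int"
  assumes sym_bond: "i \<in> nodes M \<Longrightarrow> j \<in> nodes M \<Longrightarrow> bond M i j = bond M j i"
    and diag_bond: "i \<in> nodes M \<Longrightarrow> bond M i i = 1"
    and range_bond: "i \<in> nodes M \<Longrightarrow> j \<in> nodes M \<Longrightarrow> i \<noteq> j \<Longrightarrow> bond M i j \<in> {2, 3, 4}"
    and f_invol: "i \<in> nodes M \<Longrightarrow> f i (f i y) = y"
    and f_braid: "i \<in> nodes M \<Longrightarrow> j \<in> nodes M \<Longrightarrow> i \<noteq> j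
      \<Longrightarrow> foldr f (alt_word i j (bond M i j)) y = foldr f (alt_word j i (bond M i j)) y"
    and f_order: "i \<in> nodes M \<Longrightarrow> j \<in> nodes M \<Longrightarrow> i \<noteq> j \<Longrightarrow> \<exists>y. f i y \<noteq> f j y"
    and f_order4: "i \<in> nodes M \<Longrightarrow> j \<in> nodes M \<Longrightarrow> bond M i j = 4 \<Longrightarrow> \<exists>y. f i (f j (f i (f j y))) \<noteq> y"
    and potential: "i \<in> nodes M \<Longrightarrow> \<bar>h (f i y) - h y\<bar> \<le> 1"
begin

lemma f_rev: "set w \<subseteq> nodes M \<Longrightarrow> foldr f w (foldr f (rev w) y) = y"
proof (induction w arbitrary: y)
  case (Cons i w)
  then show ?case using f_invol[of i] by simp
qed simp

lemma f_relation:
  assumes "i \<in> nodes M" "j \<in> nodes M"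
  shows "foldr f (alt_word i j (2 * bond M i j)) y = y"
proof (cases "i = j")
  case True
  then show ?thesis using diag_bond f_invol assms by (simp add: numeral_2_eq_2)
next
  case False
  let ?m = "bond M i j"
  have "alt_word i j (2 * ?m) = alt_word i j ?m @ rev (alt_word j i ?m)"
    using alt_word_add[of i j ?m ?m] by (auto simp: rev_alt_word mult_2)
  then show ?thesis
    using f_braid[OF assms False] f_rev[of "alt_word j i ?m"] set_alt_word[of j i ?m] assms by auto
qed

text \<open>With bonds at most 4, an exponent \<open>k\<close> coprime to the bond would make the
  product itself trivial, against \<open>f_order\<close>; only \<open>k = 2\<close> with bond 4
  remains, which is \<open>f_order4\<close>.\<close>

lemma f_order_exact:
  assumes "i \<in> nodes M" "j \<in> nodes M" "i \<noteq> j" "0 < k" "k < bond M i j"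
  shows "\<not> pres_cong (nodes M) (coxeter_relations M) (alt_word i j (2 * k)) []"
proof
  assume "pres_cong (nodes M) (coxeter_relations M) (alt_word i j (2 * k)) []"
  then have "foldr f (alt_word i j (2 * k)) y = foldr f [] y" for y
  proof (rule pres_cong_action)
    fix a b z assume "(a, b) \<in> coxeter_relations M"
    then show "foldr f a z = foldr f b z"
      using f_relation by (auto simp: coxeter_relations_def concat_replicate_pair)
  qed
  then have k: "foldr f (alt_word i j (2 * k)) y = y" for y by simp
  have m: "foldr f (alt_word i j (2 * bond M i j)) y = y" for y using f_relation assms by simp
  obtain y0 where "f i y0 \<noteq> f j y0" using f_order assms by blast
  then have y0: "f i (f j y0) \<noteq> y0" using f_invol[of i "f j y0"] assms(1) by metis
  have "k \<in> {1, 2, 3}" "bond M i j \<in> {2, 3, 4}" using range_bond assms by fastforce+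
  then consider "k = 1" | "k = 2" "bond M i j = 3" | "k = 2" "bond M i j = 4" | "k = 3" "bond M i j = 4"
    using assms(5) by fastforce
  then show False
  proof cases
    case 1
    then show False using k[of y0] y0 by (simp add: eval_nat_numeral)
  next
    case 2
    then have "f i (f j (f i (f j y))) = y" for y using k[of y] by (simp add: eval_nat_numeral)
    then show False using m[of y0] y0 2 by (simp add: eval_nat_numeral)
  next
    case 3
    then show False using f_order4[OF assms(1,2)] k by (auto simp: eval_nat_numeral)
  next
    case 4
    then have "f i (f j (f i (f j (f i (f j y))))) = y" for y using k[of y] by (simp add: eval_nat_numeral)
    then show False using m[of y0] y0 4 by (simp add: eval_nat_numeral)
  qed
qed

sublocale coxeter_system M
proof
  show "bond M i j \<ge> 2" if "i \<in> nodes M" "j \<in> nodes M" "i \<noteq> j" for i j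
    using range_bond[OF that] by auto
qed (use sym_bond diag_bond f_order_exact in auto)

lemma reduced_path:
  assumes "reduced u" "\<And>i. i \<in> set u \<Longrightarrow> f i x = x" "set c \<subseteq> nodes M"
    and "h (foldr f c x) = h x - int (length c)"
  shows "reduced (c @ u)"
  using reduced_coset[of f h u x c] f_relation potential assms by blast

end

locale interval_action = coxeter_action M f h
  for M :: "int coxeter_matrix" and f :: "int \<Rightarrow> int \<Rightarrow> int" and h :: "int \<Rightarrow> int" +
  fixes lo hi :: int
  assumes interval: "{lo..hi} \<subseteq> nodes M"
    and f_step: "lo \<le> i \<Longrightarrow> i \<le> hi \<Longrightarrow> f i (i + 1) = i"
    and f_fix: "lo \<le> i \<Longrightarrow> i < j \<Longrightarrow> j \<le> hi \<Longrightarrow> f i (j + 1) = j + 1"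
    and h_interval: "lo \<le> i \<Longrightarrow> i \<le> hi + 1 \<Longrightarrow> h i = i"
    and bond_interval: "lo \<le> i \<Longrightarrow> i < j \<Longrightarrow> j \<le> hi \<Longrightarrow> bond M i j = (if j = i + 1 then 3 else 2)"
begin

sublocale braid_chain gen_op lo hi
proof
  show "gen_op i (gen_op j x) = gen_op j (gen_op i x)" if "lo \<le> i" "i + 2 \<le> j" "j \<le> hi" for i j x
    using that interval bond_interval[of i j] by (intro gen_op_bond2) auto
  show "gen_op i (gen_op (i + 1) (gen_op i x)) = gen_op (i + 1) (gen_op i (gen_op (i + 1) x))"
    if "lo \<le> i" "i + 1 \<le> hi" for i x
    using that interval bond_interval[of i "i + 1"] by (intro gen_op_bond3) auto
qed

lemma f_path:
  assumes "lo \<le> a" "a \<le> b + 1" "b \<le> hi"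
  shows "foldr f [a..b] (b + 1) = a"
  using assms
proof (induction "nat (b + 1 - a)" arbitrary: a)
  case 0
  then show ?case by simp
next
  case (Suc k)
  then have "foldr f [a + 1..b] (b + 1) = a + 1" by (cases "a = b") auto
  then show ?case using Suc f_step[of a] by (simp add: upto_rec1)
qed

text \<open>The letters of \<open>delta a (b - 1)\<close> fix the point \<open>b + 1\<close>, and
  the block \<open>[a..b]\<close> carries it down to \<open>a\<close>, one unit of height per
  letter.\<close>

lemma delta_reduced:
  assumes "lo \<le> a" "b \<le> hi"
  shows "reduced (delta a b)"
  using assms
proof (induction "nat (b + 1 - a)" arbitrary: b)
  case 0
  then show ?case by (simp add: reduced_Nil)
next
  case (Suc k)
  then have ab: "a \<le> b" by simp
  have "reduced ([a..b] @ delta a (b - 1))"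
  proof (rule reduced_path)
    show "reduced (delta a (b - 1))" using Suc.hyps(1)[of "b - 1"] Suc.hyps(2) Suc.prems by simp
    show "f i (b + 1) = b + 1" if "i \<in> set (delta a (b - 1))" for i
      using that set_delta[of a "b - 1"] f_fix[of i b] Suc.prems by auto
    show "set [a..b] \<subseteq> nodes M" using interval Suc.prems by auto
    show "h (foldr f [a..b] (b + 1)) = h (b + 1) - int (length [a..b])"
      using f_path[of a b] h_interval[of a] h_interval[of "b + 1"] Suc.prems ab by simp
  qed
  then show ?case using ab by (simp add: delta_rec)
qed

lemma delta_longest:
  assumes "lo \<le> a" "b \<le> hi"
  shows "longest_word {a..b} (delta a b)"
proof (rule longest_wordI)
  show "\<exists>w. \<forall>X. foldr gen_op (delta a b) X = gen_op s (foldr gen_op w X)" if "s \<in> {a..b}" for s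
    using half_twist_starts[of a b s] assms that by simp
qed (use set_delta interval delta_reduced assms in auto)

end

lemma (in coxeter_system) gen_op_orthogonal:
  assumes "set u \<subseteq> nodes M" "set v \<subseteq> nodes M"
    and "\<And>i j. i \<in> set u \<Longrightarrow> j \<in> set v \<Longrightarrow> bond M i j = 2"
  shows "foldr gen_op u (foldr gen_op v X) = foldr gen_op v (foldr gen_op u X)"
  using gen_op_aeq[OF aeq_commute_words[OF assms], of X] by simp

text \<open>Split \<open>K\<close> into \<open>K - \<sigma> K\<close> and the \<open>\<sigma>\<close>-stable part \<open>K \<inter> \<sigma> K\<close>.\<close>

lemma (in coxeter_system) weakly_orthogonal_commute:
  assumes \<sigma>: "diagram_involution \<sigma>" and K: "K \<subseteq> nodes M"
    and wo: "weakly_orthogonal M K (\<sigma> ` K)" and u: "longest_word K u"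
  shows "foldr gen_op (map \<sigma> u) (foldr gen_op u X) = foldr gen_op u (foldr gen_op (map \<sigma> u) X)"
proof -
  let ?K' = "\<sigma> ` K"
  have inv: "\<sigma> i \<in> nodes M" "\<sigma> (\<sigma> i) = i" if "i \<in> nodes M" for i
    using \<sigma> that by (auto simp: diagram_involution_def)
  have K': "?K' \<subseteq> nodes M" using K inv by auto
  have orth: "bond M i j = 2" if "i \<in> K - ?K'" "j \<in> ?K'" for i j
    using wo that by (auto simp: weakly_orthogonal_def orthogonal_nodes_def)
  have orth': "bond M i j = 2" if "i \<in> ?K' - K" "j \<in> K" for i j
    using wo that by (auto simp: weakly_orthogonal_def orthogonal_nodes_def)
  obtain u1 where u1: "longest_word (K - ?K') u1"
    using longest_word_exists[OF u K, of "K - ?K'"] by blast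
  obtain u0 where u0: "longest_word (K \<inter> ?K') u0"
    using longest_word_exists[OF u K, of "K \<inter> ?K'"] by blast
  have "longest_word ((K - ?K') \<union> (K \<inter> ?K')) (u1 @ u0)"
    using u1 u0 K orth by (intro longest_word_union) auto
  moreover have "(K - ?K') \<union> (K \<inter> ?K') = K" by blast
  ultimately have lu: "longest_word K (u1 @ u0)" by simp
  have im1: "\<sigma> ` (K - ?K') = ?K' - K"
  proof (intro equalityI subsetI)
    fix x assume "x \<in> \<sigma> ` (K - ?K')"
    then obtain i where i: "i \<in> K" "i \<notin> ?K'" "x = \<sigma> i" by blast
    have "x \<notin> K"
    proof
      assume "x \<in> K"
      moreover have "i = \<sigma> x" using i inv K by auto
      ultimately show False using i by blast
    qed
    then show "x \<in> ?K' - K" using i by blast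
  next
    fix x assume "x \<in> ?K' - K"
    then obtain i where i: "i \<in> K" "\<sigma> i \<notin> K" "x = \<sigma> i" by blast
    have "i \<notin> ?K'"
    proof
      assume "i \<in> ?K'"
      then obtain j where "j \<in> K" "i = \<sigma> j" by blast
      then show False using i inv K by auto
    qed
    then show "x \<in> \<sigma> ` (K - ?K')" using i by blast
  qed
  have im0: "\<sigma> ` (K \<inter> ?K') = K \<inter> ?K'"
  proof -
    have "\<sigma> i \<in> K" if "i \<in> ?K'" for i using that inv K by auto
    moreover have "i \<in> \<sigma> ` (K \<inter> ?K')" if i: "i \<in> K" "i \<in> ?K'" for i
    proof -
      obtain j where j: "j \<in> K" "i = \<sigma> j" using i(2) by blast
      then have "j = \<sigma> i" using inv K by auto
      then have "j \<in> ?K'" using i(1) by blast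
      then show ?thesis using j by blast
    qed
    ultimately show ?thesis by blast
  qed
  let ?A = "foldr gen_op u1" and ?B = "foldr gen_op u0" and ?C = "foldr gen_op (map \<sigma> u1)"
  have s: "set u1 \<subseteq> K - ?K'" "set u0 \<subseteq> K \<inter> ?K'" "set (map \<sigma> u1) \<subseteq> ?K' - K"
    using u1 u0 im1 unfolding longest_word_def by auto
  have op: "foldr gen_op u Z = ?A (?B Z)" for Z
    using gen_op_longest_word[OF u lu K, of Z] by simp
  \<comment> \<open>The stable part is only permuted by \<open>\<sigma>\<close>, so the image of its
    longest word is again a longest word of the same set and gives the same operator.\<close>
  have l0: "longest_word (K \<inter> ?K') (map \<sigma> u0)"
    using longest_word_map[OF \<sigma> u0] K unfolding im0 by blast
  have op': "foldr gen_op (map \<sigma> u) Z = ?C (?B Z)" for Z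
  proof -
    have "foldr gen_op (map \<sigma> u) Z = foldr gen_op (map \<sigma> (u1 @ u0)) Z"
      using gen_op_longest_word[OF longest_word_map[OF \<sigma> u K] longest_word_map[OF \<sigma> lu K] K'] .
    also have "\<dots> = ?C (foldr gen_op (map \<sigma> u0) Z)" by simp
    also have "foldr gen_op (map \<sigma> u0) Z = ?B Z"
      using gen_op_longest_word[OF l0 u0] K by blast
    finally show ?thesis .
  qed
  have comm: "foldr gen_op v (foldr gen_op w Z) = foldr gen_op w (foldr gen_op v Z)"
    if "set v \<subseteq> A" "set w \<subseteq> B" "A \<subseteq> nodes M" "B \<subseteq> nodes M"
      "\<And>i j. i \<in> A \<Longrightarrow> j \<in> B \<Longrightarrow> bond M i j = 2" for v w A B Z
    using that(1-4) by (intro gen_op_orthogonal that(5)) auto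
  have AB: "?B (?A Z) = ?A (?B Z)" for Z
    by (rule comm[OF s(1,2), symmetric]) (use K orth in auto)
  have CB: "?B (?C Z) = ?C (?B Z)" for Z
    by (rule comm[OF s(3,2), symmetric]) (use K K' orth' in auto)
  have CA: "?C (?A Z) = ?A (?C Z)" for Z
    by (rule comm[OF s(3,1)]) (use K K' orth' in auto)
  show ?thesis unfolding op op' by (simp only: AB CB CA)
qed

text \<open>Negative points are moved along with the positive ones, so that the same map serves in types
  \<open>A\<close>, \<open>B\<close> and \<open>D\<close>.\<close>

definition swap :: "int \<Rightarrow> int \<Rightarrow> int" where
  "swap i x = (if x = i then i + 1 else if x = i + 1 then i
     else if x = - i then - (i + 1) else if x = - (i + 1) then - i else x)"

lemma swap_swap: "1 \<le> i \<Longrightarrow> swap i (swap i x) = x"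
  by (simp add: swap_def)

lemma swap_far: "1 \<le> i \<Longrightarrow> i + 2 \<le> j \<Longrightarrow> swap i (swap j x) = swap j (swap i x)"
  by (simp add: swap_def)

lemma swap_braid:
  assumes "1 \<le> i"
  shows "swap i (swap (i + 1) (swap i x)) = swap (i + 1) (swap i (swap (i + 1) x))"
proof -
  have "x \<in> {i, i + 1, i + 2, - i, - (i + 1), - (i + 2)} \<or>
    (x \<noteq> i \<and> x \<noteq> i + 1 \<and> x \<noteq> i + 2 \<and> x \<noteq> - i \<and> x \<noteq> - (i + 1) \<and> x \<noteq> - (i + 2))" by auto
  then show ?thesis using assms by (elim disjE insertE) (simp_all add: swap_def)
qed

lemma swap_step: "1 \<le> i \<Longrightarrow> swap i (i + 1) = i"
  and swap_step_neg: "1 \<le> i \<Longrightarrow> swap i (- i) = - (i + 1)"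
  and swap_fix: "1 \<le> i \<Longrightarrow> i + 1 < \<bar>x\<bar> \<or> \<bar>x\<bar> < i \<Longrightarrow> swap i x = x"
  by (auto simp: swap_def)

lemma swap_diff: "1 \<le> i \<Longrightarrow> \<bar>swap i x - x\<bar> \<le> 1"
  by (simp add: swap_def)

lemma swap_neq: "1 \<le> i \<Longrightarrow> 1 \<le> j \<Longrightarrow> i \<noteq> j \<Longrightarrow> swap i i \<noteq> swap j i"
  by (simp add: swap_def)

section \<open>Type A\<close>

lemma nodes_A: "nodes (type_A r) = {1..r}"
  and bond_A: "bond (type_A r) i j = (if i = j then 1 else if \<bar>i - j\<bar> = 1 then 3 else 2)"
  by (simp_all add: type_A_def)

lemma alt_word_numerals:
  "alt_word i j 2 = [i, j]" "alt_word i j 3 = [i, j, i]" "alt_word i j 4 = [i, j, i, j]"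
  by (simp_all add: eval_nat_numeral)

interpretation type_A: interval_action "type_A r" swap "\<lambda>x. x" 1 r for r
proof
  show "bond (type_A r) i j = bond (type_A r) j i" for i j
    by (simp add: bond_A abs_minus_commute)
  fix i j y assume ij: "i \<in> nodes (type_A r)" "j \<in> nodes (type_A r)" "i \<noteq> j"
  consider "j = i + 1" | "i = j + 1" | "i + 2 \<le> j" | "j + 2 \<le> i" using ij(3) by linarith
  then show "foldr swap (alt_word i j (bond (type_A r) i j)) y = foldr swap (alt_word j i (bond (type_A r) i j)) y"
    using ij swap_braid[of i y] swap_braid[of j y] swap_far[of i j y] swap_far[of j i y]
    by cases (simp_all add: nodes_A bond_A alt_word_numerals)
  show "\<exists>y. swap i y \<noteq> swap j y" using swap_neq[of i j] ij unfolding nodes_A by (metis atLeastAtMost_iff)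
qed (simp_all add: nodes_A bond_A swap_swap swap_step swap_fix swap_diff
  split: if_splits)

text \<open>Folding: in type \<open>A\<^bsub>r\<^esub>\<close>, the operators \<open>T i \<circ> T (r + 1 - i)\<close> for \<open>i < k\<close> form a chain, and
  the reflections \<open>down i (r + 1 - i) \<circ> up (i + 1) (r + 1 - i)\<close> are Jucys-Murphy operators for it.\<close>

locale folded_chain = braid_chain T 1 r for T :: "int \<Rightarrow> 'x \<Rightarrow> 'x" and r :: int
begin

text \<open>The rank of the folded chain: for \<open>i < k\<close> the nodes \<open>i\<close> and
  \<open>r + 1 - i\<close> are at distance at least 2. In the middle, \<open>refl k\<close> is
  \<open>T k\<close> for odd \<open>r\<close> and \<open>T (k + 1) T k T (k + 1)\<close> for even
  \<open>r\<close>.\<close>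

definition k :: int where
  "k = (r + 1) div 2"

definition pair :: "int \<Rightarrow> 'x \<Rightarrow> 'x" where
  "pair i x = T i (T (r + 1 - i) x)"

text \<open>A positive lift of the transposition of the points \<open>i\<close> and
  \<open>r + 2 - i\<close>, which the diagram reflection interchanges.\<close>

definition refl :: "int \<Rightarrow> 'x \<Rightarrow> 'x" where
  "refl i x = down i (r + 1 - i) (up (i + 1) (r + 1 - i) x)"

lemma k_bounds: "2 * k \<le> r + 1" "r \<le> 2 * k"
  unfolding k_def by presburger+

lemma cross:
  assumes "1 \<le> i" "i \<le> k - 1" "1 \<le> j" "j \<le> k - 1"
  shows "T i (T (r + 1 - j) x) = T (r + 1 - j) (T i x)"
  using assms k_bounds by (intro far) auto

text \<open>The index \<open>l\<close> is raised by \<open>up\<close> and lowered again by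
  \<open>down\<close>; the strict bounds keep both shifts in range.\<close>

lemma refl_inner:
  assumes "1 \<le> i" "i \<le> k" "i < l" "l < r + 1 - i"
  shows "refl i (T l x) = T l (refl i x)"
proof -
  have "up (i + 1) (r + 1 - i) (T l x) = T (l + 1) (up (i + 1) (r + 1 - i) x)"
    using assms k_bounds by (intro up_T) auto
  moreover have "down i (r + 1 - i) (T (l + 1) z) = T l (down i (r + 1 - i) z)" for z
    using assms k_bounds by (intro down_T) auto
  ultimately show ?thesis by (simp add: refl_def)
qed

lemma refl_outer:
  assumes "1 \<le> i" "i \<le> k" "1 \<le> l" "l \<le> r" "l + 2 \<le> i \<or> r + 1 - i + 2 \<le> l"
  shows "refl i (T l x) = T l (refl i x)"
proof -
  have "T l (foldr T w z) = foldr T w (T l z)" if "set w \<subseteq> {i..r + 1 - i}" for w z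
    using that assms k_bounds by (intro far_word) auto
  then show ?thesis by (simp add: refl_def)
qed

sublocale fold: jucys_murphy pair 1 k refl
proof
  note kb = k_bounds
  show "pair i (pair j x) = pair j (pair i x)" if "1 \<le> i" "i + 2 \<le> j" "j \<le> k - 1" for i j x
  proof -
    have "T i (T j z) = T j (T i z)" "T (r + 1 - i) (T (r + 1 - j) z) = T (r + 1 - j) (T (r + 1 - i) z)"
      "T i (T (r + 1 - j) z) = T (r + 1 - j) (T i z)" "T (r + 1 - i) (T j z) = T j (T (r + 1 - i) z)" for z
      using far[of i j z] far[of "r + 1 - j" "r + 1 - i" z] cross[of i j z] cross[of j i z] that kb by simp_all
    then show ?thesis by (simp add: pair_def)
  qed
  show "pair i (pair (i + 1) (pair i x)) = pair (i + 1) (pair i (pair (i + 1) x))"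
    if "1 \<le> i" "i + 1 \<le> k - 1" for i x
  proof -
    let ?a = "T i" and ?b = "T (i + 1)" and ?a' = "T (r + 1 - i)" and ?b' = "T (r - i)"
    have b: "?a (?b (?a z)) = ?b (?a (?b z))" for z using braid[of i z] that kb by simp
    have e: "r - i + 1 = r + 1 - i" by simp
    have b': "?a' (?b' (?a' z)) = ?b' (?a' (?b' z))" for z
      using braid[of "r - i" z, unfolded e, symmetric] that kb by simp
    have c: "?a' (?a z) = ?a (?a' z)" "?a' (?b z) = ?b (?a' z)" "?b' (?a z) = ?a (?b' z)"
      "?b' (?b z) = ?b (?b' z)" for z
      using cross[of i i z] cross[of "i + 1" i z] cross[of i "i + 1" z] cross[of "i + 1" "i + 1" z] that
      by (simp_all add: algebra_simps)
    have p: "pair (i + 1) z = ?b (?b' z)" "pair i z = ?a (?a' z)" for z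
      by (simp_all add: pair_def)
    have "pair i (pair (i + 1) (pair i x)) = ?a (?b (?a (?a' (?b' (?a' x)))))"
      unfolding p c ..
    also have "\<dots> = ?b (?a (?b (?b' (?a' (?b' x)))))" unfolding b b' ..
    also have "\<dots> = pair (i + 1) (pair i (pair (i + 1) x))" unfolding p c ..
    finally show ?thesis .
  qed
  show "refl i (pair j x) = pair j (refl i x)"
    if "1 \<le> i" "i \<le> k" "1 \<le> j" "j \<le> k - 1" "j \<noteq> i" "j \<noteq> i - 1" for i j x
  proof (cases "i < j")
    case True
    then show ?thesis using that kb refl_inner[of i j] refl_inner[of i "r + 1 - j"]
      by (simp add: pair_def)
  next
    case False
    then show ?thesis using that kb refl_outer[of i j] refl_outer[of i "r + 1 - j"]
      by (simp add: pair_def)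
  qed
  show "refl i (refl j x) = refl j (refl i x)" if "1 \<le> i" "i < j" "j \<le> k" for i j x
  proof -
    have "refl i (foldr T w z) = foldr T w (refl i z)" if "set w \<subseteq> {j..r + 1 - j}" for w z
      using that \<open>1 \<le> i\<close> \<open>i < j\<close> \<open>j \<le> k\<close> kb by (intro foldr_commute refl_inner) auto
    then show ?thesis unfolding refl_def[of j] by simp
  qed
  show "pair i (refl (i + 1) (pair i x)) = refl i x" if "1 \<le> i" "i \<le> k - 1" for i x
  proof -
    define b where "b = r + 1 - i"
    have b: "i + 2 \<le> b" "b \<le> r" using that kb by (simp_all add: b_def)
    have ib: "T i (T b z) = T b (T i z)" for z using far[of i b z] that b by simp
    \<comment> \<open>\<open>down_up\<close> puts the reflection into the form that takes up
      \<open>T i\<close> on both sides; applied once more it gives the form that takes up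
      \<open>T b\<close>.\<close>
    have r1: "refl (i + 1) z = up (i + 1) (b - 1) (down (i + 1) (b - 2) z)" for z
      using down_up[of "i + 1" "b - 1" z] that b by (simp add: refl_def b_def add.commute)
    have "pair i (refl (i + 1) (pair i x))
        = T b (T i (up (i + 1) (b - 1) (down (i + 1) (b - 2) (T i (T b x)))))"
      unfolding r1 pair_def b_def[symmetric] ib ..
    also have "\<dots> = T b (up i (b - 1) (down i (b - 2) (T b x)))"
      using up_first[of i "b - 1"] down_last[of i "b - 2"] b by simp
    also have "up i (b - 1) (down i (b - 2) (T b x)) = down i (b - 1) (up (i + 1) (b - 1) (T b x))"
      using down_up[of i "b - 1" "T b x"] that b by simp
    also have "T b (down i (b - 1) (up (i + 1) (b - 1) (T b x))) = refl i x"
      using down_first[of i b] up_last[of "i + 1" b] b by (simp add: refl_def b_def)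
    finally show ?thesis .
  qed
qed

text \<open>Peeling both ends off a symmetric interval leaves one reflection and the next inner
  interval, so the half twist is a product of nested reflections.\<close>

lemma half_twist_refl:
  assumes "1 \<le> a" "a \<le> k + 1"
  shows "half_twist a (r + 1 - a) x = fold.ys a k x"
  using assms
proof (induction "nat (k + 1 - a)" arbitrary: a x)
  case 0
  then show ?case using k_bounds by simp
next
  case (Suc l)
  then have a: "a \<le> k" by simp
  define b where "b = r + 1 - a"
  have ab: "a \<le> b" "b \<le> r" using a k_bounds Suc.prems by (simp_all add: b_def)
  have "half_twist (a + 1) b z = up (a + 1) b (half_twist (a + 1) (b - 1) z)" for z
    using half_twist_rec1[of "a + 1" b z] by (cases "a + 1 \<le> b") simp_all
  then have "half_twist a b x = refl a (half_twist (a + 1) (b - 1) x)"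
    using half_twist_rec4[of a b x] ab Suc.prems by (simp add: refl_def b_def)
  moreover have "half_twist (a + 1) (r + 1 - (a + 1)) x = fold.ys (a + 1) k x"
    using Suc.hyps(1)[of "a + 1"] Suc.hyps(2) Suc.prems a by simp
  moreover have "r + 1 - (a + 1) = b - 1" by (simp add: b_def)
  ultimately show ?case using a by (simp add: b_def upto_rec1)
qed

text \<open>Letters from the two halves of the diagram commute by \<open>cross\<close>, so a folded
  word separates into a word and its mirror image.\<close>

lemma pair_word:
  assumes "set w \<subseteq> {1..k - 1}"
  shows "foldr pair w x = foldr T (w @ map (\<lambda>i. r + 1 - i) w) x"
proof -
  have "foldr (\<lambda>s y. T s (T (r + 1 - s) y)) w x = foldr T w (foldr (\<lambda>s. T (r + 1 - s)) w x)"
    using assms by (intro foldr_merge cross) auto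
  moreover have "foldr (\<lambda>s. T (r + 1 - s)) w x = foldr T (map (\<lambda>i. r + 1 - i) w) x"
    by (simp add: foldr_map o_def)
  moreover have "pair = (\<lambda>s y. T s (T (r + 1 - s) y))" by (intro ext) (simp add: pair_def)
  ultimately show ?thesis by simp
qed

lemma folded_B2_relation:
  assumes "0 \<le> m" "4 * m - 1 \<le> r" "set j \<subseteq> {1..m - 1}" "set u \<subseteq> {2 * m + 1..r - 2 * m}"
    and comm: "\<And>x. foldr T (map (\<lambda>i. r + 1 - i) u) (foldr T u x)
      = foldr T u (foldr T (map (\<lambda>i. r + 1 - i) u) x)"
    and X: "X = delta 1 (2 * m - 1) @ map (\<lambda>i. r + 1 - i) (delta 1 (2 * m - 1)) @ u"
    and Y: "Y = delta (m + 1) (r - m) @ j @ map (\<lambda>i. r + 1 - i) j"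
  shows "foldr T (X @ Y @ X @ Y) x = foldr T (Y @ X @ Y @ X) x"
proof -
  note kb = k_bounds
  \<comment> \<open>From \<open>4 * m - 1 \<le> r \<le> 2 * k\<close>; this makes the folded chain
    long enough for the main identity.\<close>
  have mk: "2 * m \<le> k" using kb assms(2) by linarith
  let ?\<rho> = "\<lambda>i. r + 1 - i"
  let ?j' = "map (\<lambda>i. 2 * m - i) j"
  define D where "D = fold.half_twist 1 (2 * m - 1)"
  define Y0 where "Y0 = fold.ys (m + 1) k"
  define \<kappa> where "\<kappa> = foldr T u"
  define \<kappa>' where "\<kappa>' = foldr T (map ?\<rho> u)"
  define \<iota> where "\<iota> = foldr pair j"
  define \<iota>' where "\<iota>' = foldr pair ?j'"
  have sd: "set (delta 1 (2 * m - 1)) \<subseteq> {1..2 * m - 1}" by (rule set_delta)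
  have sj': "set ?j' \<subseteq> {m + 1..2 * m - 1}" using assms(3) by auto
  have sj: "set j \<subseteq> {1..2 * m - 1}" using assms(3) by force
  have su: "set (map ?\<rho> u) \<subseteq> {2 * m + 1..r - 2 * m}" using assms(4) by auto
  have X_op: "foldr T X z = D (\<kappa> z)" for z
    using pair_word[of "delta 1 (2 * m - 1)" "foldr T u z"] sd mk
    unfolding X D_def \<kappa>_def by fastforce
  have Y0: "Y0 z = half_twist (m + 1) (r - m) z" for z
    using half_twist_refl[of "m + 1" z] assms mk unfolding Y0_def by simp
  have Y_op: "foldr T Y z = Y0 (\<iota> z)" for z
    using pair_word[of j z] assms(3) mk unfolding Y Y0 \<iota>_def by fastforce
  have far_pair: "foldr T v (foldr pair w z) = foldr pair w (foldr T v z)"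
    if v: "set v \<subseteq> {2 * m + 1..r - 2 * m}" and w: "set w \<subseteq> {1..2 * m - 1}" for v w z
  proof (rule foldr_commute)
    fix s z assume s: "s \<in> set w"
    have "foldr T v (T l z) = T l (foldr T v z)" if "l = s \<or> l = ?\<rho> s" for l z
    proof (rule far_word[symmetric])
      show "1 \<le> l" "l \<le> r" using that s w assms(2) by auto
      fix t assume "t \<in> set v"
      then have t: "2 * m + 1 \<le> t" "t \<le> r - 2 * m" using v by auto
      moreover have "1 \<le> s" "s \<le> 2 * m - 1" using s w by auto
      ultimately show "1 \<le> t \<and> t \<le> r \<and> (t + 2 \<le> l \<or> l + 2 \<le> t)" using that assms(1) by auto
    qed
    then show "foldr T v (pair s z) = pair s (foldr T v z)" by (simp add: pair_def)
  qed
  \<comment> \<open>The flip of \<open>[m + 1, r - m]\<close> is \<open>i\<close> to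
    \<open>(m + 1) + (r - m) - i\<close>, which is the reflection of the whole diagram.\<close>
  have \<kappa>Y: "foldr T v (Y0 z) = Y0 (foldr T (map ?\<rho> v) z)" if v: "set v \<subseteq> {2 * m + 1..r - 2 * m}" for v z
  proof -
    have "half_twist (m + 1) (r - m) (foldr T (map ?\<rho> v) z)
        = foldr T (map (\<lambda>j. m + 1 + (r - m) - j) (map ?\<rho> v)) (half_twist (m + 1) (r - m) z)"
      using v assms(1) by (intro half_twist_word) auto
    moreover have "map (\<lambda>j. m + 1 + (r - m) - j) (map ?\<rho> v) = v" by (simp add: o_def)
    ultimately show ?thesis unfolding Y0 by simp
  qed
  \<comment> \<open>In the fold, \<open>D\<close> flips \<open>[1, 2m - 1]\<close>, so
    \<open>J\<close> goes to a subset of \<open>[m + 1, 2m - 1]\<close>, inside the interval of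
    \<open>Y0\<close>.\<close>
  have \<iota>D: "foldr pair w (D z) = D (foldr pair (map (\<lambda>i. 2 * m - i) w) z)"
    if w: "set w \<subseteq> {1..2 * m - 1}" for w z
  proof -
    have "fold.half_twist 1 (2 * m - 1) (foldr pair (map (\<lambda>i. 2 * m - i) w) z)
       = foldr pair (map (\<lambda>j. 1 + (2 * m - 1) - j) (map (\<lambda>i. 2 * m - i) w)) (fold.half_twist 1 (2 * m - 1) z)"
      using w mk by (intro fold.half_twist_word) auto
    moreover have "map (\<lambda>j. 1 + (2 * m - 1) - j) (map (\<lambda>i. 2 * m - i) w) = w" by (simp add: o_def)
    ultimately show ?thesis unfolding D_def by simp
  qed
  have "D (\<kappa> (Y0 (\<iota> (D (\<kappa> (Y0 (\<iota> x))))))) = Y0 (\<iota> (D (\<kappa> (Y0 (\<iota> (D (\<kappa> x)))))))"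
  proof (rule B2_relation_with_parabolics[of D Y0 \<kappa> \<kappa>' \<iota> \<iota>'])
    show "D (Y0 (D (Y0 z))) = Y0 (D (Y0 (D z)))" for z
      unfolding D_def Y0_def using assms(1) mk by (intro fold.half_twist_ys_B2) simp_all
    show "\<kappa> (D z) = D (\<kappa> z)" "\<kappa>' (D z) = D (\<kappa>' z)" for z
      unfolding \<kappa>_def \<kappa>'_def D_def using sd su assms(4) by (auto intro!: far_pair)
    show "\<kappa> (Y0 z) = Y0 (\<kappa>' z)" for z unfolding \<kappa>_def \<kappa>'_def by (rule \<kappa>Y[OF assms(4)])
    show "\<kappa>' (Y0 z) = Y0 (\<kappa> z)" for z
      using \<kappa>Y[OF su, of z] unfolding \<kappa>_def \<kappa>'_def by (simp add: o_def)
    show "\<iota> (D z) = D (\<iota>' z)" for z unfolding \<iota>_def \<iota>'_def by (rule \<iota>D[OF sj])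
    show "\<iota>' (D z) = D (\<iota> z)" for z
      using \<iota>D[of ?j' z] sj' assms(1) unfolding \<iota>_def \<iota>'_def by (force simp: o_def)
    show "\<iota> (Y0 z) = Y0 (\<iota> z)" for z
      unfolding \<iota>_def Y0_def using assms mk by (intro fold.word_ys) force+
    show "\<iota>' (Y0 z) = Y0 (\<iota>' z)" for z
      unfolding \<iota>'_def Y0_def using assms mk sj' by (intro fold.word_ys) force+
    show "\<kappa> (\<iota> z) = \<iota> (\<kappa> z)" "\<kappa>' (\<iota> z) = \<iota> (\<kappa>' z)" for z
      unfolding \<kappa>_def \<kappa>'_def \<iota>_def using far_pair[OF assms(4) sj] far_pair[OF su sj] by simp_all
    have sj'': "set ?j' \<subseteq> {1..2 * m - 1}" using sj' assms(1) by force
    show "\<kappa> (\<iota>' z) = \<iota>' (\<kappa> z)" "\<kappa>' (\<iota>' z) = \<iota>' (\<kappa>' z)" for z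
      unfolding \<kappa>_def \<kappa>'_def \<iota>'_def using far_pair[OF assms(4) sj''] far_pair[OF su sj''] by simp_all
    show "\<kappa>' (\<kappa> z) = \<kappa> (\<kappa>' z)" for z unfolding \<kappa>_def \<kappa>'_def by (rule comm)
    show "\<iota>' (\<iota> z) = \<iota> (\<iota>' z)" for z
      unfolding \<iota>_def \<iota>'_def
    proof (rule fold.far_words)
      fix s t assume "s \<in> set ?j'" "t \<in> set j"
      then have "m + 1 \<le> s" "s \<le> 2 * m - 1" "1 \<le> t" "t \<le> m - 1" using sj' assms(3) by auto
      then show "1 \<le> s \<and> s \<le> k - 1 \<and> 1 \<le> t \<and> t \<le> k - 1 \<and> (s + 2 \<le> t \<or> t + 2 \<le> s)" using mk by auto
    qed
  qed
  then show ?thesis by (simp add: X_op Y_op)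
qed

end

interpretation type_A: folded_chain "coxeter_system.gen_op (type_A r)" r for r
  by (rule folded_chain.intro) (rule type_A.braid_chain_axioms)

lemma type_A_reflection: "type_A.diagram_involution r (\<lambda>i. r + 1 - i)"
  by (auto simp: type_A.diagram_involution_def nodes_A bond_A abs_minus_commute)

lemma type_A_bond2: "i + 2 \<le> j \<or> j + 2 \<le> i \<Longrightarrow> bond (type_A r) i j = 2"
  by (auto simp: bond_A)

lemma defines_B2_hom_type_A:
  assumes m: "0 \<le> m" and J: "J \<subseteq> {1..m - 1}" and r: "4 * m - 1 \<le> r"
    and K: "K \<subseteq> {2 * m + 1..r - 2 * m}"
    and wo: "weakly_orthogonal (type_A r) K ((\<lambda>k. r + 1 - k) ` K)"
  shows "defines_B2_hom (artin_monoid (type_A r))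
    (artin_lift (type_A r) (longest_element (type_A r) ({1..2 * m - 1} \<union> {r + 2 - 2 * m..r} \<union> K)))
    (artin_lift (type_A r) (longest_element (type_A r) ({m + 1..r - m} \<union> J \<union> (\<lambda>j. r + 1 - j) ` J)))"
proof -
  let ?\<rho> = "\<lambda>i. r + 1 - i"
  let ?d = "delta 1 (2 * m - 1)"
  let ?long = "type_A.longest_word r"
  \<comment> \<open>The explicit word for the whole diagram supplies the length bound behind the
    existence of longest words for \<open>K\<close> and \<open>J\<close>.\<close>
  have top: "?long {1..r} (delta 1 r)" by (rule type_A.delta_longest) simp_all
  have sub: "K \<subseteq> {1..r}" "J \<subseteq> {1..r}" "{1..2 * m - 1} \<subseteq> {1..r}" using K J m r by force+
  obtain u where u: "?long K u" using type_A.longest_word_exists[OF top _ sub(1)] by (auto simp: nodes_A)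
  obtain j where j: "?long J j" using type_A.longest_word_exists[OF top _ sub(2)] by (auto simp: nodes_A)
  have d: "?long {1..2 * m - 1} ?d" using m r by (intro type_A.delta_longest) auto
  have im: "?\<rho> ` {1..2 * m - 1} = {r + 2 - 2 * m..r}"
  proof (intro equalityI subsetI)
    fix x assume "x \<in> {r + 2 - 2 * m..r}"
    then show "x \<in> ?\<rho> ` {1..2 * m - 1}" by (intro image_eqI[of _ _ "r + 1 - x"]) auto
  qed auto
  have d': "?long {r + 2 - 2 * m..r} (map ?\<rho> ?d)"
    using type_A.longest_word_map[OF type_A_reflection d, unfolded im] sub(3) by (simp only: nodes_A)
  have j': "?long (?\<rho> ` J) (map ?\<rho> j)"
    using type_A.longest_word_map[OF type_A_reflection j] sub(2) by (simp add: nodes_A)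
  have su: "set u \<subseteq> {2 * m + 1..r - 2 * m}" and sj: "set j \<subseteq> {1..m - 1}"
    using u j K J by (auto simp: type_A.longest_word_def)
  have "?long ({r + 2 - 2 * m..r} \<union> K) (map ?\<rho> ?d @ u)"
  proof (rule type_A.longest_word_union[OF d' u])
    show "bond (type_A r) i l = 2" if "i \<in> {r + 2 - 2 * m..r}" "l \<in> K" for i l
      using that K by (intro type_A_bond2) auto
  qed (use sub K m r in \<open>auto simp: nodes_A\<close>)
  then have X: "?long ({1..2 * m - 1} \<union> ({r + 2 - 2 * m..r} \<union> K)) (?d @ map ?\<rho> ?d @ u)"
  proof (rule type_A.longest_word_union[OF d])
    show "bond (type_A r) i l = 2" if "i \<in> {1..2 * m - 1}" "l \<in> {r + 2 - 2 * m..r} \<union> K" for i l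
      using that K r by (intro type_A_bond2) auto
  qed (use sub K m r in \<open>auto simp: nodes_A\<close>)
  have far_J: "i + 2 \<le> l" if il: "i \<in> J" "l \<in> ?\<rho> ` J" for i l
  proof -
    obtain l' where "l' \<in> J" "l = r + 1 - l'" using il(2) by blast
    moreover have "i \<le> m - 1" "l' \<le> m - 1" using il(1) calculation(1) J by auto
    ultimately show ?thesis using m r by linarith
  qed
  have "?long (J \<union> ?\<rho> ` J) (j @ map ?\<rho> j)"
  proof (rule type_A.longest_word_union[OF j j'])
    show "bond (type_A r) i l = 2" if "i \<in> J" "l \<in> ?\<rho> ` J" for i l
      using far_J[OF that] by (intro type_A_bond2) simp
    show "J \<inter> ?\<rho> ` J = {}" using far_J by fastforce
  qed (use J sub in \<open>auto simp: nodes_A\<close>)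
  then have Y: "?long ({m + 1..r - m} \<union> (J \<union> ?\<rho> ` J)) (delta (m + 1) (r - m) @ j @ map ?\<rho> j)"
  proof (rule type_A.longest_word_union[rotated])
    show "?long {m + 1..r - m} (delta (m + 1) (r - m))" using m by (intro type_A.delta_longest) auto
    show "bond (type_A r) i l = 2" if "i \<in> {m + 1..r - m}" "l \<in> J \<union> ?\<rho> ` J" for i l
      using that J by (intro type_A_bond2) force
    show "{m + 1..r - m} \<inter> (J \<union> ?\<rho> ` J) = {}" using J by force
  qed (use J sub m in \<open>auto simp: nodes_A\<close>)
  have nX: "{1..2 * m - 1} \<union> ({r + 2 - 2 * m..r} \<union> K) \<subseteq> nodes (type_A r)"
    and nY: "{m + 1..r - m} \<union> (J \<union> ?\<rho> ` J) \<subseteq> nodes (type_A r)"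
    using sub m r J by (auto simp: nodes_A)
  have Kn: "K \<subseteq> nodes (type_A r)" using sub(1) by (simp add: nodes_A)
  note rel = type_A.folded_B2_relation[OF m r sj su
      type_A.weakly_orthogonal_commute[OF type_A_reflection Kn wo u] HOL.refl HOL.refl]
  show ?thesis
    unfolding Un_assoc by (rule type_A.defines_B2_hom_longest[OF X Y nX nY rel])
qed

section \<open>Types B and D\<close>

text \<open>The points are \<open>\<plusminus>1, \<dots>\<close>, and \<open>zw\<close> is the word of the last generator of the chain of type \<open>B\<close>:
  \<open>[n]\<close> in type \<open>B\<^bsub>n\<^esub>\<close> and \<open>[n, n + 1]\<close> in type \<open>D\<^bsub>n+1\<^esub>\<close>.\<close>

locale signed_action = interval_action M f h 1 "n - 1"
  for M :: "int coxeter_matrix" and f :: "int \<Rightarrow> int \<Rightarrow> int" and h :: "int \<Rightarrow> int" and n :: int +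
  fixes zw :: "int list"
  assumes n_ge2: "2 \<le> n"
    and nodes_eq: "nodes M = {1..n - 1} \<union> set zw"
    and zw_ge: "s \<in> set zw \<Longrightarrow> n \<le> s"
    and f_neg: "1 \<le> i \<Longrightarrow> i \<le> n - 1 \<Longrightarrow> f i (- i) = - (i + 1)"
    and f_fix_neg: "1 \<le> i \<Longrightarrow> i \<le> n - 1 \<Longrightarrow> j \<in> nodes M \<Longrightarrow> i < j \<Longrightarrow> f j (- i) = - i"
    and f_zw: "foldr f zw (- n) = n"
    and h_neg: "1 \<le> i \<Longrightarrow> i \<le> n \<Longrightarrow> h (- i) = h i + 2 * (n - i) + int (length zw)"
    and zw_bond: "s \<in> set zw \<Longrightarrow> 1 \<le> j \<Longrightarrow> j \<le> n - 2 \<Longrightarrow> bond M s j = 2"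
    and zw_braid: "foldr gen_op zw (gen_op (n - 1) (foldr gen_op zw (gen_op (n - 1) X)))
      = gen_op (n - 1) (foldr gen_op zw (gen_op (n - 1) (foldr gen_op zw X)))"
    and zw_starts: "s \<in> set zw \<Longrightarrow> \<exists>w. \<forall>X. foldr gen_op zw X = gen_op s (foldr gen_op w X)"
begin

sublocale type_B_chain gen_op 1 n "foldr gen_op zw"
proof
  show "foldr gen_op zw (gen_op j X) = gen_op j (foldr gen_op zw X)" if "1 \<le> j" "j \<le> n - 2" for j X
    using gen_op_orthogonal[of zw "[j]" X] zw_bond[of _ j] nodes_eq that by auto
qed (rule zw_braid)

definition y_word :: "int \<Rightarrow> int list" where
  "y_word i = [i..n - 1] @ zw @ rev [i..n - 1]"

definition ys_word :: "int \<Rightarrow> int \<Rightarrow> int list" where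
  "ys_word a b = concat (map y_word [a..b])"

lemma foldr_y_word: "foldr gen_op (y_word i) X = y i X"
  by (simp add: y_word_def y_def)

lemma foldr_ys_word: "foldr gen_op (ys_word a b) X = ys a b X"
proof -
  have "foldr gen_op (concat (map y_word w)) X = foldr y w X" for w
    by (induction w) (simp_all add: foldr_y_word)
  then show ?thesis by (simp add: ys_word_def)
qed

lemma set_y_word: "1 \<le> i \<Longrightarrow> i \<le> n \<Longrightarrow> set (y_word i) \<subseteq> {j \<in> nodes M. i \<le> j}"
  using zw_ge by (fastforce simp: y_word_def nodes_eq)

lemma set_ys_word: "1 \<le> a \<Longrightarrow> b \<le> n \<Longrightarrow> set (ys_word a b) \<subseteq> {j \<in> nodes M. a \<le> j}"
proof
  fix x assume ab: "1 \<le> a" "b \<le> n" and "x \<in> set (ys_word a b)"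
  then obtain i where "a \<le> i" "i \<le> b" "x \<in> set (y_word i)" by (auto simp: ys_word_def)
  then show "x \<in> {j \<in> nodes M. a \<le> j}" using set_y_word[of i] ab by auto
qed

lemma f_rev_path: "1 \<le> i \<Longrightarrow> i \<le> n \<Longrightarrow> foldr f (rev [i..n - 1]) (- i) = - n"
proof (induction "nat (n - i)" arbitrary: i)
  case (Suc k)
  then have "i \<le> n - 1" by simp
  then have "rev [i..n - 1] = rev [i + 1..n - 1] @ [i]" by (simp add: upto_rec1)
  moreover have "f i (- i) = - (i + 1)" using f_neg[of i] Suc \<open>i \<le> n - 1\<close> by simp
  moreover have "foldr f (rev [i + 1..n - 1]) (- (i + 1)) = - n"
    using Suc.hyps(1)[of "i + 1"] Suc.hyps(2) Suc.prems \<open>i \<le> n - 1\<close> by simp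
  ultimately show ?case by simp
qed simp

lemma f_y_word: "1 \<le> i \<Longrightarrow> i \<le> n \<Longrightarrow> foldr f (y_word i) (- i) = i"
  using f_rev_path[of i] f_zw f_path[of i "n - 1"] by (simp add: y_word_def)

text \<open>\<open>y_word a\<close> carries \<open>- a\<close> to \<open>a\<close>, and
  \<open>h_neg\<close> makes this drop in height equal to its length, while all later letters fix
  \<open>- a\<close>.\<close>

lemma ys_word_reduced: "1 \<le> a \<Longrightarrow> reduced (ys_word a n)"
proof (induction "nat (n + 1 - a)" arbitrary: a)
  case 0
  then show ?case by (simp add: ys_word_def reduced_Nil)
next
  case (Suc k)
  then have a: "1 \<le> a" "a \<le> n" by simp_all
  have "reduced (y_word a @ ys_word (a + 1) n)"
  proof (rule reduced_path)
    show "reduced (ys_word (a + 1) n)" using Suc by simp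
    show "set (y_word a) \<subseteq> nodes M" using set_y_word[OF a] by blast
    show "f i (- a) = - a" if i: "i \<in> set (ys_word (a + 1) n)" for i
    proof (cases "a = n")
      case True
      then show ?thesis using i by (simp add: ys_word_def)
    next
      case False
      then show ?thesis using f_fix_neg[of a i] set_ys_word[of "a + 1" n] i a by auto
    qed
    show "h (foldr f (y_word a) (- a)) = h (- a) - int (length (y_word a))"
      using f_y_word[OF a] h_neg[OF a] a by (simp add: y_word_def)
  qed
  then show ?case using a by (simp add: ys_word_def upto_rec1)
qed

text \<open>A chain letter \<open>s\<close> starts \<open>y s\<close>, and a letter of
  \<open>zw\<close> starts \<open>y n\<close>. The \<open>y i\<close> commute, so the one that
  starts with \<open>s\<close> can be moved to the front.\<close>

lemma ys_word_longest:
  assumes "1 \<le> a" "a \<le> n"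
  shows "longest_word {j \<in> nodes M. a \<le> j} (ys_word a n)"
proof (rule longest_wordI)
  fix s assume s: "s \<in> {j \<in> nodes M. a \<le> j}"
  have "\<exists>i w. a \<le> i \<and> i \<le> n \<and> (\<forall>X. y i X = gen_op s (foldr gen_op w X))"
  proof (cases "s \<in> set zw")
    case True
    then obtain w where "\<And>X. foldr gen_op zw X = gen_op s (foldr gen_op w X)" using zw_starts by blast
    then show ?thesis using assms by (intro exI[of _ n] exI[of _ w]) (simp add: y_last)
  next
    case False
    then have "s \<le> n - 1" using s nodes_eq by auto
    then have "y s X = gen_op s (foldr gen_op ([s + 1..n - 1] @ zw @ rev [s..n - 1]) X)" for X
      using up_first[of s "n - 1"] by (simp add: y_def)
    then show ?thesis using s \<open>s \<le> n - 1\<close>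
      by (intro exI[of _ s] exI[of _ "[s + 1..n - 1] @ zw @ rev [s..n - 1]"]) auto
  qed
  then obtain i w where i: "a \<le> i" "i \<le> n" and w: "\<And>X. y i X = gen_op s (foldr gen_op w X)" by blast
  have "ys a n X = y i (ys a (i - 1) (ys (i + 1) n X))" for X
  proof -
    have "ys a n X = ys a (i - 1) (ys i n X)" using ys_split[of a "i - 1" n X] i by simp
    also have "ys i n X = y i (ys (i + 1) n X)" using i by (simp add: upto_rec1)
    also have "ys a (i - 1) (y i (ys (i + 1) n X)) = y i (ys a (i - 1) (ys (i + 1) n X))"
      using y_ys[of i a "i - 1"] i assms by simp
    finally show ?thesis .
  qed
  then have "foldr gen_op (ys_word a n) X
      = gen_op s (foldr gen_op (w @ ys_word a (i - 1) @ ys_word (i + 1) n) X)" for X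
    by (simp add: foldr_ys_word w)
  then show "\<exists>w. \<forall>X. foldr gen_op (ys_word a n) X = gen_op s (foldr gen_op w X)" by blast
qed (use set_ys_word[OF assms(1)] ys_word_reduced[OF assms(1)] in auto)

text \<open>\<open>\<sigma>\<close> records what happens to \<open>K\<close> on passing
  \<open>Y\<close>. The image of \<open>K\<close> also has to pass \<open>D\<close> and the words
  for \<open>J\<close>, so \<open>bond_K\<close> speaks of both sets; \<open>comm\<close> is stated
  for all longest words because the one for \<open>K\<close> is obtained by existence only.\<close>

theorem signed_B2_hom:
  assumes m: "0 \<le> m" "2 * m \<le> n" and J: "J \<subseteq> {1..m - 1}" and K: "K \<subseteq> {j \<in> nodes M. 2 * m + 1 \<le> j}"
    and \<sigma>K: "\<sigma> ` K \<subseteq> nodes M"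
    and bond_K: "\<And>i k. 1 \<le> i \<Longrightarrow> i \<le> 2 * m - 1 \<Longrightarrow> k \<in> K \<Longrightarrow> bond M i k = 2 \<and> bond M i (\<sigma> k) = 2"
    and bond_J: "\<And>i j. i \<in> J \<Longrightarrow> j \<in> nodes M \<Longrightarrow> m + 1 \<le> j \<Longrightarrow> bond M i j = 2"
    and \<sigma>_ys: "\<And>s X. s \<in> K \<Longrightarrow> gen_op s (ys (m + 1) n X) = ys (m + 1) n (gen_op (\<sigma> s) X)"
      "\<And>s X. s \<in> K \<Longrightarrow> gen_op (\<sigma> s) (ys (m + 1) n X) = ys (m + 1) n (gen_op s X)"
    and comm: "\<And>u X. longest_word K u \<Longrightarrow>
      foldr gen_op (map \<sigma> u) (foldr gen_op u X) = foldr gen_op u (foldr gen_op (map \<sigma> u) X)"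
  shows "defines_B2_hom (artin_monoid M)
    (artin_lift M (longest_element M ({1..2 * m - 1} \<union> K)))
    (artin_lift M (longest_element M ({j \<in> nodes M. m + 1 \<le> j} \<union> J)))"
proof -
  have mn: "m + 1 \<le> n" "2 * m - 1 \<le> n - 1" using m n_ge2 by linarith+
  have sub: "{1..2 * m - 1} \<subseteq> nodes M" "K \<subseteq> nodes M" "J \<subseteq> nodes M"
    using K J mn nodes_eq by auto
  have "{j \<in> nodes M. 1 \<le> j} = nodes M" using nodes_eq zw_ge n_ge2 by fastforce
  then have top: "longest_word (nodes M) (ys_word 1 n)" using ys_word_longest[of 1] n_ge2 by simp
  obtain u where u: "longest_word K u" using longest_word_exists[OF top order_refl sub(2)] by blast
  obtain j where j: "longest_word J j" using longest_word_exists[OF top order_refl sub(3)] by blast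
  have su: "set u \<subseteq> K" and sj: "set j \<subseteq> J" using u j by (simp_all add: longest_word_def)
  let ?d = "delta 1 (2 * m - 1)"
  have sd: "set ?d \<subseteq> {1..2 * m - 1}" by (rule set_delta)
  have d: "longest_word {1..2 * m - 1} ?d" using mn by (intro delta_longest) simp_all
  have X: "longest_word ({1..2 * m - 1} \<union> K) (?d @ u)"
    using K bond_K sub by (intro longest_word_union[OF d u]) auto
  have Y: "longest_word ({j \<in> nodes M. m + 1 \<le> j} \<union> J) (ys_word (m + 1) n @ j)"
  proof (rule longest_word_union[OF ys_word_longest j])
    show "bond M i l = 2" if "i \<in> {j \<in> nodes M. m + 1 \<le> j}" "l \<in> J" for i l
      using bond_J[of l i] bond_sym[of i l] that sub by auto
    show "{j \<in> nodes M. m + 1 \<le> j} \<inter> J = {}" using J by auto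
  qed (use m mn sub in auto)
  define D where "D = half_twist 1 (2 * m - 1)"
  define Y0 where "Y0 = ys (m + 1) n"
  let ?j' = "map (\<lambda>i. 2 * m - i) j"
  let ?u' = "map \<sigma> u"
  have sj1: "set j \<subseteq> {1..2 * m - 1}" and sj': "set ?j' \<subseteq> {m + 1..2 * m - 1}" using sj J m by auto
  have sj'': "set ?j' \<subseteq> {1..2 * m - 1}" using sj' m by force
  have orth: "foldr gen_op v (foldr gen_op w Z) = foldr gen_op w (foldr gen_op v Z)"
    if v: "v = u \<or> v = ?u'" and w: "set w \<subseteq> {1..2 * m - 1}" for v w Z
  proof -
    have "\<sigma> ` set u \<subseteq> nodes M" using image_mono[OF su, of \<sigma>] \<sigma>K by (rule order_trans)
    then have "over v" "over w" using v w su sub by auto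
    moreover have "bond M i l = 2" if il: "i \<in> set w" "l \<in> set v" for i l
    proof -
      have "1 \<le> i" "i \<le> 2 * m - 1" using il(1) w by auto
      moreover have "l \<in> set u \<union> \<sigma> ` set u" using il(2) v by auto
      ultimately show ?thesis using bond_K[of i] su by blast
    qed
    ultimately show ?thesis by (intro gen_op_orthogonal[symmetric]) auto
  qed
  have \<iota>D: "foldr gen_op w (D Z) = D (foldr gen_op (map (\<lambda>i. 2 * m - i) w) Z)"
    if w: "set w \<subseteq> {1..2 * m - 1}" for w Z
  proof -
    have "half_twist 1 (2 * m - 1) (foldr gen_op (map (\<lambda>i. 2 * m - i) w) Z)
       = foldr gen_op (map (\<lambda>j. 1 + (2 * m - 1) - j) (map (\<lambda>i. 2 * m - i) w)) (half_twist 1 (2 * m - 1) Z)"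
      using w mn by (intro half_twist_word) auto
    moreover have "map (\<lambda>j. 1 + (2 * m - 1) - j) (map (\<lambda>i. 2 * m - i) w) = w" by (simp add: o_def)
    ultimately show ?thesis unfolding D_def by simp
  qed
  have \<kappa>Y: "foldr gen_op u (Y0 Z) = Y0 (foldr gen_op ?u' Z)"
    "foldr gen_op ?u' (Y0 Z) = Y0 (foldr gen_op u Z)" for Z
  proof -
    have "foldr gen_op v (Y0 Z) = Y0 (foldr gen_op (map \<sigma> v) Z)
        \<and> foldr gen_op (map \<sigma> v) (Y0 Z) = Y0 (foldr gen_op v Z)" if "set v \<subseteq> K" for v
      using that by (induction v) (auto simp: Y0_def \<sigma>_ys)
    then show "foldr gen_op u (Y0 Z) = Y0 (foldr gen_op ?u' Z)"
      "foldr gen_op ?u' (Y0 Z) = Y0 (foldr gen_op u Z)" using su by blast+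
  qed
  \<comment> \<open>\<open>J\<close> lies below \<open>m\<close> and its flip above
    \<open>m\<close>, so the letter \<open>m\<close>, which \<open>word_ys\<close> excludes, is
    never met.\<close>
  have \<iota>Y: "foldr gen_op w (Y0 Z) = Y0 (foldr gen_op w Z)" if "w = j \<or> w = ?j'" for w Z
    unfolding Y0_def
  proof (rule word_ys)
    fix l assume "l \<in> set w"
    then have "l \<in> {1..m - 1} \<union> {m + 1..2 * m - 1}" using that sj J sj' by blast
    then show "1 \<le> l \<and> l \<le> n - 1 \<and> l \<noteq> n \<and> l \<noteq> m + 1 - 1" using m mn by auto
  qed (use m in auto)
  have \<iota>\<iota>: "foldr gen_op ?j' (foldr gen_op j Z) = foldr gen_op j (foldr gen_op ?j' Z)" for Z
  proof (rule far_words)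
    fix s t assume "s \<in> set ?j'" "t \<in> set j"
    then have "m + 1 \<le> s" "s \<le> 2 * m - 1" "1 \<le> t" "t \<le> m - 1" using sj' sj J by auto
    then show "1 \<le> s \<and> s \<le> n - 1 \<and> 1 \<le> t \<and> t \<le> n - 1 \<and> (s + 2 \<le> t \<or> t + 2 \<le> s)" using mn by auto
  qed
  have jj: "map (\<lambda>i. 2 * m - i) ?j' = j" by (simp add: o_def)
  let ?\<kappa> = "foldr gen_op u" and ?\<kappa>' = "foldr gen_op ?u'"
  let ?\<iota> = "foldr gen_op j" and ?\<iota>' = "foldr gen_op ?j'"
  have rel: "D (?\<kappa> (Y0 (?\<iota> (D (?\<kappa> (Y0 (?\<iota> Z))))))) = Y0 (?\<iota> (D (?\<kappa> (Y0 (?\<iota> (D (?\<kappa> Z)))))))" for Z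
  proof (rule B2_relation_with_parabolics[of D Y0 ?\<kappa> ?\<kappa>' ?\<iota> ?\<iota>'])
    show "D (Y0 (D (Y0 Z))) = Y0 (D (Y0 (D Z)))" for Z
      unfolding D_def Y0_def using m by (intro half_twist_ys_B2) simp_all
    show "?\<kappa> (D Z) = D (?\<kappa> Z)" "?\<kappa>' (D Z) = D (?\<kappa>' Z)" for Z
      unfolding D_def using orth sd by blast+
    show "?\<iota> (D Z) = D (?\<iota>' Z)" for Z by (rule \<iota>D[OF sj1])
    show "?\<iota>' (D Z) = D (?\<iota> Z)" for Z using \<iota>D[OF sj'', of Z] unfolding jj .
    show "?\<kappa> (?\<iota> Z) = ?\<iota> (?\<kappa> Z)" "?\<kappa>' (?\<iota> Z) = ?\<iota> (?\<kappa>' Z)" for Z using orth sj1 by blast+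
    show "?\<kappa> (?\<iota>' Z) = ?\<iota>' (?\<kappa> Z)" "?\<kappa>' (?\<iota>' Z) = ?\<iota>' (?\<kappa>' Z)" for Z using orth sj'' by blast+
    show "?\<kappa>' (?\<kappa> Z) = ?\<kappa> (?\<kappa>' Z)" for Z by (rule comm[OF u])
    show "?\<kappa> (Y0 Z) = Y0 (?\<kappa>' Z)" "?\<kappa>' (Y0 Z) = Y0 (?\<kappa> Z)" for Z by (rule \<kappa>Y)+
    show "?\<iota> (Y0 Z) = Y0 (?\<iota> Z)" "?\<iota>' (Y0 Z) = Y0 (?\<iota>' Z)" for Z using \<iota>Y by blast+
    show "?\<iota>' (?\<iota> Z) = ?\<iota> (?\<iota>' Z)" for Z by (rule \<iota>\<iota>)
  qed
  have ops: "foldr gen_op (?d @ u) Z = D (?\<kappa> Z)" "foldr gen_op (ys_word (m + 1) n @ j) Z = Y0 (?\<iota> Z)" for Z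
    by (simp_all add: D_def Y0_def foldr_ys_word)
  show ?thesis
  proof (rule defines_B2_hom_longest[OF X Y])
    fix Z
    have app: "foldr gen_op (p @ q @ p @ q) Z = foldr gen_op p (foldr gen_op q (foldr gen_op p (foldr gen_op q Z)))"
      for p q by simp
    show "foldr gen_op ((?d @ u) @ (ys_word (m + 1) n @ j) @ (?d @ u) @ ys_word (m + 1) n @ j) Z
       = foldr gen_op ((ys_word (m + 1) n @ j) @ (?d @ u) @ (ys_word (m + 1) n @ j) @ ?d @ u) Z"
      unfolding app ops by (rule rel)
  qed (use sub in auto)
qed

end

subsection \<open>Type B\<close>

definition negate :: "int \<Rightarrow> int \<Rightarrow> int" where
  "negate n x = (if \<bar>x\<bar> = n then - x else x)"

definition action_B :: "int \<Rightarrow> int \<Rightarrow> int \<Rightarrow> int" where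
  "action_B n i = (if i = n then negate n else swap i)"

text \<open>The points \<open>1, ..., n, - n, ..., - 1\<close> receive the heights
  \<open>1, ..., 2 * n\<close> in this order, so negating \<open>n\<close> is a step of size
  one.\<close>

definition height_B :: "int \<Rightarrow> int \<Rightarrow> int" where
  "height_B n x = (if x > 0 then x else 2 * n + 1 + x)"

lemma nodes_B: "nodes (type_B n) = {1..n}"
  and bond_B: "bond (type_B n) i j = (if i = j then 1
                   else if {i, j} = {n - 1, n} then 4
                   else if \<bar>i - j\<bar> = 1 then 3 else 2)"
  by (simp_all add: type_B_def)

lemma negate_negate: "negate n (negate n x) = x"
  by (simp add: negate_def)

lemma negate_swap: "1 \<le> i \<Longrightarrow> i + 2 \<le> n \<Longrightarrow> negate n (swap i x) = swap i (negate n x)"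
  by (auto simp: negate_def swap_def)

lemma negate_swap_braid:
  assumes "2 \<le> n"
  shows "swap (n - 1) (negate n (swap (n - 1) (negate n x))) = negate n (swap (n - 1) (negate n (swap (n - 1) x)))"
proof -
  have "x \<in> {n - 1, n, - (n - 1), - n} \<or> (x \<noteq> n - 1 \<and> x \<noteq> n \<and> x \<noteq> - (n - 1) \<and> x \<noteq> - n)" by auto
  then show ?thesis using assms by (elim disjE insertE) (simp_all add: swap_def negate_def)
qed

lemma interval_action_B:
  assumes n: "2 \<le> n"
  shows "interval_action (type_B n) (action_B n) (height_B n) 1 (n - 1)"
proof
  show "bond (type_B n) i j = bond (type_B n) j i" for i j
    by (simp add: bond_B abs_minus_commute insert_commute)
  show "bond (type_B n) i j \<in> {2, 3, 4}" if "i \<noteq> j" for i j using that by (simp add: bond_B)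
  show "action_B n i (action_B n i y) = y" if "i \<in> nodes (type_B n)" for i y
    using that by (simp add: action_B_def negate_negate swap_swap nodes_B)
  have sym_braid: "foldr (action_B n) (alt_word i j (bond (type_B n) i j)) y
      = foldr (action_B n) (alt_word j i (bond (type_B n) i j)) y"
    if ij: "1 \<le> i" "i < j" "j \<le> n" for i j y
  proof -
    consider "j < n" "j = i + 1" | "j < n" "i + 2 \<le> j" | "j = n" "i = n - 1" | "j = n" "i + 2 \<le> n"
      using ij by linarith
    then show ?thesis
    proof cases
      case 1
      then have "bond (type_B n) i j = 3" by (simp add: bond_B doubleton_eq_iff)
      then show ?thesis using 1 ij swap_braid[of i y] by (simp add: alt_word_numerals action_B_def)
    next
      case 2
      then have "bond (type_B n) i j = 2" using ij by (simp add: bond_B doubleton_eq_iff)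
      then show ?thesis using 2 ij swap_far[of i j y] by (simp add: alt_word_numerals action_B_def)
    next
      case 3
      then have "bond (type_B n) i j = 4" by (simp add: bond_B)
      then show ?thesis using 3 negate_swap_braid[OF n, of y] by (simp add: alt_word_numerals action_B_def)
    next
      case 4
      then have "bond (type_B n) i j = 2" by (simp add: bond_B doubleton_eq_iff)
      then show ?thesis using 4 ij negate_swap[of i n y] by (simp add: alt_word_numerals action_B_def)
    qed
  qed
  show "foldr (action_B n) (alt_word i j (bond (type_B n) i j)) y
      = foldr (action_B n) (alt_word j i (bond (type_B n) i j)) y"
    if "i \<in> nodes (type_B n)" "j \<in> nodes (type_B n)" "i \<noteq> j" for i j y
  proof (cases "i < j")
    case True
    then show ?thesis using sym_braid that by (simp add: nodes_B)
  next
    case False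
    have "bond (type_B n) i j = bond (type_B n) j i"
      by (simp add: bond_B abs_minus_commute insert_commute)
    then show ?thesis using sym_braid[of j i y] that False by (simp add: nodes_B)
  qed
  show "\<exists>y. action_B n i y \<noteq> action_B n j y"
    if ij: "i \<in> nodes (type_B n)" "j \<in> nodes (type_B n)" "i \<noteq> j" for i j
  proof -
    have "action_B n i i > 0 \<and> action_B n i i = i + 1 \<or> i = n \<and> action_B n i i = - n"
      using ij by (auto simp: action_B_def nodes_B swap_def negate_def)
    moreover have "action_B n j i = i \<or> action_B n j i = i - 1"
      using ij by (auto simp: action_B_def nodes_B swap_def negate_def)
    ultimately have "action_B n i i \<noteq> action_B n j i" using ij by (auto simp: nodes_B)
    then show ?thesis by blast
  qed
  show "\<exists>y. action_B n i (action_B n j (action_B n i (action_B n j y))) \<noteq> y"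
    if "i \<in> nodes (type_B n)" "j \<in> nodes (type_B n)" "bond (type_B n) i j = 4" for i j
  proof -
    have "i = n - 1 \<and> j = n \<or> i = n \<and> j = n - 1"
      using that(3) by (auto simp: bond_B doubleton_eq_iff split: if_splits)
    then have "action_B n i (action_B n j (action_B n i (action_B n j n))) \<noteq> n"
      using n by (elim disjE conjE) (simp_all add: action_B_def swap_def negate_def)
    then show ?thesis by blast
  qed
  show "\<bar>height_B n (action_B n i y) - height_B n y\<bar> \<le> 1" if "i \<in> nodes (type_B n)" for i y
    using that n by (auto simp: height_B_def action_B_def swap_def negate_def nodes_B)
  show "bond (type_B n) i j = (if j = i + 1 then 3 else 2)" if "1 \<le> i" "i < j" "j \<le> n - 1" for i j
    using that by (auto simp: bond_B doubleton_eq_iff)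
qed (auto simp: nodes_B bond_B action_B_def swap_step swap_fix height_B_def)

lemma signed_action_B:
  assumes n: "2 \<le> n"
  shows "signed_action (type_B n) (action_B n) (height_B n) n [n]"
proof -
  interpret interval_action "type_B n" "action_B n" "height_B n" 1 "n - 1"
    by (rule interval_action_B[OF n])
  show ?thesis
  proof
    show "foldr gen_op [n] (gen_op (n - 1) (foldr gen_op [n] (gen_op (n - 1) X)))
      = gen_op (n - 1) (foldr gen_op [n] (gen_op (n - 1) (foldr gen_op [n] X)))" for X
      using gen_op_bond4[of n "n - 1" X] n by (simp add: nodes_B bond_B insert_commute)
    show "\<exists>w. \<forall>X. foldr gen_op [n] X = gen_op s (foldr gen_op w X)" if "s \<in> set [n]" for s
      using that by (intro exI[of _ "[]"]) simp
    show "bond (type_B n) s j = 2" if "s \<in> set [n]" "1 \<le> j" "j \<le> n - 2" for s j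
      using that by (auto simp: bond_B doubleton_eq_iff)
  qed (use n in \<open>auto simp: nodes_B action_B_def swap_step_neg swap_fix negate_def height_B_def\<close>)
qed

lemma defines_B2_hom_type_B:
  assumes m: "0 \<le> m" and J: "J \<subseteq> {1..m - 1}" and n: "2 \<le> n" "2 * m \<le> n"
    and K: "K \<subseteq> {2 * m + 1..n}"
  shows "defines_B2_hom (artin_monoid (type_B n))
    (artin_lift (type_B n) (longest_element (type_B n) ({1..2 * m - 1} \<union> K)))
    (artin_lift (type_B n) (longest_element (type_B n) ({m + 1..n} \<union> J)))"
proof -
  interpret signed_action "type_B n" "action_B n" "height_B n" n "[n]"
    by (rule signed_action_B[OF n(1)])
  have far2: "bond (type_B n) i j = 2" if "i + 2 \<le> j" for i j
    using that by (auto simp: bond_B doubleton_eq_iff)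
  have set_eq: "{j \<in> nodes (type_B n). m + 1 \<le> j} = {m + 1..n}" using m by (auto simp: nodes_B)
  have ys_K: "gen_op s (ys (m + 1) n X) = ys (m + 1) n (gen_op s X)" if "s \<in> K" for s X
  proof (cases "s = n")
    case True
    \<comment> \<open>\<open>T_ys\<close> covers only the chain letters up to \<open>n - 1\<close>;
      the last generator is itself \<open>y n\<close> and commutes by \<open>y_ys\<close>.\<close>
    have yn: "gen_op n Z = y n Z" for Z by (subst y_last) simp
    show ?thesis unfolding True yn using m n by (intro y_ys) auto
  next
    case False
    then show ?thesis using that K m by (intro T_ys) auto
  qed
  show ?thesis
    unfolding set_eq[symmetric]
  proof (rule signed_B2_hom[OF m n(2) J, of K "\<lambda>i. i"])
    show "bond (type_B n) i k = 2 \<and> bond (type_B n) i k = 2"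
      if "1 \<le> i" "i \<le> 2 * m - 1" "k \<in> K" for i k
      using far2[of i k] that K by auto
    show "bond (type_B n) i j = 2" if "i \<in> J" "j \<in> nodes (type_B n)" "m + 1 \<le> j" for i j
      using far2[of i j] that J by auto
    show "gen_op s (ys (m + 1) n X) = ys (m + 1) n (gen_op s X)" if "s \<in> K" for s X
      using ys_K[OF that] .
    then show "gen_op s (ys (m + 1) n X) = ys (m + 1) n (gen_op s X)" if "s \<in> K" for s X
      using that .
  qed (use K m in \<open>auto simp: nodes_B\<close>)
qed

subsection \<open>Type D\<close>

text \<open>\<open>swap n\<close> with the signs of the four moved images reversed: the reflection
  attached to the branch node \<open>n + 1\<close>.\<close>

definition twist :: "int \<Rightarrow> int \<Rightarrow> int" where
  "twist n x = (if x = n then - (n + 1) else if x = n + 1 then - n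
     else if x = - n then n + 1 else if x = - (n + 1) then n else x)"

definition action_D :: "int \<Rightarrow> int \<Rightarrow> int \<Rightarrow> int" where
  "action_D n i = (if i = n + 1 then twist n else swap i)"

text \<open>\<open>n + 1\<close> and \<open>- (n + 1)\<close> share the height \<open>n + 1\<close>.
  This tie reflects the branching: both tail generators can raise \<open>n\<close> by one step, to
  different points.\<close>

definition height_D :: "int \<Rightarrow> int \<Rightarrow> int" where
  "height_D n x = (if x > 0 then x else 2 * n + 2 + x)"

lemma nodes_D: "nodes (type_D (n + 1)) = {1..n + 1}"
  and bond_D: "bond (type_D (n + 1)) i j = (if i = j then 1
                   else if {i, j} = {n - 1, n + 1} then 3
                   else if \<bar>i - j\<bar> = 1 \<and> max i j \<le> n then 3 else 2)"
  by (simp_all add: type_D_def)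

lemma bond_D_sym: "bond (type_D (n + 1)) i j = bond (type_D (n + 1)) j i"
  by (simp add: bond_D abs_minus_commute insert_commute max.commute)

lemma bond_D_far: "i + 2 \<le> j \<Longrightarrow> \<not> (i = n - 1 \<and> j = n + 1) \<Longrightarrow> bond (type_D (n + 1)) i j = 2"
  by (auto simp: bond_D doubleton_eq_iff)

lemma twist_twist: "1 \<le> n \<Longrightarrow> twist n (twist n x) = x"
  by (simp add: twist_def)

lemma twist_swap_far: "1 \<le> i \<Longrightarrow> i + 2 \<le> n \<Longrightarrow> twist n (swap i x) = swap i (twist n x)"
  by (simp add: twist_def swap_def)

lemma twist_swap: "1 \<le> n \<Longrightarrow> twist n (swap n x) = swap n (twist n x)"
  by (simp add: twist_def swap_def)

lemma twist_swap_braid: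
  assumes "2 \<le> n"
  shows "swap (n - 1) (twist n (swap (n - 1) x)) = twist n (swap (n - 1) (twist n x))"
proof -
  have "x \<in> {n - 1, n, n + 1, - (n - 1), - n, - (n + 1)} \<or>
    (x \<noteq> n - 1 \<and> x \<noteq> n \<and> x \<noteq> n + 1 \<and> x \<noteq> - (n - 1) \<and> x \<noteq> - n \<and> x \<noteq> - (n + 1))" by auto
  then show ?thesis using assms by (elim disjE insertE) (simp_all add: swap_def twist_def)
qed

lemma interval_action_D:
  assumes n: "3 \<le> n"
  shows "interval_action (type_D (n + 1)) (action_D n) (height_D n) 1 (n - 1)"
proof
  show "bond (type_D (n + 1)) i j = bond (type_D (n + 1)) j i" for i j by (rule bond_D_sym)
  show "bond (type_D (n + 1)) i j \<in> {2, 3, 4}" if "i \<noteq> j" for i j using that by (simp add: bond_D)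
  show "action_D n i (action_D n i y) = y" if "i \<in> nodes (type_D (n + 1))" for i y
    using that n by (simp add: action_D_def twist_twist swap_swap nodes_D)
  have sym_braid: "foldr (action_D n) (alt_word i j (bond (type_D (n + 1)) i j)) y
      = foldr (action_D n) (alt_word j i (bond (type_D (n + 1)) i j)) y"
    if ij: "1 \<le> i" "i < j" "j \<le> n + 1" for i j y
  proof -
    consider "j \<le> n" "j = i + 1" | "j \<le> n" "i + 2 \<le> j" | "j = n + 1" "i = n - 1" | "j = n + 1" "i = n"
      | "j = n + 1" "i + 2 \<le> n"
      using ij by linarith
    then show ?thesis
    proof cases
      case 1
      then have "bond (type_D (n + 1)) i j = 3" by (simp add: bond_D doubleton_eq_iff)
      then show ?thesis using 1 ij swap_braid[of i y] by (simp add: alt_word_numerals action_D_def)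
    next
      case 2
      then have "bond (type_D (n + 1)) i j = 2" using ij by (intro bond_D_far) auto
      then show ?thesis using 2 ij swap_far[of i j y] by (simp add: alt_word_numerals action_D_def)
    next
      case 3
      then have "bond (type_D (n + 1)) i j = 3" by (simp add: bond_D)
      then show ?thesis using 3 n twist_swap_braid[of n y] by (simp add: alt_word_numerals action_D_def)
    next
      case 4
      then have "bond (type_D (n + 1)) i j = 2" by (simp add: bond_D doubleton_eq_iff)
      then show ?thesis using 4 n twist_swap[of n y] by (simp add: alt_word_numerals action_D_def)
    next
      case 5
      then have "bond (type_D (n + 1)) i j = 2" by (intro bond_D_far) auto
      then show ?thesis using 5 ij twist_swap_far[of i n y] by (simp add: alt_word_numerals action_D_def)
    qed
  qed
  show "foldr (action_D n) (alt_word i j (bond (type_D (n + 1)) i j)) y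
      = foldr (action_D n) (alt_word j i (bond (type_D (n + 1)) i j)) y"
    if "i \<in> nodes (type_D (n + 1))" "j \<in> nodes (type_D (n + 1))" "i \<noteq> j" for i j y
  proof (cases "i < j")
    case True
    then show ?thesis using sym_braid that by (simp add: nodes_D)
  next
    case False
    then show ?thesis using sym_braid[of j i y] bond_D_sym[of n i j] that by (simp add: nodes_D)
  qed
  show "\<exists>y. action_D n i y \<noteq> action_D n j y"
    if ij: "i \<in> nodes (type_D (n + 1))" "j \<in> nodes (type_D (n + 1))" "i \<noteq> j" for i j
  proof -
    have "(i < n + 1 \<or> j < n + 1) \<and> 1 \<le> i \<and> 1 \<le> j" using ij by (auto simp: nodes_D)
    then consider "i \<noteq> n + 1" "j \<noteq> n + 1" | "i = n + 1" "j \<noteq> n + 1" | "j = n + 1" "i \<noteq> n + 1" by blast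
    then show ?thesis
    proof cases
      case 1
      then show ?thesis using swap_neq[of i j] ij by (auto simp: action_D_def nodes_D)
    next
      case 2
      then have "action_D n i n < 0" "action_D n j n > 0"
        using ij n by (auto simp: action_D_def nodes_D twist_def swap_def)
      then show ?thesis by (intro exI[of _ n]) simp
    next
      case 3
      then have "action_D n j n < 0" "action_D n i n > 0"
        using ij n by (auto simp: action_D_def nodes_D twist_def swap_def)
      then show ?thesis by (intro exI[of _ n]) simp
    qed
  qed
  show "\<exists>y. action_D n i (action_D n j (action_D n i (action_D n j y))) \<noteq> y"
    if "bond (type_D (n + 1)) i j = 4" for i j
    using that by (simp add: bond_D split: if_splits)
  show "\<bar>height_D n (action_D n i y) - height_D n y\<bar> \<le> 1" if "i \<in> nodes (type_D (n + 1))" for i y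
    using that n by (auto simp: height_D_def action_D_def swap_def twist_def nodes_D)
  show "bond (type_D (n + 1)) i j = (if j = i + 1 then 3 else 2)" if "1 \<le> i" "i < j" "j \<le> n - 1" for i j
    using that by (auto simp: bond_D doubleton_eq_iff)
qed (auto simp: nodes_D bond_D action_D_def swap_step swap_fix height_D_def)

lemma signed_action_D:
  assumes n: "3 \<le> n"
  shows "signed_action (type_D (n + 1)) (action_D n) (height_D n) n [n, n + 1]"
proof -
  interpret interval_action "type_D (n + 1)" "action_D n" "height_D n" 1 "n - 1"
    by (rule interval_action_D[OF n])
  let ?a = "gen_op (n - 1)" and ?b = "gen_op n" and ?c = "gen_op (n + 1)"
  have ab: "?a (?b (?a X)) = ?b (?a (?b X))" and ac: "?a (?c (?a X)) = ?c (?a (?c X))"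
    and bc: "?b (?c X) = ?c (?b X)" for X
    using gen_op_bond3[of "n - 1" n X] gen_op_bond3[of "n - 1" "n + 1" X] gen_op_bond2[of n "n + 1" X] n
    by (simp_all add: nodes_D bond_D doubleton_eq_iff)
  show ?thesis
  proof
    \<comment> \<open>The nodes \<open>n - 1\<close>, \<open>n\<close>, \<open>n + 1\<close> form a
      diagram of type A3 that folds onto B2, which gives the relation of length four.\<close>
    show "foldr gen_op [n, n + 1] (?a (foldr gen_op [n, n + 1] (?a X)))
      = ?a (foldr gen_op [n, n + 1] (?a (foldr gen_op [n, n + 1] X)))" for X
    proof -
      have "?b (?c (?a (?b (?c (?a X))))) = ?c (?b (?a (?b (?c (?a X)))))" by (simp only: bc)
      also have "?b (?a (?b (?c (?a X)))) = ?a (?b (?a (?c (?a X))))" by (simp only: ab)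
      also have "?a (?c (?a X)) = ?c (?a (?c X))" by (rule ac)
      also have "?c (?a (?b (?c (?a (?c X))))) = ?c (?a (?c (?b (?a (?c X)))))" by (simp only: bc)
      also have "\<dots> = ?a (?c (?a (?b (?a (?c X)))))" by (simp only: ac)
      also have "?a (?b (?a (?c X))) = ?b (?a (?b (?c X)))" by (rule ab)
      also have "?a (?c (?b (?a (?b (?c X))))) = ?a (?b (?c (?a (?b (?c X)))))" by (simp only: bc)
      finally show ?thesis by simp
    qed
    show "\<exists>w. \<forall>X. foldr gen_op [n, n + 1] X = gen_op s (foldr gen_op w X)" if "s \<in> set [n, n + 1]" for s
    proof (cases "s = n")
      case True
      then show ?thesis by (intro exI[of _ "[n + 1]"]) simp
    next
      case False
      then show ?thesis using that bc by (intro exI[of _ "[n]"]) simp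
    qed
    show "bond (type_D (n + 1)) s j = 2" if "s \<in> set [n, n + 1]" "1 \<le> j" "j \<le> n - 2" for s j
      using that bond_D_far[of j s n] bond_D_sym[of n s j] by auto
  qed (use n in \<open>auto simp: nodes_D action_D_def swap_step swap_step_neg swap_fix twist_def height_D_def\<close>)
qed

lemma diagram_involution_D:
  assumes n: "3 \<le> n"
  shows "coxeter_system.diagram_involution (type_D (n + 1)) (transpose n (n + 1))"
proof -
  interpret signed_action "type_D (n + 1)" "action_D n" "height_D n" n "[n, n + 1]"
    by (rule signed_action_D[OF n])
  let ?\<tau> = "transpose n (n + 1)"
  have "bond (type_D (n + 1)) (?\<tau> i) (?\<tau> j) = bond (type_D (n + 1)) i j"
    if "i \<in> nodes (type_D (n + 1))" "j \<in> nodes (type_D (n + 1))" for i j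
    using that n by (auto simp: nodes_D bond_D transpose_def doubleton_eq_iff)
  moreover have "?\<tau> i \<in> nodes (type_D (n + 1))" if "i \<in> nodes (type_D (n + 1))" for i
    using that n by (auto simp: nodes_D transpose_def)
  ultimately show ?thesis by (simp add: diagram_involution_def)
qed

lemma defines_B2_hom_type_D:
  assumes m: "0 \<le> m" and J: "J \<subseteq> {1..m - 1}" and n: "3 \<le> n" "2 * m \<le> n"
    and K: "K \<subseteq> {2 * m + 1..n + 1}" and K': "n = 2 * m \<Longrightarrow> n + 1 \<notin> K"
    and wo: "even (n - m) \<Longrightarrow> weakly_orthogonal (type_D (n + 1)) K (transpose n (n + 1) ` K)"
  shows "defines_B2_hom (artin_monoid (type_D (n + 1)))
    (artin_lift (type_D (n + 1)) (longest_element (type_D (n + 1)) ({1..2 * m - 1} \<union> K)))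
    (artin_lift (type_D (n + 1)) (longest_element (type_D (n + 1)) ({m + 1..n + 1} \<union> J)))"
proof -
  interpret signed_action "type_D (n + 1)" "action_D n" "height_D n" n "[n, n + 1]"
    by (rule signed_action_D[OF n(1)])
  let ?\<tau> = "transpose n (n + 1)"
  let ?a = "gen_op (n - 1)" and ?b = "gen_op n" and ?c = "gen_op (n + 1)"
  have ab: "?a (?b (?a X)) = ?b (?a (?b X))" and ac: "?a (?c (?a X)) = ?c (?a (?c X))"
    and bc: "?b (?c X) = ?c (?b X)" for X
    using gen_op_bond3[of "n - 1" n X] gen_op_bond3[of "n - 1" "n + 1" X] gen_op_bond2[of n "n + 1" X] n
    by (simp_all add: nodes_D bond_D doubleton_eq_iff)
  have yn: "y n X = ?b (?c X)" for X by (subst y_last) simp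
  \<comment> \<open>\<open>y (n - 1)\<close> is \<open>?a ?b ?c ?a\<close> and exchanges
    \<open>?b\<close> and \<open>?c\<close> by two braid relations. For smaller \<open>i\<close> the
    new outer letters commute with both.\<close>
  have y_swap: "?b (y i X) = y i (?c X) \<and> ?c (y i X) = y i (?b X)" if "1 \<le> i" "i \<le> n - 1" for i X
    using that
  proof (induction "nat (n - 1 - i)" arbitrary: i X)
    case 0
    then have i: "i = n - 1" by simp
    have y: "y i Z = ?a (?b (?c (?a Z)))" for Z
      using y_rec[of i Z] yn i by simp
    have "?b (?a (?b (?c (?a X)))) = ?a (?b (?a (?c (?a X))))" by (simp only: ab)
    also have "\<dots> = ?a (?b (?c (?a (?c X))))" by (simp only: ac)
    finally have 1: "?b (y i X) = y i (?c X)" unfolding y .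
    have "?c (?a (?b (?c (?a X)))) = ?c (?a (?c (?b (?a X))))" by (simp only: bc)
    also have "\<dots> = ?a (?c (?a (?b (?a X))))" by (simp only: ac)
    also have "\<dots> = ?a (?c (?b (?a (?b X))))" by (simp only: ab)
    also have "\<dots> = ?a (?b (?c (?a (?b X))))" by (simp only: bc)
    finally have "?c (y i X) = y i (?b X)" unfolding y .
    with 1 show ?case by blast
  next
    case (Suc l)
    then have i: "i + 1 \<le> n - 1" by simp
    have IH: "?b (y (i + 1) Z) = y (i + 1) (?c Z)" "?c (y (i + 1) Z) = y (i + 1) (?b Z)" for Z
      using Suc.hyps(1)[of "i + 1" Z] Suc.hyps(2) Suc.prems i by simp_all
    have T: "?b (gen_op i Z) = gen_op i (?b Z)" "?c (gen_op i Z) = gen_op i (?c Z)" for Z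
      using gen_op_bond2[of n i Z] gen_op_bond2[of "n + 1" i Z] bond_D_far[of i n n] bond_D_far[of i "n + 1" n]
        bond_D_sym[of n n i] bond_D_sym[of n "n + 1" i] Suc.prems i by (simp_all add: nodes_D)
    have y: "y i Z = gen_op i (y (i + 1) (gen_op i Z))" for Z
      using Suc.prems(2) by (rule y_rec)
    show ?case unfolding y T IH by blast
  qed
  have y_n: "?b (y n X) = y n (?b X)" "?c (y n X) = y n (?c X)" for X
    unfolding yn by (simp_all only: bc)
  \<comment> \<open>All factors except \<open>y n\<close> exchange the two tail generators, so there
    are \<open>n - a\<close> exchanges.\<close>
  have ys_tail: "(even (n - a) \<longrightarrow> ?b (ys a n X) = ys a n (?b X) \<and> ?c (ys a n X) = ys a n (?c X))
      \<and> (odd (n - a) \<longrightarrow> ?b (ys a n X) = ys a n (?c X) \<and> ?c (ys a n X) = ys a n (?b X))"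
    if "1 \<le> a" "a \<le> n" for a X
    using that
  proof (induction "nat (n - a)" arbitrary: a)
    case 0
    then have "a = n" by simp
    moreover have "ys n n Z = y n Z" for Z by simp
    moreover have "even (n - n)" by simp
    ultimately show ?case using y_n by metis
  next
    case (Suc l)
    then have a: "a \<le> n - 1" by simp
    have rec: "ys a n Z = y a (ys (a + 1) n Z)" for Z using a by (simp add: upto_rec1)
    have sw: "?b (y a Z) = y a (?c Z)" "?c (y a Z) = y a (?b Z)" for Z
      using y_swap[of a Z] Suc.prems(1) a by blast+
    have par: "even (n - a) \<longleftrightarrow> odd (n - (a + 1))" by presburger
    have "l = nat (n - (a + 1))" "1 \<le> a + 1" "a + 1 \<le> n" using Suc.hyps(2) Suc.prems a by simp_all
    note IH = Suc.hyps(1)[OF this]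
    show ?case unfolding rec sw par using IH by (metis (no_types, lifting))
  qed
  \<comment> \<open>For \<open>a = m + 1\<close> there are \<open>n - m - 1\<close> exchanges, an
    odd number exactly when \<open>n - m\<close> is even.\<close>
  define \<sigma> where "\<sigma> = (if even (n - m) then ?\<tau> else (\<lambda>i. i))"
  have mn: "m + 1 \<le> n" using m n by simp
  have parity: "even (n - (m + 1)) \<longleftrightarrow> odd (n - m)" by presburger
  have K_low: "2 * m + 1 \<le> s \<and> s \<le> n + 1" if "s \<in> K" for s using that K by auto
  \<comment> \<open>The exchange can lower \<open>n + 1\<close> to \<open>n\<close>, which stays at
    or above \<open>2 * m + 1\<close> unless \<open>n = 2 * m\<close>; in that case the extra
    assumption makes \<open>K\<close> empty.\<close>
  have \<sigma>_low: "2 * m + 1 \<le> \<sigma> s \<and> \<sigma> s \<le> n + 1" if "s \<in> K" for s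
    using K_low[OF that] K' that n by (cases "n = 2 * m") (auto simp: \<sigma>_def transpose_def)
  have empty: "K = {}" if "n = 2 * m"
    using that K K' by (auto simp: subset_iff)
  have \<sigma>\<sigma>: "\<sigma> (\<sigma> s) = s" for s by (simp add: \<sigma>_def)
  have \<sigma>_ys: "gen_op s (ys (m + 1) n X) = ys (m + 1) n (gen_op (\<sigma> s) X)"
    if s: "2 * m + 1 \<le> s" "s \<le> n + 1" for s X
  proof (cases "s \<le> n - 1")
    case True
    then have "\<sigma> s = s" by (simp add: \<sigma>_def transpose_def)
    moreover have "gen_op s (ys (m + 1) n X) = ys (m + 1) n (gen_op s X)"
      using True s m by (intro T_ys) auto
    ultimately show ?thesis by (simp only:)
  next
    case False
    then have "s = n \<or> s = n + 1" using s by linarith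
    then show ?thesis
      using ys_tail[of "m + 1" X] parity m mn by (auto simp: \<sigma>_def split: if_splits)
  qed
  have set_eq: "{j \<in> nodes (type_D (n + 1)). m + 1 \<le> j} = {m + 1..n + 1}" using m by (auto simp: nodes_D)
  show ?thesis
    unfolding set_eq[symmetric]
  proof (rule signed_B2_hom[OF m n(2) J, of K \<sigma>])
    show "K \<subseteq> {j \<in> nodes (type_D (n + 1)). 2 * m + 1 \<le> j}" using K m by (auto simp: nodes_D)
    show "\<sigma> ` K \<subseteq> nodes (type_D (n + 1))" using \<sigma>_low m by (fastforce simp: nodes_D)
    show "bond (type_D (n + 1)) i k = 2 \<and> bond (type_D (n + 1)) i (\<sigma> k) = 2"
      if "1 \<le> i" "i \<le> 2 * m - 1" "k \<in> K" for i k
    proof -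
      \<comment> \<open>Then \<open>i \<le> 2 * m - 1 < n - 1\<close>, so the edge from
        \<open>n - 1\<close> to the branch node \<open>n + 1\<close> is not met.\<close>
      have "n \<noteq> 2 * m" using empty that(3) by blast
      then have "\<not> (i = n - 1)" using that n by linarith
      then show ?thesis using bond_D_far[of i k n] bond_D_far[of i "\<sigma> k" n] that K_low \<sigma>_low by force
    qed
    show "bond (type_D (n + 1)) i j = 2" if "i \<in> J" "j \<in> nodes (type_D (n + 1))" "m + 1 \<le> j" for i j
      using that J m n by (intro bond_D_far) auto
    show "gen_op s (ys (m + 1) n X) = ys (m + 1) n (gen_op (\<sigma> s) X)" if "s \<in> K" for s X
      using K_low[OF that] by (intro \<sigma>_ys) auto
    show "gen_op (\<sigma> s) (ys (m + 1) n X) = ys (m + 1) n (gen_op s X)" if "s \<in> K" for s X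
      using \<sigma>_ys[of "\<sigma> s" X] \<sigma>_low[OF that] by (simp add: \<sigma>\<sigma>)
    show "foldr gen_op (map \<sigma> u) (foldr gen_op u X) = foldr gen_op u (foldr gen_op (map \<sigma> u) X)"
      if u: "longest_word K u" for u X
    proof (cases "even (n - m)")
      case True
      have "K \<subseteq> nodes (type_D (n + 1))" using K m by (auto simp: nodes_D)
      then show ?thesis
        using weakly_orthogonal_commute[OF diagram_involution_D[OF n(1)] _ wo[OF True] u] True
        by (simp add: \<sigma>_def)
    next
      case False
      then show ?thesis by (simp add: \<sigma>_def)
    qed
  qed
qed

theorem theorem6p7:
  fixes m :: int and J :: "int set"
  assumes "m \<ge> 0" and "J \<subseteq> {1..m - 1}"
  shows
    "(\<forall>(n::int) K. n \<ge> 1 \<and> n \<ge> 4 * m - 1 \<and> K \<subseteq> {2 * m + 1..n - 2 * m} \<and>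
        weakly_orthogonal (type_A n) K ((\<lambda>k. n + 1 - k) ` K) \<longrightarrow>
        defines_B2_hom (artin_monoid (type_A n))
          (artin_lift (type_A n)
             (longest_element (type_A n) ({1..2 * m - 1} \<union> {n + 2 - 2 * m..n} \<union> K)))
          (artin_lift (type_A n)
             (longest_element (type_A n) ({m + 1..n - m} \<union> J \<union> (\<lambda>j. n + 1 - j) ` J))))
   \<and> (\<forall>(n::int) K. n \<ge> 2 \<and> n \<ge> 2 * m \<and> K \<subseteq> {2 * m + 1..n} \<longrightarrow>
        defines_B2_hom (artin_monoid (type_B n))
          (artin_lift (type_B n) (longest_element (type_B n) ({1..2 * m - 1} \<union> K)))
          (artin_lift (type_B n) (longest_element (type_B n) ({m + 1..n} \<union> J))))
   \<and> (\<forall>(n::int) K. n \<ge> 3 \<and> n \<ge> 2 * m \<and> K \<subseteq> {2 * m + 1..n + 1} \<and>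
        (n = 2 * m \<longrightarrow> n + 1 \<notin> K) \<and>
        (even (n - m) \<longrightarrow>
           weakly_orthogonal (type_D (n + 1)) K (transpose n (n + 1) ` K)) \<longrightarrow>
        defines_B2_hom (artin_monoid (type_D (n + 1)))
          (artin_lift (type_D (n + 1))
             (longest_element (type_D (n + 1)) ({1..2 * m - 1} \<union> K)))
          (artin_lift (type_D (n + 1))
             (longest_element (type_D (n + 1)) ({m + 1..n + 1} \<union> J))))"
proof (intro conjI allI impI; elim conjE)
  note m = assms
  show "defines_B2_hom (artin_monoid (type_A n))
      (artin_lift (type_A n) (longest_element (type_A n) ({1..2 * m - 1} \<union> {n + 2 - 2 * m..n} \<union> K)))
      (artin_lift (type_A n) (longest_element (type_A n) ({m + 1..n - m} \<union> J \<union> (\<lambda>j. n + 1 - j) ` J)))"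
    if "n \<ge> 4 * m - 1" "K \<subseteq> {2 * m + 1..n - 2 * m}"
      "weakly_orthogonal (type_A n) K ((\<lambda>k. n + 1 - k) ` K)" for n K
    by (rule defines_B2_hom_type_A[OF m that])
  show "defines_B2_hom (artin_monoid (type_B n))
      (artin_lift (type_B n) (longest_element (type_B n) ({1..2 * m - 1} \<union> K)))
      (artin_lift (type_B n) (longest_element (type_B n) ({m + 1..n} \<union> J)))"
    if "n \<ge> 2" "n \<ge> 2 * m" "K \<subseteq> {2 * m + 1..n}" for n K
    by (rule defines_B2_hom_type_B[OF m that])
  show "defines_B2_hom (artin_monoid (type_D (n + 1)))
      (artin_lift (type_D (n + 1)) (longest_element (type_D (n + 1)) ({1..2 * m - 1} \<union> K)))
      (artin_lift (type_D (n + 1)) (longest_element (type_D (n + 1)) ({m + 1..n + 1} \<union> J)))"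
    if "n \<ge> 3" "n \<ge> 2 * m" "K \<subseteq> {2 * m + 1..n + 1}" "n = 2 * m \<longrightarrow> n + 1 \<notin> K"
      "even (n - m) \<longrightarrow> weakly_orthogonal (type_D (n + 1)) K (transpose n (n + 1) ` K)" for n K
    by (rule defines_B2_hom_type_D[OF m that(1-3)]) (use that(4,5) in simp_all)
qed

end
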